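(* Let $R$ and $C$ be two disjoint copies of $\mathbb N$, let $I\subseteq R\times C$, and let $G$ be the bipartite graph with vertex classes $C$ and $R$ whose edges are the pairs $\{r,c\}$ with $(r,c)\in I$. Let $p\in\{2,4,6,\dots\}$. Then the following are equivalent: (1) $S^p_I$ has the complex metric unconditional approximation property; (2) $S^p_I$ has the real metric unconditional approximation property; (3) any two vertices $r\in R$ and $c\in C$ whose distance in $G$ is $2j+1\le p/2$ (with $j\ge0$ an integer) have asymptotic distance $d_\infty(r,c)\ge p-2j+1$.
   Context: $S^p$ is the Schatten-von-Neumann class of compact operators $x\colon\ell^2_C\to\ell^2_R$ with $\|x\|_p^p=\operatorname{tr}(x^*x)^{p/2}<\infty$. $S^p_I$ is the closed subspace of those $x\in S^p$ whose matrix coefficients $x_{rc}$ vanish for $(r,c)\notin I$. Let $X$ be a separable Banach space. An approximating sequence on $X$ is a sequence $(T_k)$ of finite rank operators on $X$ with $\|T_kx-x\|\to0$ for every $x\in X$. Put $\Delta T_1=T_1$ and $\Delta T_k=T_k-T_{k-1}$ for $k\ge2$. The complex (resp. real) unconditional constant of $(T_k)$ is the least $D$ such that $\|\sum_{k=1}^n\epsilon_k\Delta T_k\|\le D$ for all $n$ and all $\epsilon_k\in\mathbb T=\{z\in\mathbb C:|z|=1\}$ (resp. $\epsilon_k\in\{-1,1\}$). $X$ has the complex (resp. real) metric unconditional approximation property if for every $\delta>0$ it has an approximating sequence with complex (resp. real) unconditional constant at most $1+\delta$. The distance of two vertices in a graph is the minimal length (number of edges) of a path joining them, and is infinite if there is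 no such path. The asymptotic distance $d_\infty(r,c)$ of $r\in R$ and $c\in C$ in $I$ is the supremum, over all finite rectangle sets $R'\times C'\subseteq R\times C$, of the distance from $r$ to $c$ in the graph with edge set $I\setminus (R'\times C')$. *)

theory Defs
  imports "HOL-Analysis.Analysis" "HOL-Library.Extended_Nat"
begin

section \<open>Complex vector spaces\<close>

class scaleC =
  fixes scaleC :: "complex \<Rightarrow> 'a \<Rightarrow> 'a" (infixr "*\<^sub>C" 75)

class complex_vector = real_vector + scaleC +
  assumes scaleC_add_right: "z *\<^sub>C (x + y) = z *\<^sub>C x + z *\<^sub>C y"
    and scaleC_add_left: "(z + w) *\<^sub>C x = z *\<^sub>C x + w *\<^sub>C x"
    and scaleC_scaleC: "z *\<^sub>C w *\<^sub>C x = (z * w) *\<^sub>C x"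
    and scaleC_one: "1 *\<^sub>C x = x"
    and scaleR_scaleC: "r *\<^sub>R x = complex_of_real r *\<^sub>C x"

class complex_normed_vector = complex_vector + real_normed_vector +
  assumes norm_scaleC: "norm (z *\<^sub>C x) = cmod z * norm x"

global_interpretation complex_vector:
  vector_space "scaleC :: complex \<Rightarrow> 'a \<Rightarrow> 'a::complex_vector"
  defines cspan = complex_vector.span
  by unfold_locales (simp_all add: scaleC_add_right scaleC_add_left scaleC_scaleC scaleC_one)

lemma bounded_linear_scaleC:
  "bounded_linear (\<lambda>x::'a::complex_normed_vector. z *\<^sub>C x)"
proof (rule bounded_linear_intro[where K = "cmod z"])
  fix r and x y :: 'a
  show "z *\<^sub>C (x + y) = z *\<^sub>C x + z *\<^sub>C y"
    by (rule scaleC_add_right)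
  show "z *\<^sub>C (r *\<^sub>R x) = r *\<^sub>R (z *\<^sub>C x)"
    by (simp add: scaleR_scaleC scaleC_scaleC mult.commute)
  show "norm (z *\<^sub>C x) \<le> norm x * cmod z"
    by (simp add: norm_scaleC mult.commute)
qed

instantiation blinfun :: (real_normed_vector, complex_normed_vector) complex_vector
begin

lift_definition scaleC_blinfun :: "complex \<Rightarrow> ('a \<Rightarrow>\<^sub>L 'b) \<Rightarrow> 'a \<Rightarrow>\<^sub>L 'b"
  is "\<lambda>z f v. z *\<^sub>C f v"
  by (rule bounded_linear_compose[OF bounded_linear_scaleC])

instance
  by standard
    (transfer, simp add: scaleC_add_right scaleC_add_left scaleC_scaleC scaleC_one scaleR_scaleC)+

end


section \<open>The Hilbert space of square-summable sequences\<close>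

typedef ell2 = "{f :: nat \<Rightarrow> complex. summable (\<lambda>i. (cmod (f i))\<^sup>2)}"
  morphisms coord Abs_ell2
  by (rule exI[of _ "\<lambda>_. 0"]) simp

setup_lifting type_definition_ell2

lemma summable_ell2_mult:
  fixes f g :: "nat \<Rightarrow> complex"
  assumes "summable (\<lambda>i. (cmod (f i))\<^sup>2)" "summable (\<lambda>i. (cmod (g i))\<^sup>2)"
  shows "summable (\<lambda>i. f i * cnj (g i))"
proof (rule summable_comparison_test')
  show "summable (\<lambda>i. (cmod (f i))\<^sup>2 + (cmod (g i))\<^sup>2)"
    by (rule summable_add[OF assms])
  fix n :: nat
  have "2 * (cmod (f n) * cmod (g n)) \<le> (cmod (f n))\<^sup>2 + (cmod (g n))\<^sup>2"
    using sum_squares_bound[of "cmod (f n)" "cmod (g n)"] by (simp only: mult.assoc)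
  moreover have "0 \<le> cmod (f n) * cmod (g n)"
    by simp
  ultimately have "cmod (f n) * cmod (g n) \<le> (cmod (f n))\<^sup>2 + (cmod (g n))\<^sup>2"
    by linarith
  then show "norm (f n * cnj (g n)) \<le> (cmod (f n))\<^sup>2 + (cmod (g n))\<^sup>2"
    by (simp add: norm_mult)
qed

lemma summable_ell2_add:
  fixes f g :: "nat \<Rightarrow> complex"
  assumes "summable (\<lambda>i. (cmod (f i))\<^sup>2)" "summable (\<lambda>i. (cmod (g i))\<^sup>2)"
  shows "summable (\<lambda>i. (cmod (f i + g i))\<^sup>2)"
proof (rule summable_comparison_test')
  show "summable (\<lambda>i. 2 * (cmod (f i))\<^sup>2 + 2 * (cmod (g i))\<^sup>2)"
    by (intro summable_add summable_mult assms)
  fix n :: nat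
  have "(cmod (f n + g n))\<^sup>2 \<le> (cmod (f n) + cmod (g n))\<^sup>2"
    by (intro power_mono norm_triangle_ineq) auto
  moreover have "0 \<le> (cmod (f n) - cmod (g n))\<^sup>2"
    by simp
  ultimately show "norm ((cmod (f n + g n))\<^sup>2) \<le> 2 * (cmod (f n))\<^sup>2 + 2 * (cmod (g n))\<^sup>2"
    by (simp add: power2_diff power2_sum)
qed

instantiation ell2 :: complex_vector
begin

lift_definition zero_ell2 :: ell2 is "\<lambda>_. 0"
  by simp

lift_definition plus_ell2 :: "ell2 \<Rightarrow> ell2 \<Rightarrow> ell2" is "\<lambda>f g i. f i + g i"
  by (simp add: summable_ell2_add)

lift_definition uminus_ell2 :: "ell2 \<Rightarrow> ell2" is "\<lambda>f i. - f i"
  by simp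

lift_definition minus_ell2 :: "ell2 \<Rightarrow> ell2 \<Rightarrow> ell2" is "\<lambda>f g i. f i - g i"
  using summable_ell2_add[of _ "\<lambda>i. - _ i"] by simp

lift_definition scaleR_ell2 :: "real \<Rightarrow> ell2 \<Rightarrow> ell2" is "\<lambda>r f i. complex_of_real r * f i"
  by (simp add: norm_mult power_mult_distrib summable_mult)

lift_definition scaleC_ell2 :: "complex \<Rightarrow> ell2 \<Rightarrow> ell2" is "\<lambda>z f i. z * f i"
  by (simp add: norm_mult power_mult_distrib summable_mult)

instance
  by standard (transfer, simp add: algebra_simps)+

end

lift_definition cinner :: "ell2 \<Rightarrow> ell2 \<Rightarrow> complex"
  is "\<lambda>f g. \<Sum>i. f i * cnj (g i)" .

instantiation ell2 :: real_inner
begin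

definition inner_ell2 :: "ell2 \<Rightarrow> ell2 \<Rightarrow> real"
  where "inner_ell2 x y = Re (cinner x y)"

definition norm_ell2 :: "ell2 \<Rightarrow> real"
  where "norm_ell2 x = sqrt (\<Sum>i. (cmod (coord x i))\<^sup>2)"

definition dist_ell2 :: "ell2 \<Rightarrow> ell2 \<Rightarrow> real"
  where "dist_ell2 x y = norm (x - y)"

definition sgn_ell2 :: "ell2 \<Rightarrow> ell2"
  where "sgn_ell2 x = x /\<^sub>R norm x"

definition uniformity_ell2 :: "(ell2 \<times> ell2) filter"
  where "uniformity_ell2 = (INF e\<in>{0<..}. principal {(x, y). dist x y < e})"

definition open_ell2 :: "ell2 set \<Rightarrow> bool"
  where "open_ell2 U = (\<forall>x\<in>U. eventually (\<lambda>(x', y). x' = x \<longrightarrow> y \<in> U) uniformity)"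

instance
proof
  have inner_eq: "inner x y = (\<Sum>i. Re (coord x i * cnj (coord y i)))" for x y :: ell2
    unfolding inner_ell2_def cinner.rep_eq
    using summable_ell2_mult[of "coord x" "coord y"] coord[of x] coord[of y]
    by (intro Re_suminf) simp
  have summ: "summable (\<lambda>i. Re (coord x i * cnj (coord y i)))" for x y :: ell2
    using summable_ell2_mult[of "coord x" "coord y"] coord[of x] coord[of y]
    by (intro summable_Re) simp
  have sq: "Re (coord x i * cnj (coord x i)) = (cmod (coord x i))\<^sup>2" for x :: ell2 and i
    by (subst complex_norm_square[symmetric]) simp
  fix x y z :: ell2 and r :: real and U :: "ell2 set"
  show "dist x y = norm (x - y)" by (rule dist_ell2_def)
  show "sgn x = x /\<^sub>R norm x" by (rule sgn_ell2_def)
  show "uniformity = (INF e\<in>{0<..}. principal {(x, y). dist x (y::ell2) < e})"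
    by (rule uniformity_ell2_def)
  show "open U = (\<forall>x\<in>U. eventually (\<lambda>(x', y). x' = x \<longrightarrow> y \<in> U) uniformity)"
    by (rule open_ell2_def)
  show "inner x y = inner y x"
    unfolding inner_eq by (simp add: mult.commute)
  show "inner (x + y) z = inner x z + inner y z"
    unfolding inner_eq suminf_add[OF summ summ]
    by (simp add: plus_ell2.rep_eq algebra_simps)
  show "inner (r *\<^sub>R x) y = r * inner x y"
    unfolding inner_eq suminf_mult[OF summ, symmetric]
    by (simp add: scaleR_ell2.rep_eq algebra_simps)
  show "0 \<le> inner x x"
    unfolding inner_eq sq using coord[of x] by (intro suminf_nonneg) auto
  show "inner x x = 0 \<longleftrightarrow> x = 0"
    unfolding inner_eq sq using coord[of x]
    by (subst suminf_eq_zero_iff) (auto simp: coord_inject[symmetric] zero_ell2.rep_eq)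
  show "norm x = sqrt (inner x x)"
    unfolding inner_eq sq norm_ell2_def ..
qed

end

instance ell2 :: complex_normed_vector
proof
  fix z :: complex and x :: ell2
  have "(\<Sum>i. (cmod (coord (z *\<^sub>C x) i))\<^sup>2) = (cmod z)\<^sup>2 * (\<Sum>i. (cmod (coord x i))\<^sup>2)"
    using coord[of x]
    by (subst suminf_mult[symmetric])
      (auto simp: scaleC_ell2.rep_eq norm_mult power_mult_distrib)
  then show "norm (z *\<^sub>C x) = cmod z * norm x"
    by (simp add: norm_ell2_def real_sqrt_mult)
qed

lift_definition basis_vec :: "nat \<Rightarrow> ell2" is "\<lambda>k i. if i = k then 1 else 0"
  by (rule summable_finite[of "{_}"]) (auto split: if_splits)


section \<open>Schatten classes\<close>

text \<open>Both index sets \<open>R\<close> and \<open>C\<close> are represented by \<^typ>\<open>nat\<close>. The library type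
  \<open>ell2 \<Rightarrow>\<^sub>L ell2\<close> consists of the bounded \<^emph>\<open>real-linear\<close> maps; complex
  linearity is imposed separately.\<close>

definition clinear_op :: "(ell2 \<Rightarrow>\<^sub>L ell2) \<Rightarrow> bool"
  where "clinear_op x \<longleftrightarrow> (\<forall>z v. blinfun_apply x (z *\<^sub>C v) = z *\<^sub>C blinfun_apply x v)"

definition compact_op :: "(ell2 \<Rightarrow>\<^sub>L ell2) \<Rightarrow> bool"
  where "compact_op x \<longleftrightarrow> compact (closure (blinfun_apply x ` cball 0 1))"

definition adj_op :: "(ell2 \<Rightarrow>\<^sub>L ell2) \<Rightarrow> ell2 \<Rightarrow>\<^sub>L ell2"
  where "adj_op x = (THE y. \<forall>u v. cinner (blinfun_apply x u) v = cinner u (blinfun_apply y v))"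

text \<open>The trace is only used for positive operators, whose diagonal entries are nonnegative
  reals; it may be infinite.\<close>

definition pos_trace :: "(ell2 \<Rightarrow> ell2) \<Rightarrow> ennreal"
  where "pos_trace A = (\<Sum>c. ennreal (Re (cinner (A (basis_vec c)) (basis_vec c))))"

text \<open>\<open>tr ((x\<^sup>* x)\<^bsup>p/2\<^esup>)\<close> for even \<open>p\<close>, where the power is an iterated composition.\<close>

definition schatten_trace :: "nat \<Rightarrow> (ell2 \<Rightarrow>\<^sub>L ell2) \<Rightarrow> ennreal"
  where "schatten_trace p x = pos_trace (blinfun_apply (adj_op x o\<^sub>L x) ^^ (p div 2))"

definition schatten_norm :: "nat \<Rightarrow> (ell2 \<Rightarrow>\<^sub>L ell2) \<Rightarrow> real"
  where "schatten_norm p x = enn2real (schatten_trace p x) powr (1 / real p)"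

definition schatten_class :: "nat \<Rightarrow> (ell2 \<Rightarrow>\<^sub>L ell2) set"
  where "schatten_class p = {x. clinear_op x \<and> compact_op x \<and> schatten_trace p x < \<infinity>}"

definition matrix_coeff :: "(ell2 \<Rightarrow>\<^sub>L ell2) \<Rightarrow> nat \<Rightarrow> nat \<Rightarrow> complex"
  where "matrix_coeff x r c = coord (blinfun_apply x (basis_vec c)) r"

text \<open>Pairs in \<open>I\<close> are ordered as (row, column).\<close>

definition schatten_subspace :: "nat \<Rightarrow> (nat \<times> nat) set \<Rightarrow> (ell2 \<Rightarrow>\<^sub>L ell2) set"
  where "schatten_subspace p I =
    {x \<in> schatten_class p. \<forall>r c. (r, c) \<notin> I \<longrightarrow> matrix_coeff x r c = 0}"


section \<open>Metric unconditional approximation\<close>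

text \<open>In this section a complex normed space is given by a linear subspace \<open>X\<close> of a complex
  vector space together with a norm \<open>N\<close> on \<open>X\<close>, which need not be the norm of the ambient type.
  Operators on \<open>X\<close> are functions on the ambient type of which only the values on \<open>X\<close> matter.\<close>

definition finite_rank_operator ::
    "'a::complex_vector set \<Rightarrow> ('a \<Rightarrow> real) \<Rightarrow> ('a \<Rightarrow> 'a) \<Rightarrow> bool"
  where "finite_rank_operator X N T \<longleftrightarrow>
    T ` X \<subseteq> X \<and>
    (\<forall>x\<in>X. \<forall>y\<in>X. T (x + y) = T x + T y) \<and>
    (\<forall>z. \<forall>x\<in>X. T (z *\<^sub>C x) = z *\<^sub>C T x) \<and>
    (\<exists>K. \<forall>x\<in>X. N (T x) \<le> K * N x) \<and>
    (\<exists>B. finite B \<and> T ` X \<subseteq> cspan B)"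

text \<open>Sequences of operators are indexed from \<open>1\<close>; the value at \<open>0\<close> is irrelevant.\<close>

definition approximating_sequence ::
    "'a::complex_vector set \<Rightarrow> ('a \<Rightarrow> real) \<Rightarrow> (nat \<Rightarrow> 'a \<Rightarrow> 'a) \<Rightarrow> bool"
  where "approximating_sequence X N T \<longleftrightarrow>
    (\<forall>k\<ge>1. finite_rank_operator X N (T k)) \<and>
    (\<forall>x\<in>X. (\<lambda>k. N (T k x - x)) \<longlonglongrightarrow> 0)"

definition op_diff :: "(nat \<Rightarrow> 'a \<Rightarrow> 'a) \<Rightarrow> nat \<Rightarrow> 'a \<Rightarrow> 'a::complex_vector"
  where "op_diff T k x = (if k = 1 then T 1 x else T k x - T (k - 1) x)"

definition operator_norm :: "'a::complex_vector set \<Rightarrow> ('a \<Rightarrow> real) \<Rightarrow> ('a \<Rightarrow> 'a) \<Rightarrow> ereal"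
  where "operator_norm X N S = (SUP x\<in>{x \<in> X. N x \<le> 1}. ereal (N (S x)))"

text \<open>\<open>E\<close> is the set of admissible signs. The constant is \<open>\<infinity>\<close> if there is no finite bound.\<close>

definition unconditional_constant ::
    "complex set \<Rightarrow> 'a::complex_vector set \<Rightarrow> ('a \<Rightarrow> real) \<Rightarrow> (nat \<Rightarrow> 'a \<Rightarrow> 'a) \<Rightarrow> ereal"
  where "unconditional_constant E X N T =
    Inf {D. \<forall>n \<epsilon>. (\<forall>k. \<epsilon> k \<in> E) \<longrightarrow>
      operator_norm X N (\<lambda>x. \<Sum>k=1..n. \<epsilon> k *\<^sub>C op_diff T k x) \<le> D}"

definition muap :: "complex set \<Rightarrow> 'a::complex_vector set \<Rightarrow> ('a \<Rightarrow> real) \<Rightarrow> bool"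
  where "muap E X N \<longleftrightarrow>
    (\<forall>\<delta>>0. \<exists>T. approximating_sequence X N T \<and>
      unconditional_constant E X N T \<le> ereal (1 + \<delta>))"

definition complex_muap :: "'a::complex_vector set \<Rightarrow> ('a \<Rightarrow> real) \<Rightarrow> bool"
  where "complex_muap = muap {z. cmod z = 1}"

definition real_muap :: "'a::complex_vector set \<Rightarrow> ('a \<Rightarrow> real) \<Rightarrow> bool"
  where "real_muap = muap {-1, 1}"


section \<open>The bipartite graph\<close>

text \<open>The row vertex \<open>r\<close> is \<open>Inl r\<close> and the column vertex \<open>c\<close> is \<open>Inr c\<close>.\<close>

definition adjacent :: "(nat \<times> nat) set \<Rightarrow> nat + nat \<Rightarrow> nat + nat \<Rightarrow> bool"
  where "adjacent I u v \<longleftrightarrow> (\<exists>(r, c)\<in>I. {u, v} = {Inl r, Inr c})"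

definition is_path :: "(nat \<times> nat) set \<Rightarrow> nat + nat \<Rightarrow> nat + nat \<Rightarrow> (nat + nat) list \<Rightarrow> bool"
  where "is_path I u v vs \<longleftrightarrow>
    vs \<noteq> [] \<and> hd vs = u \<and> last vs = v \<and> distinct vs \<and> successively (adjacent I) vs"

definition graph_dist :: "(nat \<times> nat) set \<Rightarrow> nat + nat \<Rightarrow> nat + nat \<Rightarrow> enat"
  where "graph_dist I u v = (INF vs\<in>{vs. is_path I u v vs}. enat (length vs - 1))"

definition asymptotic_dist :: "(nat \<times> nat) set \<Rightarrow> nat \<Rightarrow> nat \<Rightarrow> enat"
  where "asymptotic_dist I r c =
    (SUP (R', C')\<in>{(R', C'). finite R' \<and> finite C'}. graph_dist (I - R' \<times> C') (Inl r) (Inr c))"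

end

theory Submission
  imports Defs
begin

text \<open>Let \<open>p = 2 m\<close>. Then \<open>\<parallel>x\<parallel>\<^sup>p = tr ((x\<^sup>* x)\<^sup>m)\<close> is a sum over the closed walks of length \<open>p\<close> in
  the graph, with weights that use the matrix coefficients of \<open>x\<close> and of \<open>x\<^sup>*\<close> alternately.

  Let \<open>x\<close> live on a finite square and \<open>y\<close> far outside. If the graph condition holds, every closed walk
  decomposes into pieces in the support of \<open>x\<close> and pieces of even length in the support of \<open>y\<close>: a far
  piece of odd length would join two vertices of the square, and the rest of the walk would make
  them too close. Hence a unimodular factor \<open>\<mu>\<close> on \<open>y\<close> cancels and \<open>\<parallel>x + \<mu> y\<parallel> = \<parallel>x + y\<parallel>\<close>. Averaging the
  truncations to many nested squares yields Schur multipliers \<open>\<alpha>\<^sub>k\<close> for which the norm of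
  \<open>\<alpha>\<^sub>k + \<mu> (1 - \<alpha>\<^sub>k)\<close> is almost \<open>1\<close>, because \<open>\<parallel>x\<parallel>\<^sup>p\<close> is superadditive over blocks of rows and over
  blocks of columns. Since \<open>\<alpha>\<^sub>k \<alpha>\<^sub>l = \<alpha>\<^sub>k\<close> for \<open>k < l\<close>, signed sums of the differences of the \<open>\<alpha>\<^sub>k\<close> are
  products of such multipliers.

  Conversely, the real property forces \<open>\<parallel>x + y\<parallel>\<close> and \<open>\<parallel>x - y\<parallel>\<close> to be almost equal when \<open>y\<close> is far away:
  finite rank operators nearly annihilate far unit matrices, as the norm is dominated by the
  Hilbert-Schmidt norm. If the graph condition fails, let \<open>x\<close> and \<open>y\<close> be the indicators of a near path
  and a far path that together form a closed walk of length at most \<open>p\<close>. All walks have nonnegative weight for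
  \<open>x + y\<close>, and this one changes its sign for \<open>x - y\<close>, so the norms differ by a fixed amount.\<close>

section \<open>Row- and column-finite matrices\<close>

text \<open>As \<open>p\<close> is even, the \<open>p\<close>-th power of the norm is a polynomial
  in the entries and their conjugates. All norm inequalities come from Cauchy-Schwarz for traces in
  finite corners, and the norm of an infinite matrix is the supremum over its corners.

  The obstacle to sufficiency is that \<open>\<mu>\<close> cancels only if nothing lies between the
  small and the large square. Deleting this annulus costs its norm, and which annuli are light
  depends on the matrix, so no fixed square works. The average over \<open>L\<close> squares costs
  only the mean of \<open>L\<close> annulus norms; their \<open>p\<close>-th powers have a bounded
  sum, so this mean is of order \<open>L^(-1/p)\<close>.

  The number \<open>p - 2 j + 1\<close> reflects parity: distances between a row and a column are
  odd, so violating the bound means a far path of length at most \<open>p - 2 j - 1\<close>, which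
  is what closes a near path of length \<open>2 j + 1\<close> to a walk of length at most
  \<open>p\<close>. For necessity, the signs enter only through the operators
  \<open>2 T_k - 1\<close>: these are almost contractions, yet they send \<open>x - y\<close> almost
  to \<open>x + y\<close>, whose norm has a \<open>p\<close>-th power larger by at least 2.\<close>

text \<open>Row- and column-finite instead of finite matrices, so that there is a unit and the ring
  operations of the library are available. Traces are only taken of matrices in a finite corner.\<close>

typedef rcm = "{A :: nat \<Rightarrow> nat \<Rightarrow> complex. (\<forall>i. finite {j. A i j \<noteq> 0}) \<and> (\<forall>j. finite {i. A i j \<noteq> 0})}"
  morphisms ent Abs_rcm
  by (rule exI[of _ "\<lambda>_ _. 0"]) simp

setup_lifting type_definition_rcm

lemma rcm_eqI: "(\<And>i j. ent A i j = ent B i j) \<Longrightarrow> A = B"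
  by (simp add: ent_inject[symmetric] fun_eq_iff)

lemma finite_row: "finite {j. ent A i j \<noteq> 0}" and finite_col: "finite {i. ent A i j \<noteq> 0}"
  using ent[of A] by auto

instantiation rcm :: ring_1
begin

lift_definition zero_rcm :: rcm is "\<lambda>_ _. 0" by simp
lift_definition one_rcm :: rcm is "\<lambda>i j. if i = j then 1 else 0" by simp
lift_definition plus_rcm :: "rcm \<Rightarrow> rcm \<Rightarrow> rcm" is "\<lambda>A B i j. A i j + B i j"
proof -
  fix A B :: "nat \<Rightarrow> nat \<Rightarrow> complex"
  assume A: "(\<forall>i. finite {j. A i j \<noteq> 0}) \<and> (\<forall>j. finite {i. A i j \<noteq> 0})"
    and B: "(\<forall>i. finite {j. B i j \<noteq> 0}) \<and> (\<forall>j. finite {i. B i j \<noteq> 0})"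
  have "finite {j. A i j + B i j \<noteq> 0}" for i
    by (rule finite_subset[of _ "{j. A i j \<noteq> 0} \<union> {j. B i j \<noteq> 0}"]) (use A B in auto)
  moreover have "finite {i. A i j + B i j \<noteq> 0}" for j
    by (rule finite_subset[of _ "{i. A i j \<noteq> 0} \<union> {i. B i j \<noteq> 0}"]) (use A B in auto)
  ultimately show "(\<forall>i. finite {j. A i j + B i j \<noteq> 0}) \<and> (\<forall>j. finite {i. A i j + B i j \<noteq> 0})"
    by blast
qed
lift_definition uminus_rcm :: "rcm \<Rightarrow> rcm" is "\<lambda>A i j. - A i j" by simp
definition minus_rcm :: "rcm \<Rightarrow> rcm \<Rightarrow> rcm" where "minus_rcm A B = A + - B"

lift_definition times_rcm :: "rcm \<Rightarrow> rcm \<Rightarrow> rcm"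
  is "\<lambda>A B i j. \<Sum>k | A i k \<noteq> 0. A i k * B k j"
proof -
  fix A B :: "nat \<Rightarrow> nat \<Rightarrow> complex"
  assume A: "(\<forall>i. finite {j. A i j \<noteq> 0}) \<and> (\<forall>j. finite {i. A i j \<noteq> 0})"
    and B: "(\<forall>i. finite {j. B i j \<noteq> 0}) \<and> (\<forall>j. finite {i. B i j \<noteq> 0})"
  have "finite {j. (\<Sum>k | A i k \<noteq> 0. A i k * B k j) \<noteq> 0}" for i
  proof (rule finite_subset[of _ "\<Union>k\<in>{k. A i k \<noteq> 0}. {j. B k j \<noteq> 0}"])
    show "{j. (\<Sum>k | A i k \<noteq> 0. A i k * B k j) \<noteq> 0} \<subseteq> (\<Union>k\<in>{k. A i k \<noteq> 0}. {j. B k j \<noteq> 0})"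
      by (auto elim!: sum.not_neutral_contains_not_neutral)
    show "finite (\<Union>k\<in>{k. A i k \<noteq> 0}. {j. B k j \<noteq> 0})"
      using A B by auto
  qed
  moreover have "finite {i. (\<Sum>k | A i k \<noteq> 0. A i k * B k j) \<noteq> 0}" for j
  proof (rule finite_subset[of _ "\<Union>k\<in>{k. B k j \<noteq> 0}. {i. A i k \<noteq> 0}"])
    show "{i. (\<Sum>k | A i k \<noteq> 0. A i k * B k j) \<noteq> 0} \<subseteq> (\<Union>k\<in>{k. B k j \<noteq> 0}. {i. A i k \<noteq> 0})"
      by (auto elim!: sum.not_neutral_contains_not_neutral)
    show "finite (\<Union>k\<in>{k. B k j \<noteq> 0}. {i. A i k \<noteq> 0})"
      using A B by auto
  qed
  ultimately show "(\<forall>i. finite {j. (\<Sum>k | A i k \<noteq> 0. A i k * B k j) \<noteq> 0}) \<and>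
      (\<forall>j. finite {i. (\<Sum>k | A i k \<noteq> 0. A i k * B k j) \<noteq> 0})"
    by blast
qed

lemma ent_mult:
  assumes "finite S" "\<And>k. k \<notin> S \<Longrightarrow> ent A i k = 0 \<or> ent B k j = 0"
  shows "ent (A * B) i j = (\<Sum>k\<in>S. ent A i k * ent B k j)"
  unfolding times_rcm.rep_eq
  by (rule sum.mono_neutral_cong) (use assms finite_row in auto)

lemma ent_mult_less:
  assumes "\<And>k. k \<ge> N \<Longrightarrow> ent A i k = 0 \<or> ent B k j = 0"
  shows "ent (A * B) i j = (\<Sum>k<N. ent A i k * ent B k j)"
  by (rule ent_mult) (use assms in auto)

lemma rcm_mult_assoc: "(A * B) * C = A * (B * (C::rcm))"
proof (rule rcm_eqI)
  fix i j
  \<comment> \<open>The row support of \<open>A\<close> and the column support of \<open>C\<close>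
    are finite index sets for all the sums involved, so that the sums can be exchanged.\<close>
  let ?S = "{k. ent A i k \<noteq> 0}" and ?T = "{l. ent C l j \<noteq> 0}"
  have fin: "finite ?S" "finite ?T" by (rule finite_row finite_col)+
  have "ent ((A * B) * C) i j = (\<Sum>l\<in>?T. (\<Sum>k\<in>?S. ent A i k * ent B k l) * ent C l j)"
    using fin by (subst ent_mult[of ?T]) (auto intro!: sum.cong ent_mult)
  also have "\<dots> = (\<Sum>l\<in>?T. \<Sum>k\<in>?S. ent A i k * (ent B k l * ent C l j))"
    by (simp add: sum_distrib_right mult.assoc)
  also have "\<dots> = (\<Sum>k\<in>?S. \<Sum>l\<in>?T. ent A i k * (ent B k l * ent C l j))"
    by (rule sum.swap)
  also have "\<dots> = (\<Sum>k\<in>?S. ent A i k * (\<Sum>l\<in>?T. ent B k l * ent C l j))"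
    by (simp add: sum_distrib_left)
  also have "\<dots> = ent (A * (B * C)) i j"
    using fin by (subst ent_mult[of ?S A]) (auto intro!: sum.cong ent_mult[symmetric])
  finally show "ent ((A * B) * C) i j = ent (A * (B * C)) i j" .
qed

instance
proof
  fix A B C :: rcm
  show "A * B * C = A * (B * C)" by (rule rcm_mult_assoc)
  show "A + B + C = A + (B + C)" "A + B = B + A" "0 + A = A" "- A + A = 0" "A - B = A + - B"
    by (auto intro!: rcm_eqI simp: plus_rcm.rep_eq zero_rcm.rep_eq uminus_rcm.rep_eq minus_rcm_def)
  show "1 * A = A"
  proof (rule rcm_eqI)
    fix i j show "ent (1 * A) i j = ent A i j"
      by (subst ent_mult[of "{i}"]) (auto simp: one_rcm.rep_eq)
  qed
  show "A * 1 = A"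
  proof (rule rcm_eqI)
    fix i j show "ent (A * 1) i j = ent A i j"
      by (subst ent_mult[of "{j}"]) (auto simp: one_rcm.rep_eq)
  qed
  show "(A + B) * C = A * C + B * C"
  proof (rule rcm_eqI)
    fix i j
    let ?T = "{l. ent C l j \<noteq> 0}"
    show "ent ((A + B) * C) i j = ent (A * C + B * C) i j"
      unfolding plus_rcm.rep_eq
      by (subst (1 2 3) ent_mult[of ?T]) (auto simp: finite_col plus_rcm.rep_eq algebra_simps sum.distrib)
  qed
  show "A * (B + C) = A * B + A * C"
  proof (rule rcm_eqI)
    fix i j
    let ?S = "{k. ent A i k \<noteq> 0}"
    show "ent (A * (B + C)) i j = ent (A * B + A * C) i j"
      unfolding plus_rcm.rep_eq
      by (subst (1 2 3) ent_mult[of ?S]) (auto simp: finite_row plus_rcm.rep_eq algebra_simps sum.distrib)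
  qed
  show "(0::rcm) \<noteq> 1"
    by (metis one_rcm.rep_eq zero_rcm.rep_eq zero_neq_one)
qed

end

lemma ent_diff: "ent (A - B) i j = ent A i j - ent B i j"
  by (simp only: minus_rcm_def plus_rcm.rep_eq uminus_rcm.rep_eq diff_conv_add_uminus)

lift_definition star :: "rcm \<Rightarrow> rcm" is "\<lambda>A i j. cnj (A j i)" by simp

lift_definition smul :: "complex \<Rightarrow> rcm \<Rightarrow> rcm" is "\<lambda>c A i j. c * A i j"
  by (auto intro: finite_subset[rotated])

lemma star_star [simp]: "star (star A) = A"
  by (rule rcm_eqI) (simp add: star.rep_eq)

lemma star_one [simp]: "star 1 = 1"
  by (rule rcm_eqI) (auto simp: star.rep_eq one_rcm.rep_eq)

lemma star_add: "star (A + B) = star A + star B"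
  by (rule rcm_eqI) (simp add: star.rep_eq plus_rcm.rep_eq)

lemma star_mult: "star (A * B) = star B * star A"
proof (rule rcm_eqI)
  fix i j
  let ?S = "{k. ent A j k \<noteq> 0}"
  show "ent (star (A * B)) i j = ent (star B * star A) i j"
    unfolding star.rep_eq
    by (subst (1 2) ent_mult[of ?S]) (auto simp: finite_row star.rep_eq mult.commute)
qed

lemma star_power: "star (A ^ n) = star A ^ n"
  by (induction n) (simp_all add: star_mult power_commutes)

lemma smul_mult_left: "smul c A * B = smul c (A * B)"
proof (rule rcm_eqI)
  fix i j
  let ?S = "{k. ent A i k \<noteq> 0}"
  show "ent (smul c A * B) i j = ent (smul c (A * B)) i j"
    unfolding smul.rep_eq
    by (subst (1 2) ent_mult[of ?S]) (auto simp: finite_row smul.rep_eq mult.assoc sum_distrib_left)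
qed

lemma smul_mult_right: "A * smul c B = smul c (A * B)"
proof (rule rcm_eqI)
  fix i j
  let ?S = "{k. ent A i k \<noteq> 0}"
  show "ent (A * smul c B) i j = ent (smul c (A * B)) i j"
    unfolding smul.rep_eq
    by (subst (1 2) ent_mult[of ?S]) (auto simp: finite_row smul.rep_eq mult.left_commute sum_distrib_left)
qed

lemma smul_smul: "smul c (smul d A) = smul (c * d) A"
  by (rule rcm_eqI) (simp add: smul.rep_eq mult.assoc)

lemma smul_power: "smul c A ^ n = smul (c ^ n) (A ^ n)"
  by (induction n) (auto intro!: rcm_eqI simp: smul_mult_left smul_mult_right smul_smul smul.rep_eq)

lemma star_smul: "star (smul c A) = smul (cnj c) (star A)"
  by (rule rcm_eqI) (simp add: star.rep_eq smul.rep_eq)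

section \<open>Traces and Hilbert-Schmidt norms in a finite corner\<close>

definition corner :: "nat \<Rightarrow> rcm \<Rightarrow> bool"
  where "corner N A \<longleftrightarrow> (\<forall>i j. ent A i j \<noteq> 0 \<longrightarrow> i < N \<and> j < N)"

lemma cornerD: "corner N A \<Longrightarrow> N \<le> i \<or> N \<le> j \<Longrightarrow> ent A i j = 0"
  unfolding corner_def by (meson leD)

lemma corner_mult:
  assumes "corner N A" "corner N B" shows "corner N (A * B)"
  unfolding corner_def
proof (intro allI impI)
  fix i j assume nz: "ent (A * B) i j \<noteq> 0"
  have "ent (A * B) i j = (\<Sum>k<N. ent A i k * ent B k j)"
    by (rule ent_mult_less) (simp add: cornerD[OF assms(1)])
  with nz obtain k where "ent A i k * ent B k j \<noteq> 0"
    by (auto elim: sum.not_neutral_contains_not_neutral)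
  then show "i < N \<and> j < N" using assms by (auto simp: corner_def)
qed

lemma corner_add: "corner N A \<Longrightarrow> corner N B \<Longrightarrow> corner N (A + B)"
  by (auto simp: corner_def plus_rcm.rep_eq) (metis add_0)+

lemma corner_star: "corner N A \<Longrightarrow> corner N (star A)"
  by (auto simp: corner_def star.rep_eq)

text \<open>The exponent is positive because \<open>A ^ 0\<close> is the unit, which lies in no
  corner.\<close>

lemma corner_power: "corner N A \<Longrightarrow> corner N (A ^ Suc k)"
  by (induction k) (auto intro: corner_mult)

definition trn :: "nat \<Rightarrow> rcm \<Rightarrow> complex"
  where "trn N A = (\<Sum>i<N. ent A i i)"

lemma trn_add: "trn N (A + B) = trn N A + trn N B"
  by (simp add: trn_def plus_rcm.rep_eq sum.distrib)

lemma trn_smul: "trn N (smul c A) = c * trn N A"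
  by (simp add: trn_def smul.rep_eq sum_distrib_left)

text \<open>The corner matrix confines both summation indices to those below \<open>N\<close>. The
  other factor is arbitrary, so it may contain a zeroth power, that is, the unit.\<close>

lemma trn_commute:
  assumes "corner N A" shows "trn N (A * B) = trn N (B * A)"
proof -
  have "trn N (A * B) = (\<Sum>i<N. \<Sum>k<N. ent A i k * ent B k i)"
    unfolding trn_def
    by (intro sum.cong refl ent_mult_less) (simp add: cornerD[OF assms])
  also have "\<dots> = (\<Sum>k<N. \<Sum>i<N. ent A i k * ent B k i)"
    by (rule sum.swap)
  also have "\<dots> = trn N (B * A)"
    unfolding trn_def
    by (intro sum.cong refl, subst ent_mult_less[of N]) (simp_all add: cornerD[OF assms] mult.commute)
  finally show ?thesis .
qed

lemma trn_star_mult: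
  assumes "corner N A"
  shows "trn N (star A * B) = (\<Sum>i<N. \<Sum>k<N. cnj (ent A k i) * ent B k i)"
  unfolding trn_def
  by (intro sum.cong refl, subst ent_mult_less[of N])
    (simp_all add: cornerD[OF assms] star.rep_eq)

text \<open>The squared Hilbert-Schmidt norm of the leading corner.\<close>

definition hsn :: "nat \<Rightarrow> rcm \<Rightarrow> real"
  where "hsn N A = (\<Sum>i<N. \<Sum>k<N. (cmod (ent A k i))\<^sup>2)"

lemma trn_star_self: "corner N A \<Longrightarrow> trn N (star A * A) = of_real (hsn N A)"
  by (simp add: trn_star_mult hsn_def complex_norm_square[symmetric] mult.commute del: of_real_power)

lemma hsn_nonneg: "0 \<le> hsn N A"
  by (simp add: hsn_def sum_nonneg)

lemma cmod_sum_mult_le: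
  fixes f g :: "'a \<Rightarrow> complex"
  shows "(cmod (\<Sum>i\<in>S. f i * g i))\<^sup>2 \<le> (\<Sum>i\<in>S. (cmod (f i))\<^sup>2) * (\<Sum>i\<in>S. (cmod (g i))\<^sup>2)"
proof -
  have "cmod (\<Sum>i\<in>S. f i * g i) \<le> (\<Sum>i\<in>S. cmod (f i) * cmod (g i))"
    by (rule sum_norm_le) (simp add: norm_mult)
  then have "(cmod (\<Sum>i\<in>S. f i * g i))\<^sup>2 \<le> (\<Sum>i\<in>S. cmod (f i) * cmod (g i))\<^sup>2"
    by (intro power_mono) auto
  also have "\<dots> \<le> (\<Sum>i\<in>S. (cmod (f i))\<^sup>2) * (\<Sum>i\<in>S. (cmod (g i))\<^sup>2)"
    by (rule Cauchy_Schwarz_ineq_sum)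
  finally show ?thesis .
qed

lemma trn_Cauchy_Schwarz:
  assumes "corner N A"
  shows "(cmod (trn N (star A * B)))\<^sup>2 \<le> hsn N A * hsn N B"
  unfolding trn_star_mult[OF assms] hsn_def sum.cartesian_product
  using cmod_sum_mult_le[of "\<lambda>(i, k). cnj (ent A k i)" "\<lambda>(i, k). ent B k i" "{..<N} \<times> {..<N}"]
  by (simp add: case_prod_unfold)

lemma hsn_star: "hsn N (star A) = hsn N A"
  unfolding hsn_def by (subst sum.swap) (simp add: star.rep_eq)

text \<open>Cauchy-Schwarz for each entry of the product bounds its square by a row sum of
  \<open>A\<close> times a column sum of \<open>B\<close>.\<close>

lemma hsn_mult:
  assumes "corner N A" shows "hsn N (A * B) \<le> hsn N A * hsn N B"
proof -
  have "hsn N (A * B) \<le> (\<Sum>i<N. \<Sum>k<N. (\<Sum>l<N. (cmod (ent A k l))\<^sup>2) * (\<Sum>l<N. (cmod (ent B l i))\<^sup>2))"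
    unfolding hsn_def
  proof (intro sum_mono)
    fix i k
    have "ent (A * B) k i = (\<Sum>l<N. ent A k l * ent B l i)"
      by (rule ent_mult_less) (simp add: cornerD[OF assms(1)])
    then show "(cmod (ent (A * B) k i))\<^sup>2 \<le> (\<Sum>l<N. (cmod (ent A k l))\<^sup>2) * (\<Sum>l<N. (cmod (ent B l i))\<^sup>2)"
      by (simp add: cmod_sum_mult_le)
  qed
  also have "\<dots> = (\<Sum>k<N. \<Sum>l<N. (cmod (ent A k l))\<^sup>2) * hsn N B"
    unfolding hsn_def by (simp add: sum_distrib_left sum_distrib_right mult.commute)
  also have "(\<Sum>k<N. \<Sum>l<N. (cmod (ent A k l))\<^sup>2) = hsn N A"
    unfolding hsn_def by (rule sum.swap)
  finally show ?thesis .
qed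

text \<open>\<open>altprod x j\<close> is the alternating product \<open>\<cdots> x\<^sup>* x\<close> of \<open>j\<close> factors.\<close>

definition altprod :: "rcm \<Rightarrow> nat \<Rightarrow> rcm"
  where "altprod x j = (if even j then (star x * x) ^ (j div 2) else x * (star x * x) ^ (j div 2))"

text \<open>The alternating product replaces the \<open>j\<close>-th power of the absolute value of
  \<open>x\<close>: it factorizes \<open>(star x * x) ^ j\<close> for odd \<open>j\<close> too,
  without square roots of operators.\<close>

lemma star_altprod: "star (altprod x j) * altprod x j = (star x * x) ^ j"
proof (cases "even j")
  case True
  then obtain s where "j = s + s" by (metis evenE mult_2)
  then show ?thesis by (simp add: altprod_def star_power star_mult power_add)
next
  case False
  then obtain s where j: "j = Suc (s + s)" by (metis oddE mult_2 Suc_eq_plus1)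
  then have "altprod x j = x * (star x * x) ^ s" by (simp add: altprod_def)
  then have "star (altprod x j) * altprod x j = (star x * x) ^ s * (star x * x) * (star x * x) ^ s"
    by (simp add: star_power star_mult mult.assoc)
  then show ?thesis by (simp add: j power_add power_commutes mult.assoc)
qed

text \<open>Indices two apart have the same parity, so the two alternating products have the same
  shape and combine to a power of \<open>star x * x\<close>; for neighbouring indices a single
  factor \<open>x\<close> or \<open>star x\<close> would be left over.\<close>

lemma star_altprod_2: "star (altprod x j) * altprod x (Suc (Suc j)) = (star x * x) ^ Suc j"
proof -
  have "altprod x (Suc (Suc j)) = altprod x j * (star x * x)"
    by (simp add: altprod_def power_Suc2 mult.assoc del: power_Suc)
  then have "star (altprod x j) * altprod x (Suc (Suc j)) = (star x * x) ^ j * (star x * x)"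
    by (simp add: star_altprod mult.assoc[symmetric])
  then show ?thesis by (simp add: power_Suc2 del: power_Suc)
qed

lemma star_altprod_left: "star (altprod x j) * (altprod x j * z) = (star x * x) ^ j * z"
  by (simp add: star_altprod[symmetric] mult.assoc)

lemma star_altprod_2_left: "star (altprod x j) * (altprod x (Suc (Suc j)) * z) = (star x * x) ^ Suc j * z"
  by (simp add: star_altprod_2[symmetric] mult.assoc del: power_Suc)

lemma corner_altprod_mult: "corner N x \<Longrightarrow> corner N P \<Longrightarrow> corner N (altprod x j * P)"
proof -
  assume x: "corner N x" and P: "corner N P"
  have p: "corner N ((star x * x) ^ k * Q)" if "corner N Q" for k Q
    using that by (induction k) (auto simp: mult.assoc intro: corner_mult corner_star x)
  show ?thesis using x P p by (auto simp: altprod_def mult.assoc intro: corner_mult)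
qed

section \<open>Log-convexity of mixed traces\<close>

definition mixed :: "nat \<Rightarrow> rcm \<Rightarrow> rcm \<Rightarrow> rcm \<Rightarrow> nat \<Rightarrow> nat \<Rightarrow> complex"
  where "mixed N P x y j k = trn N (P * (star x * x) ^ j * P * (star y * y) ^ k)"

text \<open>For a projection \<open>P\<close> in the corner, \<open>mixed\<close> is the squared
  Hilbert-Schmidt norm of this matrix. Taking the unit of the corner for \<open>P\<close> leads to
  the Hoelder inequality, taking \<open>y = x * P\<close> leads to pinching.\<close>

definition mixed_factor :: "rcm \<Rightarrow> rcm \<Rightarrow> rcm \<Rightarrow> nat \<Rightarrow> nat \<Rightarrow> rcm"
  where "mixed_factor P x y j k = altprod x j * P * star (altprod y k)"

lemma corner_mixed_factor:
  assumes "corner N x" "corner N y" "corner N P" "P * P = P" "star P = P"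
  shows "corner N (mixed_factor P x y j k)"
proof -
  have "mixed_factor P x y j k = (altprod x j * P) * star (altprod y k * P)"
    using assms by (simp add: mixed_factor_def star_mult mult.assoc[symmetric]) (simp add: mult.assoc)
  then show ?thesis using assms by (simp add: corner_mult corner_star corner_altprod_mult)
qed

lemma mixed_eq_hsn:
  assumes "corner N x" "corner N y" "corner N P" "P * P = P" "star P = P"
  shows "mixed N P x y j k = of_real (hsn N (mixed_factor P x y j k))"
proof -
  have "of_real (hsn N (mixed_factor P x y j k)) = trn N ((altprod y k * P) * ((star x * x) ^ j * P * star (altprod y k)))"
    using assms by (simp add: trn_star_self[symmetric] corner_mixed_factor) (simp add: mixed_factor_def star_mult mult.assoc star_altprod_left)
  also have "\<dots> = trn N (((star x * x) ^ j * P * star (altprod y k)) * (altprod y k * P))"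
    using assms by (intro trn_commute corner_altprod_mult)
  also have "\<dots> = trn N ((star x * x) ^ j * P * (star y * y) ^ k * P)"
    by (simp add: mult.assoc star_altprod_left)
  also have "\<dots> = mixed N P x y j k"
    unfolding mixed_def using trn_commute[OF assms(3), of "(star x * x) ^ j * P * (star y * y) ^ k"]
    by (simp add: mult.assoc)
  finally show ?thesis by simp
qed

lemma mixed_eq_inner:
  assumes "corner N x" "corner N y" "corner N P" "P * P = P" "star P = P"
  shows "mixed N P x y (Suc j) (Suc k) = trn N (star (mixed_factor P x y j (Suc (Suc k))) * mixed_factor P x y (Suc (Suc j)) k)"
proof -
  have "trn N (star (mixed_factor P x y j (Suc (Suc k))) * mixed_factor P x y (Suc (Suc j)) k)
     = trn N ((altprod y (Suc (Suc k)) * P) * ((star x * x) ^ Suc j * P * star (altprod y k)))"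
    using assms by (simp add: mixed_factor_def star_mult mult.assoc star_altprod_2_left del: power_Suc)
  also have "\<dots> = trn N (((star x * x) ^ Suc j * P * star (altprod y k)) * (altprod y (Suc (Suc k)) * P))"
    using assms by (intro trn_commute corner_altprod_mult)
  also have "\<dots> = trn N ((star x * x) ^ Suc j * P * (star y * y) ^ Suc k * P)"
    by (simp add: mult.assoc star_altprod_2_left del: power_Suc)
  also have "\<dots> = mixed N P x y (Suc j) (Suc k)"
    unfolding mixed_def using trn_commute[OF assms(3), of "(star x * x) ^ Suc j * P * (star y * y) ^ Suc k"]
    by (simp add: mult.assoc del: power_Suc)
  finally show ?thesis by simp
qed

text \<open>Cauchy-Schwarz for two factors whose indices differ by \<open>2\<close>. Log-convexity of this kind replaces the
  spectral theorem in the proofs of the Hoelder inequality and of the pinching inequality.\<close>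

lemma mixed_log_convex:
  assumes "corner N x" "corner N y" "corner N P" "P * P = P" "star P = P"
  shows "(Re (mixed N P x y (Suc j) (Suc k)))\<^sup>2
    \<le> Re (mixed N P x y j (Suc (Suc k))) * Re (mixed N P x y (Suc (Suc j)) k)"
proof -
  have "(Re (mixed N P x y (Suc j) (Suc k)))\<^sup>2 \<le> (cmod (mixed N P x y (Suc j) (Suc k)))\<^sup>2"
    by (intro power2_le_iff_abs_le[THEN iffD2] abs_Re_le_cmod) simp
  also have "\<dots> \<le> hsn N (mixed_factor P x y j (Suc (Suc k))) * hsn N (mixed_factor P x y (Suc (Suc j)) k)"
    unfolding mixed_eq_inner[OF assms] by (intro trn_Cauchy_Schwarz corner_mixed_factor assms)
  finally show ?thesis by (simp add: mixed_eq_hsn[OF assms])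
qed

lemma mixed_nonneg:
  assumes "corner N x" "corner N y" "corner N P" "P * P = P" "star P = P"
  shows "0 \<le> Re (mixed N P x y j k)"
  by (simp add: mixed_eq_hsn[OF assms] hsn_nonneg)

text \<open>By log-convexity all ratios \<open>f (Suc j) / f j\<close> are at least
  \<open>f 1 / f 0\<close>, and the product of the first \<open>m\<close> of them is
  \<open>f m / f 0\<close>. Denominators are cleared since values may vanish.\<close>

lemma log_convex_power_le:
  fixes f :: "nat \<Rightarrow> real"
  assumes nonneg: "\<And>j. j \<le> m \<Longrightarrow> 0 \<le> f j"
    and conv: "\<And>j. Suc (Suc j) \<le> m \<Longrightarrow> (f (Suc j))\<^sup>2 \<le> f j * f (Suc (Suc j))"
    and "m \<ge> 1"
  shows "f 1 ^ m \<le> f 0 ^ (m - 1) * f m"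
proof (cases "m = 1 \<or> f 1 = 0")
  case True
  then show ?thesis using nonneg[of 0] nonneg[of m] \<open>m \<ge> 1\<close> by (auto simp: zero_power)
next
  case False
  then have m2: "m \<ge> 2" and f1: "f 1 > 0" using nonneg[of 1] \<open>m \<ge> 1\<close> by auto
  have f0: "f 0 > 0"
  proof -
    have "(f 1)\<^sup>2 \<le> f 0 * f 2" using conv[of 0] m2 by (simp add: numeral_2_eq_2)
    moreover have "(f 1)\<^sup>2 > 0" using f1 by simp
    ultimately have "f 0 * f 2 > 0" by linarith
    then show ?thesis using nonneg[of 0] by (auto simp: zero_less_mult_iff)
  qed
  have ratio: "f j > 0 \<and> f j * f 1 \<le> f 0 * f (Suc j)" if "Suc j \<le> m" for j
    using that
  proof (induction j)
    case 0 then show ?case using f0 by simp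
  next
    case (Suc j)
    then have IH: "f j > 0" "f j * f 1 \<le> f 0 * f (Suc j)" by auto
    then have "0 < f 0 * f (Suc j)" using f1 mult_pos_pos[of "f j" "f 1"] by linarith
    then have p: "f (Suc j) > 0" using f0 by (simp add: zero_less_mult_iff)
    have "f j * (f (Suc j) * f 1) = (f j * f 1) * f (Suc j)" by simp
    also have "\<dots> \<le> (f 0 * f (Suc j)) * f (Suc j)" using IH p by (intro mult_right_mono) auto
    also have "\<dots> = f 0 * (f (Suc j))\<^sup>2" by (simp add: power2_eq_square)
    also have "\<dots> \<le> f 0 * (f j * f (Suc (Suc j)))" using conv[of j] Suc.prems f0 by (intro mult_left_mono) auto
    finally have "f j * (f (Suc j) * f 1) \<le> f j * (f 0 * f (Suc (Suc j)))" by (simp add: mult.left_commute)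
    then show ?case using p IH(1) by simp
  qed
  have "f 0 * f 1 ^ j \<le> f 0 ^ j * f j" if "j \<le> m" for j
    using that
  proof (induction j)
    case 0 then show ?case by simp
  next
    case (Suc j)
    have "f 0 * f 1 ^ Suc j = (f 0 * f 1 ^ j) * f 1" by simp
    also have "\<dots> \<le> (f 0 ^ j * f j) * f 1" using Suc f1 by (intro mult_right_mono) auto
    also have "\<dots> = f 0 ^ j * (f j * f 1)" by simp
    also have "\<dots> \<le> f 0 ^ j * (f 0 * f (Suc j))" using ratio[of j] Suc.prems f0 by (intro mult_left_mono) auto
    finally show ?case by (simp add: mult_ac)
  qed
  from this[of m] have "f 0 * f 1 ^ m \<le> f 0 ^ m * f m" by simp
  also have "f 0 ^ m = f 0 * f 0 ^ (m - 1)" using \<open>m \<ge> 1\<close> by (metis power_eq_if not_one_le_zero)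
  finally show ?thesis using f0 by (simp add: mult.assoc)
qed

text \<open>The \<open>2 m\<close>-th power of the Schatten norm of a matrix in the corner.\<close>

definition gtrace :: "nat \<Rightarrow> nat \<Rightarrow> rcm \<Rightarrow> real"
  where "gtrace m N x = Re (trn N ((star x * x) ^ m))"

lemma gtrace_eq_hsn:
  assumes x: "corner N x" and m: "m \<ge> 1" shows "gtrace m N x = hsn N (altprod x m)"
proof -
  have "corner N (altprod x m)"
  proof (cases "m = 1")
    case False
    then obtain k where "m div 2 = Suc k" using m by (cases "m div 2") auto
    then show ?thesis using x by (auto simp: altprod_def intro!: corner_mult corner_star corner_power
      simp del: power_Suc)
  qed (use x in \<open>simp add: altprod_def\<close>)
  then show ?thesis
    unfolding gtrace_def star_altprod[symmetric] by (simp add: trn_star_self)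
qed

lemma gtrace_star:
  assumes x: "corner N x" and m: "m \<ge> 1" shows "gtrace m N (star x) = gtrace m N x"
proof -
  obtain k where k: "m = Suc k" using m by (cases m) auto
  have comm: "x * (star x * x) ^ n = (x * star x) ^ n * x" for n
    by (induction n) (simp_all add: mult.assoc)
  have "trn N ((x * star x) ^ m) = trn N (((x * star x) ^ k * x) * star x)"
    by (simp add: k power_Suc2 mult.assoc del: power_Suc)
  also have "\<dots> = trn N (star x * ((x * star x) ^ k * x))"
    using trn_commute[OF corner_star[OF x]] by simp
  also have "\<dots> = trn N ((star x * x) ^ m)"
    by (simp add: comm[symmetric] k mult.assoc)
  finally show ?thesis by (simp add: gtrace_def)
qed

lemma gtrace_nonneg: "corner N x \<Longrightarrow> m \<ge> 1 \<Longrightarrow> 0 \<le> gtrace m N x"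
  by (simp add: gtrace_eq_hsn hsn_nonneg)

lemma gtrace_smul: "gtrace m N (smul c x) = (cmod c) ^ (2 * m) * gtrace m N x"
proof -
  have "(star (smul c x) * smul c x) ^ m = smul (of_real ((cmod c) ^ (2 * m))) ((star x * x) ^ m)"
    by (simp add: star_smul smul_mult_left smul_mult_right smul_smul smul_power power_mult
        complex_norm_square[symmetric] mult.commute[of "cnj c"])
  then show ?thesis by (simp add: gtrace_def trn_smul)
qed

text \<open>Each factor that is peeled off costs one Hilbert-Schmidt norm. Through
  \<open>gtrace_le_hsn\<close> the Schatten norm is dominated by the Hilbert-Schmidt norm.\<close>

lemma hsn_altprod_le: "corner N x \<Longrightarrow> hsn N (altprod x (Suc k)) \<le> hsn N x ^ Suc k"
proof (induction k)
  case 0 then show ?case by (simp add: altprod_def)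
next
  case (Suc k)
  have comm: "(star x * x) ^ n * star x = star x * (x * star x) ^ n" for n
    by (induction n) (simp_all add: mult.assoc)
  have "altprod x (Suc (Suc k)) = (if even k then star x else x) * altprod x (Suc k)"
    by (auto simp: altprod_def mult.assoc)
  then have "hsn N (altprod x (Suc (Suc k))) \<le> hsn N x * hsn N (altprod x (Suc k))"
    using hsn_mult[OF corner_star[OF Suc.prems], of "altprod x (Suc k)"] hsn_mult[OF Suc.prems, of "altprod x (Suc k)"]
    by (auto simp: hsn_star split: if_splits)
  also have "\<dots> \<le> hsn N x * hsn N x ^ Suc k"
    using Suc by (intro mult_left_mono hsn_nonneg) auto
  finally show ?case by simp
qed

lemma gtrace_le_hsn: "corner N x \<Longrightarrow> m \<ge> 1 \<Longrightarrow> gtrace m N x \<le> hsn N x ^ m"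
  using hsn_altprod_le[of N x "m - 1"] by (simp add: gtrace_eq_hsn)

section \<open>Hoelder, pinching and Minkowski inequalities\<close>

lift_definition proj :: "nat set \<Rightarrow> rcm" is "\<lambda>S i j. if i = j \<and> i \<in> S then 1 else 0" by simp

lemma ent_proj_mult: "ent (proj S * A) i j = (if i \<in> S then ent A i j else 0)"
  by (subst ent_mult[of "{i}"]) (auto simp: proj.rep_eq)

lemma ent_mult_proj: "ent (A * proj S) i j = (if j \<in> S then ent A i j else 0)"
  by (subst ent_mult[of "{j}"]) (auto simp: proj.rep_eq)

lemma proj_mult_proj: "proj S * proj T = proj (S \<inter> T)"
  by (rule rcm_eqI) (auto simp: ent_proj_mult proj.rep_eq)

lemma star_proj [simp]: "star (proj S) = proj S"
  by (rule rcm_eqI) (auto simp: star.rep_eq proj.rep_eq)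

lemma corner_proj: "S \<subseteq> {..<N} \<Longrightarrow> corner N (proj S)"
  by (auto simp: corner_def proj.rep_eq split: if_splits)

lemma corner_proj_mult: "corner N x \<Longrightarrow> corner N (proj S * x)"
  and corner_mult_proj: "corner N x \<Longrightarrow> corner N (x * proj S)"
  by (auto simp: corner_def ent_proj_mult ent_mult_proj split: if_splits)

lemma proj_corner: "corner N x \<Longrightarrow> proj {..<N} * x = x"
  and corner_proj_right: "corner N x \<Longrightarrow> x * proj {..<N} = x"
  by (rule rcm_eqI, fastforce simp: corner_def ent_proj_mult ent_mult_proj)+

text \<open>Log-convexity along the line \<open>j + k = m\<close>, compared at \<open>j = 0\<close>,
  \<open>j = 1\<close> and \<open>j = m\<close>.\<close>

lemma mixed_Hoelder:
  assumes "corner N x" "corner N y" "corner N P" "P * P = P" "star P = P" "m \<ge> 1"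
  shows "Re (mixed N P x y 1 (m - 1)) ^ m \<le> Re (mixed N P x y 0 m) ^ (m - 1) * Re (mixed N P x y m 0)"
proof -
  let ?f = "\<lambda>j. Re (mixed N P x y j (m - j))"
  have "?f 1 ^ m \<le> ?f 0 ^ (m - 1) * ?f m"
  proof (rule log_convex_power_le[of m ?f])
    fix j assume "Suc (Suc j) \<le> m"
    then show "(?f (Suc j))\<^sup>2 \<le> ?f j * ?f (Suc (Suc j))"
      using mixed_log_convex[OF assms(1-5), of j "m - Suc (Suc j)"]
      by (simp add: Suc_diff_Suc Suc_diff_le)
  qed (use assms mixed_nonneg in auto)
  then show ?thesis by simp
qed

text \<open>Here \<open>P\<close> is the unit of the corner. This is the Hoelder inequality with
  exponents \<open>m\<close> and \<open>m / (m - 1)\<close>, raised to the \<open>m\<close>-th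
  power.\<close>

lemma trace_Hoelder:
  assumes x: "corner N x" and y: "corner N y" and m: "m \<ge> 1"
  shows "Re (trn N (star x * x * (star y * y) ^ (m - 1))) ^ m \<le> gtrace m N y ^ (m - 1) * gtrace m N x"
proof -
  let ?P = "proj {..<N}"
  have P: "corner N ?P" "?P * ?P = ?P" "star ?P = ?P"
    by (simp_all add: corner_proj proj_mult_proj)
  obtain k where k: "m = Suc k" using m by (cases m) auto
  have sx: "?P * star x = star x" "?P * star y = star y" "star y * ?P = star y" "x * ?P = x" "star x * ?P = star x"
    using x y by (simp_all add: proj_corner corner_proj_right corner_star)
  have p: "?P * (star x * x) ^ m = (star x * x) ^ m" "?P * (star y * y) ^ m = (star y * y) ^ m"
    by (simp_all add: k mult.assoc[symmetric] sx)
  have "mixed N ?P x y 0 m = trn N ((star y * y) ^ m)"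
    by (simp add: mixed_def P p mult.assoc)
  moreover have "mixed N ?P x y m 0 = trn N ((star x * x) ^ m)"
    using trn_commute[OF P(1), of "?P * (star x * x) ^ m"] p
    by (simp add: mixed_def mult.assoc[symmetric] P)
  moreover have "mixed N ?P x y 1 (m - 1) = trn N (star x * x * (star y * y) ^ (m - 1))"
    by (simp add: mixed_def mult.assoc[symmetric] sx) (simp add: mult.assoc sx)
  ultimately show ?thesis
    using mixed_Hoelder[OF x y P m] by (simp add: gtrace_def)
qed

text \<open>For \<open>y = x * P\<close> the values of \<open>mixed\<close> at \<open>(0, m)\<close>
  and \<open>(1, m - 1)\<close> coincide, so Hoelder reads
  \<open>t ^ m \<le> t ^ (m - 1) * s\<close> and leaves \<open>t \<le> s\<close>. With
  \<open>a = star x * x\<close>, this compares the \<open>m\<close>-th power of \<open>P a P\<close>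
  with the compression of the \<open>m\<close>-th power of \<open>a\<close>.\<close>

lemma trace_pinching:
  assumes x: "corner N x" and S: "S \<subseteq> {..<N}" and m: "m \<ge> 1"
  shows "gtrace m N (x * proj S) \<le> (\<Sum>i\<in>S. Re (ent ((star x * x) ^ m) i i))"
proof -
  let ?P = "proj S" and ?y = "x * proj S"
  have P: "corner N ?P" "?P * ?P = ?P" "star ?P = ?P"
    using S by (simp_all add: corner_proj proj_mult_proj)
  have y: "corner N ?y" using x by (rule corner_mult_proj)
  obtain k where k: "m = Suc k" using m by (cases m) auto
  have b: "star ?y * ?y = ?P * (star x * x) * ?P" by (simp add: star_mult mult.assoc)
  have Pb: "?P * (star ?y * ?y) ^ m = (star ?y * ?y) ^ m"
    unfolding k b by (simp add: mult.assoc[symmetric] P)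
  have f0: "mixed N ?P x ?y 0 m = trn N ((star ?y * ?y) ^ m)"
    by (simp add: mixed_def P Pb mult.assoc)
  have f1: "mixed N ?P x ?y 1 (m - 1) = trn N ((star ?y * ?y) ^ m)"
    by (simp add: mixed_def k b mult.assoc)
  have fm: "Re (mixed N ?P x ?y m 0) = (\<Sum>i\<in>S. Re (ent ((star x * x) ^ m) i i))"
  proof -
    have "mixed N ?P x ?y m 0 = (\<Sum>i<N. if i \<in> S then ent ((star x * x) ^ m) i i else 0)"
      by (simp add: mixed_def trn_def ent_mult_proj) (simp add: mult.assoc ent_proj_mult cong: if_cong)
    also have "\<dots> = (\<Sum>i\<in>S. ent ((star x * x) ^ m) i i)"
      using S by (subst sum.inter_restrict[symmetric]) (auto intro!: sum.cong)
    finally show ?thesis by simp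
  qed
  have H: "gtrace m N ?y ^ m \<le> gtrace m N ?y ^ (m - 1) * Re (mixed N ?P x ?y m 0)"
    using mixed_Hoelder[OF x y P m] unfolding f0 f1 gtrace_def .
  have "gtrace m N ?y \<le> Re (mixed N ?P x ?y m 0)"
  proof (cases "gtrace m N ?y = 0")
    case True
    then show ?thesis using mixed_nonneg[OF x y P] by simp
  next
    case False
    then have pos: "gtrace m N ?y > 0" using gtrace_nonneg[OF y m] by simp
    from H have "gtrace m N ?y ^ (m - 1) * gtrace m N ?y \<le> gtrace m N ?y ^ (m - 1) * Re (mixed N ?P x ?y m 0)"
      by (simp add: k mult.commute)
    then show ?thesis using pos by simp
  qed
  then show ?thesis by (simp add: fm)
qed

text \<open>Pinching to \<open>S\<close> and to its complement uses disjoint parts of the diagonal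
  of \<open>(star x * x) ^ m\<close>, whose full sum is the trace.\<close>

lemma gtrace_columns_superadditive:
  assumes x: "corner N x" and m: "m \<ge> 1"
  shows "gtrace m N (x * proj S) + gtrace m N (x * proj (- S)) \<le> gtrace m N x"
proof -
  have eq: "x * proj T = x * proj (T \<inter> {..<N})" for T
    using x by (intro rcm_eqI) (auto simp: ent_mult_proj corner_def)
  have "gtrace m N (x * proj S) + gtrace m N (x * proj (- S))
      \<le> (\<Sum>i\<in>S \<inter> {..<N}. Re (ent ((star x * x) ^ m) i i)) + (\<Sum>i\<in>- S \<inter> {..<N}. Re (ent ((star x * x) ^ m) i i))"
    by (subst (1 2) eq) (intro add_mono trace_pinching x m; simp)
  also have "\<dots> = (\<Sum>i<N. Re (ent ((star x * x) ^ m) i i))"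
    by (subst sum.union_disjoint[symmetric]) (auto intro!: sum.cong)
  also have "\<dots> = gtrace m N x" by (simp add: gtrace_def trn_def)
  finally show ?thesis .
qed

lemma gtrace_rows_superadditive:
  assumes x: "corner N x" and m: "m \<ge> 1"
  shows "gtrace m N (proj S * x) + gtrace m N (proj (- S) * x) \<le> gtrace m N x"
proof -
  have "gtrace m N (proj T * x) = gtrace m N (star x * proj T)" for T
    using gtrace_star[OF corner_proj_mult[OF x] m, of T] by (simp add: star_mult)
  then show ?thesis
    using gtrace_columns_superadditive[OF corner_star[OF x] m, of S] gtrace_star[OF x m] by simp
qed

text \<open>Minkowski by duality: the power of \<open>z = x + y\<close> is a trace that depends
  linearly on one factor \<open>star z\<close>; both resulting summands are bounded by Hoelder, and
  \<open>\<nu> z ^ (2 * m - 1)\<close> is cancelled.\<close>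

lemma root_gtrace_add_le:
  assumes x: "corner N x" and y: "corner N y" and m: "m \<ge> 1"
  shows "root (2 * m) (gtrace m N (x + y)) \<le> root (2 * m) (gtrace m N x) + root (2 * m) (gtrace m N y)"
proof -
  define z where "z = x + y"
  have z: "corner N z" using x y by (simp add: z_def corner_add)
  define \<nu> where "\<nu> v = root (2 * m) (gtrace m N v)" for v
  have nu0: "0 \<le> \<nu> v" if "corner N v" for v using gtrace_nonneg[OF that m] m by (simp add: \<nu>_def real_root_ge_zero)
  have nup: "\<nu> v ^ (2 * m) = gtrace m N v" if "corner N v" for v
    using gtrace_nonneg[OF that m] m by (simp add: \<nu>_def)
  obtain k where k: "m = Suc k" using m by (cases m) auto
  have key: "Re (trn N (star v * z * (star z * z) ^ k)) \<le> \<nu> v * \<nu> z ^ (2 * m - 1)" if v: "corner N v" for v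
  proof -
    \<comment> \<open>The factor \<open>z * (star z * z) ^ k\<close> is divided between the two
      arguments of Cauchy-Schwarz so that the squared norm of \<open>U\<close> is a trace to which
      \<open>trace_Hoelder\<close> applies, with adjoints.\<close>
    define U where "U = altprod (star z) k * v"
    have U: "corner N U"
      unfolding U_def by (intro corner_altprod_mult corner_star z v)
    have split: "star (altprod (star z) k) * altprod z (Suc k) = z * (star z * z) ^ k"
    proof -
      have comm: "(z * star z) ^ n * z = z * (star z * z) ^ n" for n
        by (induction n) (simp_all add: mult.assoc)
      show ?thesis
      proof (cases "even k")
        case True
        then obtain s where "k = s + s" by (metis evenE mult_2)
        then show ?thesis
          by (simp add: altprod_def star_power star_mult power_add mult.assoc[symmetric] comm)
      next
        case False
        then obtain s where "k = Suc (s + s)" by (metis oddE mult_2 Suc_eq_plus1)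
        then show ?thesis
          by (simp add: altprod_def star_power star_mult power_add mult.assoc[symmetric] comm)
            (simp add: mult.assoc power_commutes[symmetric])
      qed
    qed
    have "hsn N U = Re (trn N (star v * ((z * star z) ^ k * v)))"
      using trn_star_self[OF U] star_altprod_left[of "star z" k v]
      by (simp add: U_def star_mult mult.assoc)
    also have "\<dots> = Re (trn N (((z * star z) ^ k * v) * star v))"
      by (subst trn_commute[OF corner_star[OF v]]) simp
    also have "\<dots> = Re (trn N (v * star v * (z * star z) ^ k))"
      by (subst trn_commute[OF corner_mult[OF v corner_star[OF v]]]) (simp add: mult.assoc)
    finally have "hsn N U ^ m \<le> gtrace m N z ^ k * gtrace m N v"
      using trace_Hoelder[OF corner_star[OF v] corner_star[OF z] m]
      unfolding gtrace_star[OF v m] gtrace_star[OF z m] by (simp add: k)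
    also have "\<dots> = (\<nu> z ^ (2 * k) * (\<nu> v)\<^sup>2) ^ m"
      by (simp add: nup[symmetric] z v power_mult[symmetric] power_mult_distrib mult_ac)
    finally have hU: "hsn N U \<le> \<nu> z ^ (2 * k) * (\<nu> v)\<^sup>2"
      using k power_le_imp_le_base[of "hsn N U" k "\<nu> z ^ (2 * k) * (\<nu> v)\<^sup>2"] by simp
    have "(cmod (trn N (star v * z * (star z * z) ^ k)))\<^sup>2 = (cmod (trn N (star U * altprod z m)))\<^sup>2"
      by (simp add: U_def star_mult mult.assoc split k)
    also have "\<dots> \<le> hsn N U * hsn N (altprod z m)"
      by (rule trn_Cauchy_Schwarz[OF U])
    also have "\<dots> \<le> (\<nu> z ^ (2 * k) * (\<nu> v)\<^sup>2) * \<nu> z ^ (2 * m)"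
      using hU by (intro mult_mono) (auto simp: nup z gtrace_eq_hsn[OF z m] hsn_nonneg)
    also have "\<dots> = (\<nu> v * \<nu> z ^ (2 * m - 1))\<^sup>2"
      by (simp add: k power_mult_distrib power_mult[symmetric] power_add[symmetric] mult_ac
          flip: power_Suc power_add)
    finally have "cmod (trn N (star v * z * (star z * z) ^ k)) \<le> \<nu> v * \<nu> z ^ (2 * m - 1)"
      by (rule power2_le_imp_le) (simp add: nu0 v z)
    then show ?thesis using complex_Re_le_cmod order_trans by blast
  qed
  have "(star z * z) ^ m = (star x + star y) * z * (star z * z) ^ k"
    using star_add[of x y] by (simp add: k z_def)
  then have "(star z * z) ^ m = star x * z * (star z * z) ^ k + star y * z * (star z * z) ^ k"
    by (simp only: distrib_right)
  then have "\<nu> z ^ (2 * m) = Re (trn N (star x * z * (star z * z) ^ k)) + Re (trn N (star y * z * (star z * z) ^ k))"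
    by (simp only: nup[OF z] gtrace_def trn_add plus_complex.sel)
  also have "\<dots> \<le> (\<nu> x + \<nu> y) * \<nu> z ^ (2 * m - 1)"
    using key[OF x] key[OF y] by (simp add: distrib_right)
  finally have le: "\<nu> z * \<nu> z ^ (2 * m - 1) \<le> (\<nu> x + \<nu> y) * \<nu> z ^ (2 * m - 1)"
    by (simp add: k)
  have "\<nu> z \<le> \<nu> x + \<nu> y"
  proof (cases "\<nu> z = 0")
    case True then show ?thesis using nu0 x y by simp
  next
    case False
    then have "0 < \<nu> z ^ (2 * m - 1)" using nu0[OF z] by simp
    with le show ?thesis by simp
  qed
  then show ?thesis by (simp add: \<nu>_def z_def)
qed


section \<open>Norms of infinite matrices\<close>

lift_definition cut :: "nat \<Rightarrow> (nat \<Rightarrow> nat \<Rightarrow> complex) \<Rightarrow> rcm"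
  is "\<lambda>N A i j. if i < N \<and> j < N then A i j else 0"
proof -
  fix N :: nat and A :: "nat \<Rightarrow> nat \<Rightarrow> complex"
  have "finite {j. (if i < N \<and> j < N then A i j else 0) \<noteq> 0}" for i
    by (rule finite_subset[of _ "{..<N}"]) auto
  moreover have "finite {i. (if i < N \<and> j < N then A i j else 0) \<noteq> 0}" for j
    by (rule finite_subset[of _ "{..<N}"]) auto
  ultimately show "(\<forall>i. finite {j. (if i < N \<and> j < N then A i j else 0) \<noteq> 0}) \<and>
      (\<forall>j. finite {i. (if i < N \<and> j < N then A i j else 0) \<noteq> 0})"
    by blast
qed

lemma corner_cut: "corner N (cut N A)"
  by (auto simp: corner_def cut.rep_eq split: if_splits)

definition row_restr :: "nat set \<Rightarrow> (nat \<Rightarrow> nat \<Rightarrow> complex) \<Rightarrow> nat \<Rightarrow> nat \<Rightarrow> complex"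
  where "row_restr S A = (\<lambda>r c. if r \<in> S then A r c else 0)"

definition col_restr :: "nat set \<Rightarrow> (nat \<Rightarrow> nat \<Rightarrow> complex) \<Rightarrow> nat \<Rightarrow> nat \<Rightarrow> complex"
  where "col_restr S A = (\<lambda>r c. if c \<in> S then A r c else 0)"

lemma cut_row_restr: "cut N (row_restr S A) = proj S * cut N A"
  by (rule rcm_eqI) (simp add: ent_proj_mult cut.rep_eq row_restr_def)

lemma cut_col_restr: "cut N (col_restr S A) = cut N A * proj S"
  by (rule rcm_eqI) (simp add: ent_mult_proj cut.rep_eq col_restr_def)

definition conj_transpose :: "(nat \<Rightarrow> nat \<Rightarrow> complex) \<Rightarrow> nat \<Rightarrow> nat \<Rightarrow> complex"
  where "conj_transpose A = (\<lambda>r c. cnj (A c r))"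

lemma cut_conj_transpose: "cut N (conj_transpose A) = star (cut N A)"
  by (rule rcm_eqI) (simp add: cut.rep_eq star.rep_eq conj_transpose_def)

text \<open>Through this identity facts about rows carry over to columns.\<close>

lemma col_restr_eq: "col_restr S A = conj_transpose (row_restr S (conj_transpose A))"
  by (auto simp: col_restr_def row_restr_def conj_transpose_def fun_eq_iff)

lemma cut_add: "cut N (\<lambda>r c. A r c + B r c) = cut N A + cut N B"
  by (rule rcm_eqI) (simp add: cut.rep_eq plus_rcm.rep_eq)

lemma cut_scale: "cut N (\<lambda>r c. z * A r c) = smul z (cut N A)"
  by (rule rcm_eqI) (simp add: cut.rep_eq smul.rep_eq)

lemma cut_cong: "(\<And>r c. r < N \<Longrightarrow> c < N \<Longrightarrow> A r c = B r c) \<Longrightarrow> cut N A = cut N B"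
  by (rule rcm_eqI) (simp add: cut.rep_eq)

definition tnorm :: "nat \<Rightarrow> nat \<Rightarrow> (nat \<Rightarrow> nat \<Rightarrow> complex) \<Rightarrow> real"
  where "tnorm m N A = root (2 * m) (gtrace m N (cut N A))"

text \<open>The Schatten class in terms of finite truncations alone. For complex linear operators,
  \<open>schatten_trace_finite_iff\<close> and \<open>schatten_norm_eq\<close> justify
  \<open>sp_mats\<close> and \<open>mnorm\<close>.\<close>

definition sp_mats :: "nat \<Rightarrow> (nat \<Rightarrow> nat \<Rightarrow> complex) set"
  where "sp_mats m = {A. bdd_above (range (\<lambda>N. tnorm m N A))}"

definition mnorm :: "nat \<Rightarrow> (nat \<Rightarrow> nat \<Rightarrow> complex) \<Rightarrow> real"
  where "mnorm m A = (SUP N. tnorm m N A)"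

definition trunc :: "nat \<Rightarrow> (nat \<Rightarrow> nat \<Rightarrow> complex) \<Rightarrow> nat \<Rightarrow> nat \<Rightarrow> complex"
  where "trunc n A = (\<lambda>r c. if r < n \<and> c < n then A r c else 0)"

context
  fixes m :: nat
  assumes m: "m \<ge> 1"
begin

lemma tnorm_nonneg: "0 \<le> tnorm m N A"
  using m by (simp add: tnorm_def real_root_ge_zero gtrace_nonneg corner_cut)

lemma tnorm_power: "tnorm m N A ^ (2 * m) = gtrace m N (cut N A)"
  using m by (simp add: tnorm_def gtrace_nonneg corner_cut)

lemma tnorm_leI: "gtrace m N (cut N A) \<le> K ^ (2 * m) \<Longrightarrow> 0 \<le> K \<Longrightarrow> tnorm m N A \<le> K"
  unfolding tnorm_power[symmetric] using m power_mono_iff[of "tnorm m N A" K "2 * m"] tnorm_nonneg by simp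

lemma tnorm_row_restr: "tnorm m N (row_restr S A) ^ (2 * m) + tnorm m N (row_restr (- S) A) ^ (2 * m) \<le> tnorm m N A ^ (2 * m)"
  unfolding tnorm_power cut_row_restr by (rule gtrace_rows_superadditive[OF corner_cut m])

lemma tnorm_row_restr_le: "tnorm m N (row_restr S A) \<le> tnorm m N A"
proof -
  have "tnorm m N (row_restr S A) ^ (2 * m) \<le> tnorm m N A ^ (2 * m)"
    using tnorm_row_restr[of N S A] zero_le_power[OF tnorm_nonneg[of N "row_restr (- S) A"], of "2 * m"] by linarith
  then show ?thesis using m power_mono_iff[of "tnorm m N (row_restr S A)" "tnorm m N A" "2 * m"] tnorm_nonneg by simp
qed

lemma tnorm_conj_transpose: "tnorm m N (conj_transpose A) = tnorm m N A"
  by (simp add: tnorm_def cut_conj_transpose gtrace_star[OF corner_cut m])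

lemma tnorm_col_restr_le: "tnorm m N (col_restr S A) \<le> tnorm m N A"
  using tnorm_row_restr_le[of N S "conj_transpose A"] by (simp add: col_restr_eq tnorm_conj_transpose)

lemma gtrace_eqI:
  assumes "cut N A = cut M B" "N \<le> M"
  shows "gtrace m N (cut N A) = gtrace m M (cut M B)"
proof -
  have "gtrace m M (cut N A) = gtrace m N (cut N A)"
  proof -
    obtain k where k: "m = Suc k" using m by (cases m) auto
    let ?a = "(star (cut N A) * cut N A) ^ m"
    have "corner N ?a"
      unfolding k by (intro corner_power corner_mult corner_star corner_cut)
    then have "trn M ?a = trn N ?a"
      unfolding trn_def using assms(2) by (intro sum.mono_neutral_right) (auto simp: cornerD)
    then show ?thesis by (simp add: gtrace_def)
  qed
  then show ?thesis using assms(1) by simp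
qed

text \<open>A truncation is a row restriction of a column restriction of any larger one, and neither
  increases the norm. Hence the supremum in \<open>mnorm\<close> is a limit.\<close>

lemma tnorm_mono: "N \<le> M \<Longrightarrow> tnorm m N A \<le> tnorm m M A"
proof -
  assume NM: "N \<le> M"
  let ?B = "row_restr {..<N} (col_restr {..<N} A)"
  have "cut N A = cut M ?B"
    using NM by (intro rcm_eqI) (auto simp: cut.rep_eq row_restr_def col_restr_def)
  then have "tnorm m N A = tnorm m M ?B"
    unfolding tnorm_def using gtrace_eqI[of N A M ?B] NM by simp
  also have "\<dots> \<le> tnorm m M A"
    by (rule order_trans[OF tnorm_row_restr_le tnorm_col_restr_le])
  finally show ?thesis .
qed

lemma tnorm_const_corner:
  assumes "\<And>r c. A r c \<noteq> 0 \<Longrightarrow> r < N \<and> c < N" "N \<le> M"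
  shows "tnorm m M A = tnorm m N A"
proof -
  have "cut N A = cut M A"
  proof (rule rcm_eqI)
    fix i j show "ent (cut N A) i j = ent (cut M A) i j"
      using assms(1)[of i j] assms(2) by (cases "A i j = 0") (auto simp: cut.rep_eq)
  qed
  then show ?thesis using gtrace_eqI[of N A M A] assms(2) by (simp add: tnorm_def)
qed

lemma tnorm_add: "tnorm m N (\<lambda>r c. A r c + B r c) \<le> tnorm m N A + tnorm m N B"
  unfolding tnorm_def cut_add by (rule root_gtrace_add_le[OF corner_cut corner_cut m])

lemma tnorm_scale: "tnorm m N (\<lambda>r c. z * A r c) = cmod z * tnorm m N A"
proof -
  have "tnorm m N (\<lambda>r c. z * A r c) ^ (2 * m) = (cmod z * tnorm m N A) ^ (2 * m)"
    by (simp add: tnorm_power cut_scale gtrace_smul power_mult_distrib)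
  then show ?thesis
    by (rule power_eq_imp_eq_base) (use m tnorm_nonneg in auto)
qed

lemma tnorm_hsn: "tnorm m N A \<le> sqrt (\<Sum>r<N. \<Sum>c<N. (cmod (A r c))\<^sup>2)"
proof (rule tnorm_leI)
  have hsn: "hsn N (cut N A) = (\<Sum>r<N. \<Sum>c<N. (cmod (A r c))\<^sup>2)"
    unfolding hsn_def by (subst sum.swap) (simp add: cut.rep_eq)
  have "gtrace m N (cut N A) \<le> hsn N (cut N A) ^ m"
    by (rule gtrace_le_hsn[OF corner_cut m])
  also have "\<dots> = sqrt (hsn N (cut N A)) ^ (2 * m)"
    by (simp add: power_mult hsn_nonneg)
  finally show "gtrace m N (cut N A) \<le> sqrt (\<Sum>r<N. \<Sum>c<N. (cmod (A r c))\<^sup>2) ^ (2 * m)"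
    by (simp add: hsn)
qed (simp add: sum_nonneg)

text \<open>Restriction to one entry does not increase the norm, and the Gram matrix of a one-entry
  matrix is a multiple of a projection.\<close>

lemma cmod_le_tnorm:
  assumes "r < N" "c < N" shows "cmod (A r c) \<le> tnorm m N A"
proof -
  let ?B = "row_restr {r} (col_restr {c} A)"
  let ?x = "cut N ?B"
  have x: "ent ?x i j = (if i = r \<and> j = c then A r c else 0)" for i j
    using assms by (auto simp: cut.rep_eq row_restr_def col_restr_def)
  have a: "star ?x * ?x = smul (of_real ((cmod (A r c))\<^sup>2)) (proj {c})"
  proof (rule rcm_eqI)
    fix i j
    show "ent (star ?x * ?x) i j = ent (smul (of_real ((cmod (A r c))\<^sup>2)) (proj {c})) i j"
      by (subst ent_mult[of "{r}"]) (auto simp: star.rep_eq x smul.rep_eq proj.rep_eq complex_norm_square[symmetric] mult.commute simp del: of_real_power)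
  qed
  have pp: "proj {c} ^ Suc k = proj {c}" for k
    by (induction k) (simp_all add: proj_mult_proj)
  obtain k where k: "m = Suc k" using m by (cases m) auto
  have "gtrace m N ?x = cmod (A r c) ^ (2 * m)"
    unfolding gtrace_def a smul_power trn_smul k pp
    using assms by (simp add: trn_def proj.rep_eq power_mult power2_eq_square flip: of_real_power)
  then have "cmod (A r c) ^ (2 * m) = tnorm m N ?B ^ (2 * m)"
    by (simp add: tnorm_power)
  then have "cmod (A r c) = tnorm m N ?B"
    by (rule power_eq_imp_eq_base) (use m tnorm_nonneg in auto)
  also have "\<dots> \<le> tnorm m N A"
    by (rule order_trans[OF tnorm_row_restr_le tnorm_col_restr_le])
  finally show ?thesis .
qed

lemma tnorm_le_mnorm: "A \<in> sp_mats m \<Longrightarrow> tnorm m N A \<le> mnorm m A"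
  by (auto simp: sp_mats_def mnorm_def intro: cSUP_upper)

lemma sp_mats_I: "(\<And>N. tnorm m N A \<le> K) \<Longrightarrow> A \<in> sp_mats m"
  by (auto simp: sp_mats_def intro!: bdd_aboveI2)

lemma mnorm_leI: "(\<And>N. tnorm m N A \<le> K) \<Longrightarrow> mnorm m A \<le> K"
  by (auto simp: mnorm_def intro!: cSUP_least)

lemma mnorm_nonneg: "A \<in> sp_mats m \<Longrightarrow> 0 \<le> mnorm m A"
  using tnorm_le_mnorm[of A 0] tnorm_nonneg[of 0 A] by linarith

lemma tnorm_tendsto_mnorm: "A \<in> sp_mats m \<Longrightarrow> (\<lambda>N. tnorm m N A) \<longlonglongrightarrow> mnorm m A"
  unfolding mnorm_def by (rule LIMSEQ_incseq_SUP) (auto simp: sp_mats_def incseq_def intro: tnorm_mono)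

lemma sp_mats_add: "A \<in> sp_mats m \<Longrightarrow> B \<in> sp_mats m \<Longrightarrow> (\<lambda>r c. A r c + B r c) \<in> sp_mats m"
  and mnorm_add: "A \<in> sp_mats m \<Longrightarrow> B \<in> sp_mats m \<Longrightarrow> mnorm m (\<lambda>r c. A r c + B r c) \<le> mnorm m A + mnorm m B"
proof -
  assume AB: "A \<in> sp_mats m" "B \<in> sp_mats m"
  have *: "tnorm m N (\<lambda>r c. A r c + B r c) \<le> mnorm m A + mnorm m B" for N
    using tnorm_add[of N A B] tnorm_le_mnorm[OF AB(1), of N] tnorm_le_mnorm[OF AB(2), of N] by linarith
  show "(\<lambda>r c. A r c + B r c) \<in> sp_mats m" using * by (rule sp_mats_I)
  show "mnorm m (\<lambda>r c. A r c + B r c) \<le> mnorm m A + mnorm m B" using * by (rule mnorm_leI)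
qed

lemma sp_mats_scale: "A \<in> sp_mats m \<Longrightarrow> (\<lambda>r c. z * A r c) \<in> sp_mats m"
  and mnorm_scale: "A \<in> sp_mats m \<Longrightarrow> mnorm m (\<lambda>r c. z * A r c) = cmod z * mnorm m A"
proof -
  assume A: "A \<in> sp_mats m"
  have "tnorm m N (\<lambda>r c. z * A r c) \<le> cmod z * mnorm m A" for N
    unfolding tnorm_scale by (intro mult_left_mono tnorm_le_mnorm A) simp
  then show zA: "(\<lambda>r c. z * A r c) \<in> sp_mats m" by (rule sp_mats_I)
  have "(\<lambda>N. tnorm m N (\<lambda>r c. z * A r c)) \<longlonglongrightarrow> cmod z * mnorm m A"
    unfolding tnorm_scale by (intro tendsto_intros tnorm_tendsto_mnorm A)
  then show "mnorm m (\<lambda>r c. z * A r c) = cmod z * mnorm m A"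
    using tnorm_tendsto_mnorm[OF zA] LIMSEQ_unique by blast
qed

lemma sp_mats_diff: "A \<in> sp_mats m \<Longrightarrow> B \<in> sp_mats m \<Longrightarrow> (\<lambda>r c. A r c - B r c) \<in> sp_mats m"
  using sp_mats_add[OF _ sp_mats_scale[of B "-1"], of A] by simp

lemma sp_mats_row_restr: "A \<in> sp_mats m \<Longrightarrow> row_restr S A \<in> sp_mats m"
  and mnorm_row_restr: "A \<in> sp_mats m \<Longrightarrow>
    mnorm m (row_restr S A) ^ (2 * m) + mnorm m (row_restr (- S) A) ^ (2 * m) \<le> mnorm m A ^ (2 * m)"
  and mnorm_row_restr_le: "A \<in> sp_mats m \<Longrightarrow> mnorm m (row_restr S A) \<le> mnorm m A"
proof -
  assume A: "A \<in> sp_mats m"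
  have *: "tnorm m N (row_restr S A) \<le> mnorm m A" for N S
    using tnorm_row_restr_le[of N S A] tnorm_le_mnorm[OF A, of N] by linarith
  then have sp_mats: "row_restr S A \<in> sp_mats m" for S by (rule sp_mats_I)
  then show "row_restr S A \<in> sp_mats m" .
  show "mnorm m (row_restr S A) \<le> mnorm m A" using * by (rule mnorm_leI)
  show "mnorm m (row_restr S A) ^ (2 * m) + mnorm m (row_restr (- S) A) ^ (2 * m) \<le> mnorm m A ^ (2 * m)"
    using tnorm_row_restr
    by (intro LIMSEQ_le[OF tendsto_add[OF tendsto_power[OF tnorm_tendsto_mnorm[OF sp_mats]]
          tendsto_power[OF tnorm_tendsto_mnorm[OF sp_mats]]] tendsto_power[OF tnorm_tendsto_mnorm[OF A]]]) blast
qed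

lemma sp_mats_conj_transpose: "conj_transpose A \<in> sp_mats m \<longleftrightarrow> A \<in> sp_mats m"
  by (simp add: sp_mats_def tnorm_conj_transpose)

lemma mnorm_conj_transpose: "mnorm m (conj_transpose A) = mnorm m A"
  by (simp add: mnorm_def tnorm_conj_transpose)

lemma sp_mats_col_restr: "A \<in> sp_mats m \<Longrightarrow> col_restr S A \<in> sp_mats m"
  by (simp add: col_restr_eq sp_mats_conj_transpose sp_mats_row_restr)

lemma mnorm_col_restr_le: "A \<in> sp_mats m \<Longrightarrow> mnorm m (col_restr S A) \<le> mnorm m A"
  using mnorm_row_restr_le[of "conj_transpose A" S]
  by (simp add: col_restr_eq sp_mats_conj_transpose mnorm_conj_transpose)

lemma cmod_le_mnorm: "A \<in> sp_mats m \<Longrightarrow> cmod (A r c) \<le> mnorm m A"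
  by (rule order_trans[OF cmod_le_tnorm[of r "Suc (max r c)" c A] tnorm_le_mnorm]) auto

lemma sp_mats_corner:
  assumes "\<And>r c. A r c \<noteq> 0 \<Longrightarrow> r < N \<and> c < N"
  shows "A \<in> sp_mats m" and "mnorm m A = tnorm m N A"
proof -
  have *: "tnorm m M A \<le> tnorm m N A" for M
    using tnorm_const_corner[of A N "max M N", OF assms] tnorm_mono[of M "max M N" A] by simp
  then show "A \<in> sp_mats m" by (rule sp_mats_I)
  then show "mnorm m A = tnorm m N A"
    using * by (intro antisym mnorm_leI tnorm_le_mnorm)
qed

lemma tnorm_trunc: "tnorm m N (trunc N A) = tnorm m N A"
  unfolding tnorm_def by (subst cut_cong[of N _ A]) (auto simp: trunc_def)

lemma mnorm_trunc: "mnorm m (trunc n A) = tnorm m n A"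
  using sp_mats_corner(2)[of "trunc n A" n] tnorm_trunc by (auto simp: trunc_def split: if_splits)

lemma sp_mats_trunc: "trunc n A \<in> sp_mats m"
  by (rule sp_mats_corner(1)[of _ n]) (auto simp: trunc_def split: if_splits)

text \<open>By superadditivity the \<open>2 m\<close>-th powers of head and tail add up to at most
  that of the whole, and the head dominates the truncation, which exhausts the norm in the
  limit.\<close>

lemma mnorm_row_restr_tail:
  assumes A: "A \<in> sp_mats m"
  shows "(\<lambda>n. mnorm m (row_restr (- {..<n}) A)) \<longlonglongrightarrow> 0"
proof -
  have lim: "(\<lambda>n. mnorm m A ^ (2 * m) - tnorm m n A ^ (2 * m)) \<longlonglongrightarrow> 0"
    using tendsto_diff[OF tendsto_const tendsto_power[OF tnorm_tendsto_mnorm[OF A]], of "mnorm m A ^ (2 * m)" "2 * m"]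
    by simp
  have root0: "f \<longlonglongrightarrow> 0" if "(\<lambda>n. f n ^ (2 * m)) \<longlonglongrightarrow> 0" "\<And>n. 0 \<le> f n" for f :: "nat \<Rightarrow> real"
  proof -
    have "(\<lambda>n. root (2 * m) (f n ^ (2 * m))) \<longlonglongrightarrow> root (2 * m) 0"
      by (intro tendsto_intros that)
    then show ?thesis using that(2) m by (simp add: real_root_power_cancel)
  qed
  show "(\<lambda>n. mnorm m (row_restr (- {..<n}) A)) \<longlonglongrightarrow> 0"
  proof (rule root0)
    have "mnorm m (row_restr (- {..<n}) A) ^ (2 * m) \<le> mnorm m A ^ (2 * m) - tnorm m n A ^ (2 * m)" for n
    proof -
      have "tnorm m n A = tnorm m n (row_restr {..<n} A)"
        unfolding tnorm_def by (subst cut_cong[of n A "row_restr {..<n} A"]) (auto simp: row_restr_def)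
      then have "tnorm m n A \<le> mnorm m (row_restr {..<n} A)"
        by (simp add: tnorm_le_mnorm sp_mats_row_restr A)
      then have "tnorm m n A ^ (2 * m) \<le> mnorm m (row_restr {..<n} A) ^ (2 * m)"
        by (intro power_mono tnorm_nonneg)
      then show ?thesis using mnorm_row_restr[OF A, of "{..<n}"] by linarith
    qed
    then show "(\<lambda>n. mnorm m (row_restr (- {..<n}) A) ^ (2 * m)) \<longlonglongrightarrow> 0"
      by (intro tendsto_sandwich[OF _ _ tendsto_const lim]) (auto simp: mnorm_nonneg sp_mats_row_restr A)
  qed (simp add: mnorm_nonneg sp_mats_row_restr A)
qed

lemma mnorm_col_restr_tail:
  "A \<in> sp_mats m \<Longrightarrow> (\<lambda>n. mnorm m (col_restr (- {..<n}) A)) \<longlonglongrightarrow> 0"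
  using mnorm_row_restr_tail[of "conj_transpose A"]
  by (simp add: col_restr_eq sp_mats_conj_transpose mnorm_conj_transpose)

lemma mnorm_trunc_tendsto:
  assumes A: "A \<in> sp_mats m"
  shows "(\<lambda>n. mnorm m (\<lambda>r c. trunc n A r c - A r c)) \<longlonglongrightarrow> 0"
proof (rule tendsto_sandwich[OF _ _ tendsto_const])
  show "(\<lambda>n. mnorm m (row_restr (- {..<n}) A) + mnorm m (col_restr (- {..<n}) A)) \<longlonglongrightarrow> 0"
    using tendsto_add[OF mnorm_row_restr_tail[OF A] mnorm_col_restr_tail[OF A]] by simp
  show "\<forall>\<^sub>F n in sequentially. 0 \<le> mnorm m (\<lambda>r c. trunc n A r c - A r c)"
    by (simp add: mnorm_nonneg sp_mats_diff sp_mats_trunc A)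
  have "mnorm m (\<lambda>r c. trunc n A r c - A r c)
      \<le> mnorm m (row_restr (- {..<n}) A) + mnorm m (col_restr (- {..<n}) A)" for n
  proof -
    \<comment> \<open>The complement of the square consists of the rows from \<open>n\<close> on
      and, within the first \<open>n\<close> rows, of the columns from \<open>n\<close> on.\<close>
    let ?B = "row_restr {..<n} (col_restr (- {..<n}) A)"
    have "(\<lambda>r c. trunc n A r c - A r c) = (\<lambda>r c. (-1) * (row_restr (- {..<n}) A r c + ?B r c))"
      by (auto simp: trunc_def row_restr_def col_restr_def fun_eq_iff)
    then have "mnorm m (\<lambda>r c. trunc n A r c - A r c) = mnorm m (\<lambda>r c. row_restr (- {..<n}) A r c + ?B r c)"
      using mnorm_scale[OF sp_mats_add[OF sp_mats_row_restr[OF A] sp_mats_row_restr[OF sp_mats_col_restr[OF A]]],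
        of "-1" "- {..<n}" "{..<n}" "- {..<n}"] by simp
    also have "\<dots> \<le> mnorm m (row_restr (- {..<n}) A) + mnorm m ?B"
      by (intro mnorm_add sp_mats_row_restr sp_mats_col_restr A)
    also have "mnorm m ?B \<le> mnorm m (col_restr (- {..<n}) A)"
      by (intro mnorm_row_restr_le sp_mats_col_restr A)
    finally show ?thesis by simp
  qed
  then show "\<forall>\<^sub>F n in sequentially. mnorm m (\<lambda>r c. trunc n A r c - A r c)
      \<le> mnorm m (row_restr (- {..<n}) A) + mnorm m (col_restr (- {..<n}) A)"
    by simp
qed

end


section \<open>Closed walks\<close>

lemma is_path_walk:
  "is_path J u v vs \<longleftrightarrow> vs \<noteq> [] \<and> hd vs = u \<and> last vs = v \<and> distinct vs \<and>
    (\<forall>i. Suc i < length vs \<longrightarrow> adjacent J (vs ! i) (vs ! Suc i))"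
  by (simp add: is_path_def successively_conv_nth)

lemma adjacent_commute: "adjacent J u v \<longleftrightarrow> adjacent J v u"
  by (simp add: adjacent_def insert_commute)

lemma adjacent_mono: "adjacent J u v \<Longrightarrow> J \<subseteq> K \<Longrightarrow> adjacent K u v"
  by (auto simp: adjacent_def)

lemma adjacent_isl: "adjacent J u v \<Longrightarrow> isl v \<longleftrightarrow> \<not> isl u"
  by (auto simp: adjacent_def doubleton_eq_iff)

lemma adjacent_Inl_Inr: "adjacent J (Inl r) (Inr c) \<longleftrightarrow> (r, c) \<in> J"
  by (auto simp: adjacent_def doubleton_eq_iff)

text \<open>\<open>graph_dist\<close> is an infimum over paths with distinct vertices, while the
  arguments below produce walks. A repeated vertex encloses a loop that can be cut out.\<close>

lemma graph_dist_le_walk: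
  assumes "w 0 = u" "w L = v" "\<And>t. t < L \<Longrightarrow> adjacent J (w t) (w (Suc t))"
  shows "graph_dist J u v \<le> enat L"
  using assms
proof (induction L arbitrary: w rule: less_induct)
  case (less L)
  show ?case
  proof (cases "inj_on w {..L}")
    case True
    define vs where "vs = map w [0..<Suc L]"
    have "is_path J u v vs"
      unfolding is_path_walk using less.prems True
      by (auto simp: vs_def distinct_map last_map hd_map hd_upt lessThan_Suc_atMost[symmetric]
          atLeast0LessThan simp del: upt_Suc)
    then have "graph_dist J u v \<le> enat (length vs - 1)"
      unfolding graph_dist_def by (intro INF_lower) simp
    then show ?thesis by (simp add: vs_def)
  next
    case False
    then obtain i j where ij: "i < j" "j \<le> L" "w i = w j"
      unfolding inj_on_def by (metis atMost_iff linorder_neqE_nat)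
    define w' where "w' t = (if t \<le> i then w t else w (t + (j - i)))" for t
    have "graph_dist J u v \<le> enat (L - (j - i))"
    proof (rule less.IH)
      show "L - (j - i) < L" using ij by simp
      show "w' 0 = u" using less.prems by (simp add: w'_def)
      show "w' (L - (j - i)) = v"
      proof (cases "L - (j - i) \<le> i")
        case True
        then have "L - (j - i) = i" "j = L" using ij by auto
        then show ?thesis using ij less.prems by (simp add: w'_def)
      qed (use ij less.prems in \<open>auto simp: w'_def\<close>)
      fix t assume t: "t < L - (j - i)"
      show "adjacent J (w' t) (w' (Suc t))"
      proof (cases "t = i")
        case True
        then have "Suc t + (j - i) = Suc j" using ij by simp
        then show ?thesis using True ij t less.prems(3)[of j] by (simp add: w'_def)
      next
        case False
        then show ?thesis using t ij less.prems(3)[of t] less.prems(3)[of "t + (j - i)"]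
          by (auto simp: w'_def)
      qed
    qed
    also have "\<dots> \<le> enat L" by simp
    finally show ?thesis .
  qed
qed

text \<open>Nonempty sets of extended naturals contain their infimum; the empty set would give
  distance \<open>\<infinity>\<close>.\<close>

lemma graph_dist_attained:
  assumes "graph_dist J u v = enat d"
  obtains vs where "is_path J u v vs" "length vs = Suc d"
proof -
  let ?D = "(\<lambda>vs. enat (length vs - 1)) ` {vs. is_path J u v vs}"
  have "?D \<noteq> {}"
  proof
    assume "?D = {}"
    then have "graph_dist J u v = \<infinity>" unfolding graph_dist_def by (simp only: Inf_empty top_enat_def)
    then show False using assms by simp
  qed
  then have "Inf ?D \<in> ?D" by (metis ex_in_conv wellorder_InfI)
  then obtain vs where "is_path J u v vs" "length vs - 1 = d"
    using assms unfolding graph_dist_def by auto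
  moreover have "vs \<noteq> []" using \<open>is_path J u v vs\<close> by (simp add: is_path_def)
  ultimately show ?thesis using that[of vs] by (cases vs) auto
qed

lemma walk_isl:
  assumes "\<And>t. t < L \<Longrightarrow> adjacent J (w t) (w (Suc t))"
  shows "t \<le> L \<Longrightarrow> isl (w t) \<longleftrightarrow> (isl (w 0) \<longleftrightarrow> even t)"
proof (induction t)
  case (Suc t)
  then show ?case using adjacent_isl[OF assms[of t]] by auto
qed simp

lemma graph_dist_odd:
  assumes "graph_dist J (Inl r) (Inr c) = enat d"
  shows "odd d"
proof -
  obtain vs where vs: "is_path J (Inl r) (Inr c) vs" "length vs = Suc d"
    using graph_dist_attained[OF assms] .
  then have "vs ! 0 = Inl r" "vs ! d = Inr c"
    by (auto simp: is_path_def hd_conv_nth last_conv_nth)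
  then show ?thesis
    using walk_isl[of d J "(!) vs" d] vs by (auto simp: is_path_walk)
qed

lemma graph_dist_anti_mono: "J \<subseteq> K \<Longrightarrow> graph_dist K u v \<le> graph_dist J u v"
  unfolding graph_dist_def
  by (rule INF_superset_mono) (use adjacent_mono[of J _ _ K] in \<open>auto simp: is_path_walk\<close>)

section \<open>The graph condition for nested squares\<close>

definition graph_condition :: "nat \<Rightarrow> (nat \<times> nat) set \<Rightarrow> bool"
  where "graph_condition p I \<longleftrightarrow> (\<forall>r c j. graph_dist I (Inl r) (Inr c) = enat (2 * j + 1) \<and> 2 * j + 1 \<le> p div 2
           \<longrightarrow> asymptotic_dist I r c \<ge> enat (p - 2 * j + 1))"

text \<open>A supremum that is at least \<open>Suc k\<close> exceeds \<open>k\<close>, and then so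
  does the distance for a single rectangle; removing a square that contains this rectangle can only
  increase the distance.\<close>

lemma asymptotic_dist_geD:
  assumes "enat (Suc k) \<le> asymptotic_dist I r c"
  shows "\<exists>n. enat (Suc k) \<le> graph_dist (I - {..<n} \<times> {..<n}) (Inl r) (Inr c)"
proof -
  have "enat k < asymptotic_dist I r c"
    using assms by (simp add: Suc_ile_eq)
  then obtain R' C' where fin: "finite R'" "finite C'"
    and k: "enat k < graph_dist (I - R' \<times> C') (Inl r) (Inr c)"
    unfolding asymptotic_dist_def less_SUP_iff by auto
  obtain n where n: "R' \<union> C' \<subseteq> {..<n}"
    using fin finite_nat_set_iff_bounded[of "R' \<union> C'"] by (auto simp: subset_iff)
  have "graph_dist (I - R' \<times> C') (Inl r) (Inr c) \<le> graph_dist (I - {..<n} \<times> {..<n}) (Inl r) (Inr c)"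
    using n by (intro graph_dist_anti_mono) auto
  then show ?thesis using k by (intro exI[of _ n]) (simp add: Suc_ile_eq)
qed

text \<open>One removed square of size \<open>n'\<close> achieves the asymptotic bound for all
  relevant pairs below \<open>n\<close> at once.\<close>

definition separated :: "nat \<Rightarrow> (nat \<times> nat) set \<Rightarrow> nat \<Rightarrow> nat \<Rightarrow> bool"
  where "separated m I n n' \<longleftrightarrow> (\<forall>r<n. \<forall>c<n. \<forall>j. graph_dist I (Inl r) (Inr c) = enat (2 * j + 1) \<and> 2 * j + 1 \<le> m
    \<longrightarrow> enat (2 * m - 2 * j + 1) \<le> graph_dist (I - {..<n'} \<times> {..<n'}) (Inl r) (Inr c))"

lemma separated_exists:
  assumes "graph_condition (2 * m) I"
  shows "\<exists>n'>n. separated m I n n'"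
proof -
  let ?P = "\<lambda>r c N. \<forall>j. graph_dist I (Inl r) (Inr c) = enat (2 * j + 1) \<and> 2 * j + 1 \<le> m
    \<longrightarrow> enat (2 * m - 2 * j + 1) \<le> graph_dist (I - {..<N} \<times> {..<N}) (Inl r) (Inr c)"
  have "\<exists>N. ?P r c N" for r c
  proof (cases "\<exists>j. graph_dist I (Inl r) (Inr c) = enat (2 * j + 1) \<and> 2 * j + 1 \<le> m")
    case True
    then obtain j where j: "graph_dist I (Inl r) (Inr c) = enat (2 * j + 1)" "2 * j + 1 \<le> m"
      by blast
    then have "enat (Suc (2 * m - 2 * j)) \<le> asymptotic_dist I r c"
      using assms by (simp add: graph_condition_def)
    from asymptotic_dist_geD[OF this] show ?thesis using j by auto
  qed auto
  then obtain N where N: "\<And>r c. ?P r c (N r c)" by metis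
  \<comment> \<open>The sum is a common upper bound of the finitely many thresholds, and
    \<open>Suc n\<close> makes \<open>n'\<close> exceed \<open>n\<close>.\<close>
  define n' where "n' = Suc n + (\<Sum>r<n. \<Sum>c<n. N r c)"
  have "?P r c n'" if rc: "r < n" "c < n" for r c
  proof -
    have "N r c \<le> (\<Sum>c<n. N r c)" using rc by (intro member_le_sum) auto
    also have "\<dots> \<le> (\<Sum>r<n. \<Sum>c<n. N r c)"
      using rc by (intro member_le_sum[of r _ "\<lambda>r. \<Sum>c<n. N r c"]) auto
    finally have "N r c \<le> n'" by (simp add: n'_def)
    then have "graph_dist (I - {..<N r c} \<times> {..<N r c}) (Inl r) (Inr c)
        \<le> graph_dist (I - {..<n'} \<times> {..<n'}) (Inl r) (Inr c)"
      by (intro graph_dist_anti_mono) auto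
    then show ?thesis using N[of r c] order_trans by blast
  qed
  then show ?thesis by (intro exI[of _ n']) (simp add: n'_def separated_def)
qed

text \<open>A closed walk of length \<open>2 m\<close> is a \<open>2 m\<close>-periodic sequence whose even terms are columns and whose
  odd terms are rows.\<close>

definition walk_edge :: "(nat \<Rightarrow> nat) \<Rightarrow> nat \<Rightarrow> nat \<times> nat"
  where "walk_edge f i = (if even i then (f (Suc i), f i) else (f i, f (Suc i)))"

definition walk_vertex :: "(nat \<Rightarrow> nat) \<Rightarrow> nat \<Rightarrow> nat + nat"
  where "walk_vertex f i = (if even i then Inr (f i) else Inl (f i))"

lemma adjacent_walk_vertex: "walk_edge f i \<in> J \<Longrightarrow> adjacent J (walk_vertex f i) (walk_vertex f (Suc i))"
  by (auto simp: walk_edge_def walk_vertex_def adjacent_Inl_Inr adjacent_commute[of J "Inr _"] split: if_splits)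

text \<open>Distances are taken from the row to the column, so a segment that starts at a column
  (even \<open>a\<close>) is traversed backwards.\<close>

lemma graph_dist_walk:
  assumes "\<And>t. t < L \<Longrightarrow> walk_edge f (a + t) \<in> J" "odd L"
  shows "graph_dist J (Inl (if even a then f (a + L) else f a)) (Inr (if even a then f a else f (a + L))) \<le> enat L"
proof (cases "even a")
  case True
  show ?thesis
  proof (rule graph_dist_le_walk[of "\<lambda>t. walk_vertex f (a + (L - t))"])
    fix t assume t: "t < L"
    then have "adjacent J (walk_vertex f (a + (L - Suc t))) (walk_vertex f (Suc (a + (L - Suc t))))"
      by (intro adjacent_walk_vertex assms) simp
    also have "Suc (a + (L - Suc t)) = a + (L - t)" using t by simp
    finally show "adjacent J (walk_vertex f (a + (L - t))) (walk_vertex f (a + (L - Suc t)))"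
      by (subst adjacent_commute)
  qed (use True assms(2) in \<open>auto simp: walk_vertex_def\<close>)
next
  case False
  show ?thesis
  proof (rule graph_dist_le_walk[of "\<lambda>t. walk_vertex f (a + t)"])
    show "adjacent J (walk_vertex f (a + t)) (walk_vertex f (a + Suc t))" if "t < L" for t
      using adjacent_walk_vertex[OF assms(1)[OF that]] by simp
  qed (use False assms(2) in \<open>auto simp: walk_vertex_def\<close>)
qed

text \<open>The segment and the rest of the closed walk join the same row and column, so the
  distance \<open>2 j + 1\<close> of these is at most \<open>L\<close> and at most
  \<open>2 m - L\<close>, hence at most \<open>m\<close>. Then \<open>separated\<close> demands
  \<open>L \<ge> 2 m - 2 j + 1\<close>, contrary to \<open>2 j + 1 \<le> 2 m - L\<close>.\<close>

lemma no_odd_far_segment: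
  assumes far: "separated m I n n'"
    and per: "\<And>i. f (i + 2 * m) = f i"
    and I: "\<And>i. walk_edge f i \<in> I"
    and L: "odd L" "L < 2 * m"
    and seg: "\<And>t. t < L \<Longrightarrow> walk_edge f (a + t) \<notin> {..<n'} \<times> {..<n'}"
    and ends: "f a < n" "f (a + L) < n"
  shows False
proof -
  define r where "r = (if even a then f (a + L) else f a)"
  define c where "c = (if even a then f a else f (a + L))"
  have rc: "r < n" "c < n" using ends by (auto simp: r_def c_def)
  have d1: "graph_dist (I - {..<n'} \<times> {..<n'}) (Inl r) (Inr c) \<le> enat L"
    unfolding r_def c_def using I seg L(1) by (intro graph_dist_walk) auto
  have d2: "graph_dist I (Inl r) (Inr c) \<le> enat (2 * m - L)"
  proof -
    have "graph_dist I (Inl (if even (a + L) then f ((a + L) + (2 * m - L)) else f (a + L)))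
        (Inr (if even (a + L) then f (a + L) else f ((a + L) + (2 * m - L)))) \<le> enat (2 * m - L)"
      using I L by (intro graph_dist_walk) auto
    moreover have "f ((a + L) + (2 * m - L)) = f a" using per[of a] L by simp
    ultimately show ?thesis using L(1) by (simp add: r_def c_def split: if_splits)
  qed
  have d3: "graph_dist I (Inl r) (Inr c) \<le> enat L"
    by (rule order_trans[OF graph_dist_anti_mono d1]) auto
  then obtain d where d: "graph_dist I (Inl r) (Inr c) = enat d"
    by (metis enat_ile)
  then obtain j where j: "d = 2 * j + 1" using graph_dist_odd oddE by metis
  have "d \<le> L" "d \<le> 2 * m - L" using d d2 d3 by auto
  then have "2 * j + 1 \<le> m" using j by simp
  then have "enat (2 * m - 2 * j + 1) \<le> enat L"
    using far[unfolded separated_def] rc d j d1 order_trans by blast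
  then show False using \<open>d \<le> 2 * m - L\<close> j L by simp
qed

lemma prod_shift_periodic:
  fixes g :: "nat \<Rightarrow> complex"
  assumes "\<And>i. g (i + k) = g i"
  shows "(\<Prod>t<k. g (s + t)) = (\<Prod>t<k. g t)"
proof (induction s)
  case (Suc s)
  have "(\<Prod>t<k. g (Suc s + t)) * g s = (\<Prod>t<Suc k. g (s + t))"
    by (subst prod.lessThan_Suc_shift) (simp add: mult.commute)
  also have "\<dots> = (\<Prod>t<k. g (s + t)) * g s"
    by (simp add: assms)
  finally have shift: "(\<Prod>t<k. g (Suc s + t)) * g s = (\<Prod>t<k. g (s + t)) * g s" .
  \<comment> \<open>The two products differ by exchanging \<open>g s\<close> for the equal factor
    \<open>g (s + k)\<close>. If it vanishes it cannot be cancelled, but then both products are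
    zero.\<close>
  show ?case
  proof (cases "g s = 0 \<and> k > 0")
    case True
    have "g (Suc s + (k - 1)) = 0" using True assms[of s] by simp
    then have z1: "(\<Prod>t<k. g (Suc s + t)) = 0" using True
      by (intro prod_zero) (auto intro!: bexI[of _ "k - 1"])
    have z2: "(\<Prod>t<k. g (s + t)) = 0" using True
      by (intro prod_zero) (auto intro!: bexI[of _ 0])
    show ?thesis using Suc z1 z2 by metis
  next
    case False
    then show ?thesis using Suc shift
      by (cases "k = 0") auto
  qed
qed simp

lemma prod_lessThan_add:
  fixes g :: "nat \<Rightarrow> complex"
  shows "(\<Prod>t<a + b. g t) = (\<Prod>t<a. g t) * (\<Prod>t<b. g (a + t))"
  by (induction b) (simp_all add: mult.assoc)

lemma walk_edge_bounded:
  "walk_edge f i \<in> {..<n} \<times> {..<n} \<Longrightarrow> f i < n" "walk_edge f i \<in> {..<n} \<times> {..<n} \<Longrightarrow> f (Suc i) < n"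
  by (simp_all add: walk_edge_def split: if_splits)

text \<open>Between consecutive near edges the far edges form stretches of even length, along which
  \<open>\<mu>\<close> and \<open>cnj \<mu>\<close> alternate and cancel in pairs. A walk without
  near edges is a single stretch of even length \<open>2 m\<close>.\<close>

lemma closed_walk_weight:
  fixes \<mu> :: complex
  assumes far: "separated m I n n'"
    and per: "\<And>i. f (i + 2 * m) = f i"
    and I: "\<And>i. walk_edge f i \<in> I"
    and nf: "\<And>i. walk_edge f i \<in> {..<n} \<times> {..<n} \<or> walk_edge f i \<notin> {..<n'} \<times> {..<n'}"
    and \<mu>: "cmod \<mu> = 1"
  shows "(\<Prod>i<2 * m. if walk_edge f i \<in> {..<n} \<times> {..<n} then 1 else if even i then cnj \<mu> else \<mu>) = 1"
proof -
  let ?near = "\<lambda>i. walk_edge f i \<in> {..<n} \<times> {..<n}"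
  define g where "g i = (if ?near i then 1 else if even i then cnj \<mu> else \<mu>)" for i
  have we: "walk_edge f (i + 2 * m) = walk_edge f i" for i
    using per[of i] per[of "Suc i"] by (simp add: walk_edge_def)
  have mu: "cnj \<mu> * \<mu> = 1" "\<mu> * cnj \<mu> = 1"
    using \<mu> complex_norm_square[of \<mu>] by (simp_all add: mult.commute)
  have seg: "(\<Prod>t<2 * q. g (a + t)) = 1" if "\<And>t. t < 2 * q \<Longrightarrow> \<not> ?near (a + t)" for a q
    using that
  proof (induction q)
    case (Suc q)
    have "(\<Prod>t<2 * Suc q. g (a + t)) = (\<Prod>t<2 * q. g (a + t)) * (g (a + 2 * q) * g (a + Suc (2 * q)))"
      by (simp add: mult.assoc)
    also have "\<dots> = 1"
    proof -
      have "(\<Prod>t<2 * q. g (a + t)) = 1" using Suc.prems by (intro Suc.IH) simp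
      moreover have "g (a + 2 * q) * g (a + Suc (2 * q)) = 1"
        using Suc.prems[of "2 * q"] Suc.prems[of "Suc (2 * q)"] mu by (simp add: g_def)
      ultimately show ?thesis by simp
    qed
    finally show ?case .
  qed simp
  have "(\<Prod>i<2 * m. g i) = 1"
  proof (cases "\<exists>s. ?near s")
    case False
    then show ?thesis using seg[of m 0] by simp
  next
    case True
    then obtain s where s: "?near s" ..
    \<comment> \<open>The walk is read from a near edge \<open>s\<close>, so that each far stretch
      has near edges on both sides. Passing from a near position \<open>i\<close> to the preceding
      near position \<open>l\<close> removes one stretch.\<close>
    have main: "i \<le> 2 * m \<Longrightarrow> ?near (s + i) \<Longrightarrow> (\<Prod>t<i. g (s + t)) = 1" for i
    proof (induction i rule: less_induct)
      case (less i)
      show ?case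
      proof (cases "i = 0")
        case False
        define S where "S = {l. l < i \<and> ?near (s + l)}"
        define l where "l = Max S"
        have "finite S" by (rule finite_subset[of _ "{..<i}"]) (auto simp: S_def)
        moreover have "0 \<in> S" using False s by (simp add: S_def)
        ultimately have "l \<in> S" and le: "\<And>t. t \<in> S \<Longrightarrow> t \<le> l" unfolding l_def using Max_in Max_ge by blast+
        then have l: "l < i" "?near (s + l)" by (simp_all add: S_def)
        have lmax: "\<not> ?near (s + t)" if "l < t" "t < i" for t
          using le[of t] that by (auto simp: S_def)
        define L where "L = i - Suc l"
        have i: "i = Suc l + L" using l by (simp add: L_def)
        have f: "\<not> ?near (s + Suc l + t)" if "t < L" for t
          
        proof -
          have "l < Suc l + t" "Suc l + t < i" using that i by auto
          from lmax[OF this] show ?thesis by (simp only: add.assoc not_False_eq_True)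
        qed
        have "even L"
        proof (rule ccontr)
          assume "odd L"
          show False
          proof (rule no_odd_far_segment[where f = f and a = "s + Suc l" and L = L and n = n and n' = n' and I = I and m = m])
            show "L < 2 * m" using less.prems i by simp
            show "walk_edge f (s + Suc l + t) \<notin> {..<n'} \<times> {..<n'}" if "t < L" for t
              using nf[of "s + Suc l + t"] f[OF that] by satx
            show "f (s + Suc l) < n" using walk_edge_bounded(2)[OF l(2)] by simp
            have "f (s + i) < n" by (rule walk_edge_bounded(1)[OF less.prems(2)])
            moreover have "s + Suc l + L = s + i" using i by simp
            ultimately show "f (s + Suc l + L) < n" by (simp only:)
          qed (fact far, fact per, fact I, fact \<open>odd L\<close>)
        qed
        then obtain q where q: "L = 2 * q" by (rule evenE)
        have "(\<Prod>t<i. g (s + t)) = (\<Prod>t<Suc l. g (s + t)) * (\<Prod>t<L. g (s + (Suc l + t)))"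
          unfolding i by (rule prod_lessThan_add)
        also have "(\<Prod>t<L. g (s + (Suc l + t))) = 1"
        proof -
          have "(\<Prod>t<2 * q. g (s + Suc l + t)) = 1" using f unfolding q by (rule seg)
          then show ?thesis by (simp only: q add.assoc)
        qed
        also have "(\<Prod>t<Suc l. g (s + t)) = 1"
        proof -
          have "(\<Prod>t<l. g (s + t)) = 1" using less.IH[OF l(1) _ l(2)] less.prems(1) l(1) by linarith
          moreover have "g (s + l) = 1" using l(2) by (simp only: g_def if_True)
          ultimately show ?thesis by simp
        qed
        finally show ?thesis by simp
      qed simp
    qed
    have "(\<Prod>t<2 * m. g (s + t)) = 1" using main[of "2 * m"] s by (simp add: we)
    moreover have "(\<Prod>t<2 * m. g (s + t)) = (\<Prod>t<2 * m. g t)"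
      by (rule prod_shift_periodic) (simp add: g_def we)
    ultimately show ?thesis by simp
  qed
  then show ?thesis by (simp add: g_def)
qed

section \<open>Traces as sums over closed walks\<close>

primrec chain :: "(nat \<Rightarrow> rcm) \<Rightarrow> nat \<Rightarrow> nat \<Rightarrow> rcm" where
  "chain B i 0 = B i"
| "chain B i (Suc n) = B i * chain B (Suc i) n"

text \<open>The list \<open>ws\<close> holds the \<open>n\<close> intermediate indices of a product
  of \<open>n + 1\<close> factors.\<close>

lemma ent_chain:
  assumes B: "\<And>i. corner N (B i)"
  shows "ent (chain B i n) u v
    = (\<Sum>ws\<in>{ws. set ws \<subseteq> {..<N} \<and> length ws = n}. \<Prod>k\<le>n. ent (B (i + k)) ((u # ws @ [v]) ! k) ((u # ws @ [v]) ! Suc k))"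
proof (induction n arbitrary: i u)
  case 0
  have "{ws. set ws \<subseteq> {..<N} \<and> length ws = 0} = {[]}" by auto
  then show ?case by simp
next
  case (Suc n)
  let ?Ls = "\<lambda>n. {ws. set ws \<subseteq> {..<N} \<and> length ws = n}"
  have "ent (chain B i (Suc n)) u v = (\<Sum>w<N. ent (B i) u w * ent (chain B (Suc i) n) w v)"
    by (simp, rule ent_mult_less) (simp add: cornerD[OF B])
  also have "\<dots> = (\<Sum>w<N. \<Sum>ws\<in>?Ls n. ent (B i) u w *
      (\<Prod>k\<le>n. ent (B (Suc i + k)) ((w # ws @ [v]) ! k) ((w # ws @ [v]) ! Suc k)))"
    by (simp add: Suc.IH sum_distrib_left)
  also have "\<dots> = (\<Sum>w<N. \<Sum>ws\<in>?Ls n.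
      (\<Prod>k\<le>Suc n. ent (B (i + k)) ((u # (w # ws) @ [v]) ! k) ((u # (w # ws) @ [v]) ! Suc k)))"
    by (subst prod.atMost_Suc_shift) simp
  also have "\<dots> = (\<Sum>(w, ws)\<in>{..<N} \<times> ?Ls n.
      (\<Prod>k\<le>Suc n. ent (B (i + k)) ((u # (w # ws) @ [v]) ! k) ((u # (w # ws) @ [v]) ! Suc k)))"
    by (rule sum.cartesian_product)
  also have "\<dots> = (\<Sum>ws\<in>?Ls (Suc n).
      (\<Prod>k\<le>Suc n. ent (B (i + k)) ((u # ws @ [v]) ! k) ((u # ws @ [v]) ! Suc k)))"
    by (rule sum.reindex_bij_witness[of _ "\<lambda>ws. (hd ws, tl ws)" "\<lambda>(w, ws). w # ws"])
      (auto simp: length_Suc_conv)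
  finally show ?case .
qed

lemma chain_alternating:
  assumes "\<And>i. B i = (if even i then star C else C)" "even i"
  shows "chain B i (Suc (2 * k)) = (star C * C) ^ Suc k"
  using assms(2)
proof (induction k arbitrary: i)
  case 0 then show ?case by (simp add: assms(1))
next
  case (Suc k)
  have "chain B i (Suc (2 * Suc k)) = B i * (B (Suc i) * chain B (Suc (Suc i)) (Suc (2 * k)))"
    by simp
  also have "\<dots> = star C * (C * (star C * C) ^ Suc k)"
    using Suc.prems by (subst Suc.IH) (simp_all add: assms(1))
  finally show ?case by (simp add: mult.assoc)
qed

text \<open>The trace is a sum over closed walks on which \<open>A\<close> does not vanish, and each
  summand is multiplied by the product of \<open>\<gamma>\<close> along its walk, conjugated at the
  steps that use \<open>star\<close>.\<close>

lemma gtrace_gauge: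
  fixes \<gamma> :: "nat \<Rightarrow> nat \<Rightarrow> complex"
  assumes m: "m \<ge> 1"
    and g: "\<And>f. (\<And>i. f (i + 2 * m) = f i) \<Longrightarrow> (\<And>i. A (fst (walk_edge f i)) (snd (walk_edge f i)) \<noteq> 0) \<Longrightarrow>
      (\<Prod>i<2 * m. if even i then cnj (\<gamma> (fst (walk_edge f i)) (snd (walk_edge f i)))
        else \<gamma> (fst (walk_edge f i)) (snd (walk_edge f i))) = 1"
  shows "gtrace m N (cut N (\<lambda>r c. \<gamma> r c * A r c)) = gtrace m N (cut N A)"
proof -
  obtain k where k: "m = Suc k" using m by (cases m) auto
  let ?Ls = "{ws. set ws \<subseteq> {..<N} \<and> length ws = Suc (2 * k)}"
  define B where "B D i = (if even i then star (cut N D) else cut N D)" for D and i :: nat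
  have cB: "corner N (B D i)" for D i by (simp add: B_def corner_star corner_cut)
  have ex: "ent ((star (cut N D) * cut N D) ^ m) u u
      = (\<Sum>ws\<in>?Ls. \<Prod>i\<le>Suc (2 * k). ent (B D i) ((u # ws @ [u]) ! i) ((u # ws @ [u]) ! Suc i))" for D u
    using chain_alternating[of "B D" "cut N D" 0 k] ent_chain[of N "B D" 0 "Suc (2 * k)" u u, OF cB]
    by (simp add: B_def k)
  have eq: "(\<Prod>i\<le>Suc (2 * k). ent (B (\<lambda>r c. \<gamma> r c * A r c) i) ((u # ws @ [u]) ! i) ((u # ws @ [u]) ! Suc i))
      = (\<Prod>i\<le>Suc (2 * k). ent (B A i) ((u # ws @ [u]) ! i) ((u # ws @ [u]) ! Suc i))"
    (is "?lhs = ?rhs")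
    if u: "u < N" and ws: "ws \<in> ?Ls" for u ws
  proof -
    \<comment> \<open>The cyclic list of vertices becomes a periodic sequence, which agrees with
      \<open>u # ws @ [u]\<close> up to position \<open>2 m\<close> inclusive.\<close>
    define f where "f i = (u # ws) ! (i mod (2 * m))" for i
    have len: "length (u # ws) = 2 * m" using ws by (simp add: k)
    have f: "(u # ws @ [u]) ! i = f i" if "i \<le> 2 * m" for i
      using that len by (cases "i = 2 * m") (auto simp: f_def nth_append nth_Cons split: nat.splits)
    have fN: "f i < N" for i
    proof -
      have "f i \<in> set (u # ws)" unfolding f_def using len k by (intro nth_mem) simp
      then show ?thesis using u ws by auto
    qed
    have per: "f (i + 2 * m) = f i" for i by (simp add: f_def)
    have wper: "walk_edge f (i + 2 * m) = walk_edge f i" for i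
      using per[of i] per[of "Suc i"] by (simp add: walk_edge_def)
    let ?e = "\<lambda>D i. if even i then cnj (D (fst (walk_edge f i)) (snd (walk_edge f i)))
        else D (fst (walk_edge f i)) (snd (walk_edge f i))"
    have set: "{..Suc (2 * k)} = {..<2 * m}" by (auto simp: k)
    have entB: "(\<Prod>i\<le>Suc (2 * k). ent (B D i) ((u # ws @ [u]) ! i) ((u # ws @ [u]) ! Suc i))
        = (\<Prod>i<2 * m. ?e D i)" for D
      unfolding set
    proof (intro prod.cong refl)
      fix i assume "i \<in> {..<2 * m}"
      then have "(u # ws @ [u]) ! i = f i" "(u # ws @ [u]) ! Suc i = f (Suc i)"
        using f[of i] f[of "Suc i"] by auto
      then show "ent (B D i) ((u # ws @ [u]) ! i) ((u # ws @ [u]) ! Suc i) = ?e D i"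
        using fN by (simp only:) (simp add: B_def star.rep_eq cut.rep_eq walk_edge_def)
    qed
    show ?thesis
    proof (cases "\<forall>i<2 * m. A (fst (walk_edge f i)) (snd (walk_edge f i)) \<noteq> 0")
      case True
      have nz: "A (fst (walk_edge f i)) (snd (walk_edge f i)) \<noteq> 0" for i
      proof -
        have "walk_edge f i = walk_edge f (i mod (2 * m))"
        proof (induction i rule: less_induct)
          case (less i)
          show ?case
          proof (cases "i < 2 * m")
            case False
            then have "walk_edge f i = walk_edge f (i - 2 * m)" using wper[of "i - 2 * m"] by simp
            also have "\<dots> = walk_edge f ((i - 2 * m) mod (2 * m))" using False m by (intro less) auto
            finally show ?thesis using False by (simp add: le_mod_geq)
          qed simp
        qed
        then show ?thesis using True m by simp
      qed
      have "(\<Prod>i<2 * m. ?e (\<lambda>r c. \<gamma> r c * A r c) i) = (\<Prod>i<2 * m. ?e \<gamma> i) * (\<Prod>i<2 * m. ?e A i)"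
        unfolding prod.distrib[symmetric] by (intro prod.cong) auto
      also have "(\<Prod>i<2 * m. ?e \<gamma> i) = 1" using per nz by (rule g)
      finally show ?thesis unfolding entB by simp
    next
      case False
      then obtain i where i: "i < 2 * m" "A (fst (walk_edge f i)) (snd (walk_edge f i)) = 0" by blast
      then have "(\<Prod>i<2 * m. ?e (\<lambda>r c. \<gamma> r c * A r c) i) = 0" "(\<Prod>i<2 * m. ?e A i) = 0"
        by (auto intro!: prod_zero bexI[of _ i])
      then show ?thesis unfolding entB by (simp only:)
    qed
  qed
  show ?thesis
    unfolding gtrace_def trn_def ex by (intro arg_cong[where f = Re] sum.cong refl eq) auto
qed

lemma gtrace_near_far:
  assumes m: "m \<ge> 1"
    and far: "separated m I n n'"
    and A: "\<And>r c. A r c \<noteq> 0 \<Longrightarrow> (r, c) \<in> I \<and> (r < n \<and> c < n \<or> \<not> (r < n' \<and> c < n'))"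
    and \<mu>: "cmod \<mu> = 1"
  shows "gtrace m N (cut N (\<lambda>r c. (if r < n \<and> c < n then 1 else \<mu>) * A r c)) = gtrace m N (cut N A)"
proof (rule gtrace_gauge[OF m])
  fix f :: "nat \<Rightarrow> nat"
  assume per: "\<And>i. f (i + 2 * m) = f i"
    and nz: "\<And>i. A (fst (walk_edge f i)) (snd (walk_edge f i)) \<noteq> 0"
  have "(\<Prod>i<2 * m. if walk_edge f i \<in> {..<n} \<times> {..<n} then 1 else if even i then cnj \<mu> else \<mu>) = 1"
  proof (rule closed_walk_weight[where f = f and n = n and n' = n' and I = I and m = m])
    show "walk_edge f i \<in> I" for i using A[OF nz[of i]] by simp
    show "walk_edge f i \<in> {..<n} \<times> {..<n} \<or> walk_edge f i \<notin> {..<n'} \<times> {..<n'}" for i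
      using A[OF nz[of i]] by (auto simp: mem_Times_iff)
  qed (rule far per \<mu>)+
  then show "(\<Prod>i<2 * m. if even i then cnj (if fst (walk_edge f i) < n \<and> snd (walk_edge f i) < n then 1 else \<mu>)
        else (if fst (walk_edge f i) < n \<and> snd (walk_edge f i) < n then 1 else \<mu>)) = 1"
    by (simp add: mem_Times_iff if_distrib[of cnj] cong: if_cong)
      (smt (verit, best) prod.cong)
qed


section \<open>Operators and their matrices\<close>

lemmas coord_simps = plus_ell2.rep_eq minus_ell2.rep_eq uminus_ell2.rep_eq zero_ell2.rep_eq
  scaleC_ell2.rep_eq scaleR_ell2.rep_eq basis_vec.rep_eq

lemma ell2_eqI: "(\<And>i. coord x i = coord y i) \<Longrightarrow> x = y"
  by (simp add: coord_inject[symmetric] fun_eq_iff)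

lemma summable_coord: "summable (\<lambda>i. (cmod (coord x i))\<^sup>2)"
  using coord[of x] by simp

lemma summable_cinner: "summable (\<lambda>i. coord x i * cnj (coord y i))"
  by (rule summable_ell2_mult[OF summable_coord summable_coord])

lemma cinner_add_left: "cinner (x + y) z = cinner x z + cinner y z"
  by (simp add: cinner.rep_eq coord_simps distrib_right suminf_add[OF summable_cinner summable_cinner])

lemma cinner_add_right: "cinner z (x + y) = cinner z x + cinner z y"
  by (simp add: cinner.rep_eq coord_simps distrib_left suminf_add[OF summable_cinner summable_cinner])

lemma cinner_scaleC_left: "cinner (c *\<^sub>C x) y = c * cinner x y"
  by (simp add: cinner.rep_eq coord_simps mult.assoc suminf_mult[OF summable_cinner])

lemma cinner_scaleC_right: "cinner x (c *\<^sub>C y) = cnj c * cinner x y"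
  using suminf_mult[OF summable_cinner, of "cnj c" x y]
  by (simp add: cinner.rep_eq coord_simps mult_ac)

lemma cinner_commute: "cinner y x = cnj (cinner x y)"
  using bounded_linear.suminf[OF bounded_linear_cnj summable_cinner, of x y]
  by (simp add: cinner.rep_eq mult.commute)

lemma cinner_basis_right: "cinner x (basis_vec c) = coord x c"
proof -
  have "cinner x (basis_vec c) = (\<Sum>i\<in>{c}. coord x i * cnj (coord (basis_vec c) i))"
    unfolding cinner.rep_eq by (rule suminf_finite) (auto simp: coord_simps)
  then show ?thesis by (simp add: coord_simps)
qed

lemma cinner_diff_left: "cinner (x - y) z = cinner x z - cinner y z"
  using cinner_add_left[of "x - y" y z] by simp

lemma norm_ell2_power2: "(norm x)\<^sup>2 = (\<Sum>i. (cmod (coord x i))\<^sup>2)"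
  by (simp add: norm_ell2_def suminf_nonneg summable_coord)

text \<open>A unimodular factor \<open>u\<close> on \<open>x\<close> makes the inner product real
  and nonnegative, which reduces the claim to the real Cauchy-Schwarz inequality.\<close>

lemma cmod_cinner_le: "cmod (cinner x y) \<le> norm x * norm y"
proof (cases "cinner x y = 0")
  case False
  define z where "z = cinner x y"
  define u where "u = cnj z / of_real (cmod z)"
  have z: "z \<noteq> 0" using False by (simp add: z_def)
  then have "cmod u = 1" by (simp add: u_def norm_divide)
  have "u * z = of_real ((cmod z)\<^sup>2) / of_real (cmod z)"
    unfolding complex_norm_square by (simp add: u_def)
  also have "\<dots> = of_real (cmod z)" using z by (simp add: power2_eq_square)
  finally have "u * cinner x y = of_real (cmod (cinner x y))" by (simp add: z_def)
  then have "cmod (cinner x y) = inner (u *\<^sub>C x) y"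
    by (simp add: inner_ell2_def cinner_scaleC_left)
  also have "\<dots> \<le> norm (u *\<^sub>C x) * norm y" by (rule norm_cauchy_schwarz)
  finally show ?thesis using \<open>cmod u = 1\<close> by (simp add: norm_scaleC)
qed simp

lemma norm_basis_vec [simp]: "norm (basis_vec c) = 1"
proof -
  have "(\<Sum>i. (cmod (coord (basis_vec c) i))\<^sup>2) = (\<Sum>i\<in>{c}. (cmod (coord (basis_vec c) i))\<^sup>2)"
    by (rule suminf_finite) (auto simp: coord_simps)
  then show ?thesis by (simp add: norm_ell2_def coord_simps)
qed

lemma cmod_coord_le: "cmod (coord x i) \<le> norm x"
  using cmod_cinner_le[of x "basis_vec i"] by (simp add: cinner_basis_right)

lemma bounded_linear_coord: "bounded_linear (\<lambda>x. coord x i)"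
  by (rule bounded_linear_intro[of _ 1])
    (simp_all add: coord_simps scaleR_conv_of_real cmod_coord_le)

section \<open>Truncation of vectors\<close>

lift_definition head :: "nat \<Rightarrow> ell2 \<Rightarrow> ell2" is "\<lambda>n v i. if i < n then v i else 0"
  by (rule summable_finite[of "{..<_}"]) (auto split: if_splits)

lemma norm_head: "norm (v - head n v) ^ 2 = norm v ^ 2 - (\<Sum>i<n. (cmod (coord v i))\<^sup>2)"
proof -
  have s: "summable (\<lambda>i. if i < n then (cmod (coord v i))\<^sup>2 else 0)"
    by (rule summable_finite[of "{..<n}"]) auto
  have "norm (v - head n v) ^ 2 = (\<Sum>i. (cmod (coord v i))\<^sup>2 - (if i < n then (cmod (coord v i))\<^sup>2 else 0))"
    unfolding norm_ell2_power2 by (intro suminf_cong) (simp add: coord_simps head.rep_eq)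
  also have "\<dots> = norm v ^ 2 - (\<Sum>i. if i < n then (cmod (coord v i))\<^sup>2 else 0)"
    unfolding norm_ell2_power2 by (rule suminf_diff[symmetric, OF summable_coord s])
  also have "(\<Sum>i. if i < n then (cmod (coord v i))\<^sup>2 else 0) = (\<Sum>i<n. (cmod (coord v i))\<^sup>2)"
    by (subst suminf_finite[of "{..<n}"]) auto
  finally show ?thesis .
qed

lemma norm_head_le: "norm (head n v) \<le> norm v"
proof -
  have "(norm (head n v))\<^sup>2 \<le> (norm v)\<^sup>2"
    unfolding norm_ell2_power2 by (intro suminf_le summable_coord) (simp add: head.rep_eq)
  then show ?thesis by (simp add: power2_le_iff_abs_le)
qed

lemma head_tendsto: "(\<lambda>n. head n v) \<longlonglongrightarrow> v"
proof -
  have "(\<lambda>n. \<Sum>i<n. (cmod (coord v i))\<^sup>2) \<longlonglongrightarrow> norm v ^ 2"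
    unfolding norm_ell2_power2 by (rule summable_LIMSEQ[OF summable_coord])
  then have "(\<lambda>n. norm (v - head n v) ^ 2) \<longlonglongrightarrow> norm v ^ 2 - norm v ^ 2"
    unfolding norm_head by (intro tendsto_intros)
  then have "(\<lambda>n. sqrt (norm (v - head n v) ^ 2)) \<longlonglongrightarrow> sqrt 0"
    by (intro tendsto_real_sqrt) simp
  then have "(\<lambda>n. norm (v - head n v)) \<longlonglongrightarrow> 0" by simp
  then have "(\<lambda>n. norm (head n v - v)) \<longlonglongrightarrow> 0" by (simp add: norm_minus_commute)
  then show ?thesis by (subst (asm) tendsto_norm_zero_iff) (rule LIM_zero_cancel)
qed

lemma head_diff: "head n (v - w) = head n v - head n w"
  by (rule ell2_eqI) (simp add: coord_simps head.rep_eq)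

text \<open>The maps \<open>head n\<close> are contractions, so they may be applied along a
  convergent sequence of arguments.\<close>

lemma head_tendsto2:
  assumes "f \<longlonglongrightarrow> v" shows "(\<lambda>n. head n (f n)) \<longlonglongrightarrow> v"
proof -
  have "(\<lambda>n. head n (f n - v)) \<longlonglongrightarrow> 0"
  proof (rule Lim_null_comparison)
    show "\<forall>\<^sub>F n in sequentially. norm (head n (f n - v)) \<le> norm (f n - v)"
      by (simp add: norm_head_le)
    show "(\<lambda>n. norm (f n - v)) \<longlonglongrightarrow> 0"
      using assms by (simp add: LIM_zero tendsto_norm_zero)
  qed
  then have "(\<lambda>n. head n (f n - v) + head n v) \<longlonglongrightarrow> 0 + v"
    by (intro tendsto_add head_tendsto)
  then show ?thesis by (simp add: head_diff)
qed

lemma coord_sum: "coord (\<Sum>i\<in>S. f i) j = (\<Sum>i\<in>S. coord (f i) j)"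
  by (induction S rule: infinite_finite_induct) (simp_all add: coord_simps)

lemma head_eq_sum: "head n v = (\<Sum>c<n. coord v c *\<^sub>C basis_vec c)"
  by (rule ell2_eqI) (simp add: head.rep_eq coord_sum coord_simps if_distrib[of "(*) _"] sum.delta' cong: if_cong)

lemma clinear_op_sum:
  assumes "clinear_op x"
  shows "blinfun_apply x (\<Sum>i\<in>S. f i *\<^sub>C g i) = (\<Sum>i\<in>S. f i *\<^sub>C blinfun_apply x (g i))"
  using assms by (simp add: blinfun.sum_right clinear_op_def)

lemma coord_apply_head:
  assumes "clinear_op x"
  shows "coord (blinfun_apply x (head n v)) r = (\<Sum>c<n. matrix_coeff x r c * coord v c)"
  by (simp add: head_eq_sum clinear_op_sum[OF assms] coord_sum coord_simps matrix_coeff_def mult.commute)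

text \<open>The vectors \<open>head n v\<close> are finite combinations of basis vectors and
  converge to \<open>v\<close>, so the matrix determines a bounded complex linear map.\<close>

lemma clinear_op_eqI:
  assumes "clinear_op x" "clinear_op y" "\<And>r c. matrix_coeff x r c = matrix_coeff y r c"
  shows "x = y"
proof (rule blinfun_eqI)
  fix v
  have eq: "blinfun_apply x (head n v) = blinfun_apply y (head n v)" for n
    by (rule ell2_eqI) (simp add: coord_apply_head assms)
  have "(\<lambda>n. blinfun_apply x (head n v)) \<longlonglongrightarrow> blinfun_apply x v"
    "(\<lambda>n. blinfun_apply y (head n v)) \<longlonglongrightarrow> blinfun_apply y v"
    by (intro tendsto_intros head_tendsto)+
  then show "blinfun_apply x v = blinfun_apply y v"
    unfolding eq using LIMSEQ_unique by blast
qed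

section \<open>Existence of the adjoint\<close>

lemma cinner_sum_right: "cinner v (\<Sum>i\<in>S. f i) = (\<Sum>i\<in>S. cinner v (f i))"
  by (induction S rule: infinite_finite_induct)
    (simp_all add: cinner_add_right, simp_all add: cinner.rep_eq coord_simps)

lemma norm_sum_basis: "(norm (\<Sum>c<n. a c *\<^sub>C basis_vec c))\<^sup>2 = (\<Sum>c<n. (cmod (a c))\<^sup>2)"
proof -
  have "coord (\<Sum>c<n. a c *\<^sub>C basis_vec c) i = (if i < n then a i else 0)" for i
    by (simp add: coord_sum coord_simps if_distrib[of "(*) _"] sum.delta' cong: if_cong)
  then have "(norm (\<Sum>c<n. a c *\<^sub>C basis_vec c))\<^sup>2 = (\<Sum>i\<in>{..<n}. (cmod (if i < n then a i else 0))\<^sup>2)"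
    unfolding norm_ell2_power2 by (subst suminf_finite[of "{..<n}"]) auto
  then show ?thesis by simp
qed

text \<open>Testing \<open>x\<close> on the vector \<open>w\<close> with coordinates
  \<open>a c\<close> produces the sum of squares \<open>s\<close> itself as an inner product, which
  is at most \<open>norm v * norm x * sqrt s\<close>. Hence these coordinates define a vector of
  \<open>ell2\<close>.\<close>

lemma adjoint_coords_bound:
  assumes x: "clinear_op x"
  shows "(\<Sum>c<n. (cmod (cinner v (blinfun_apply x (basis_vec c))))\<^sup>2) \<le> (norm v * norm x)\<^sup>2"
proof -
  define a where "a c = cinner v (blinfun_apply x (basis_vec c))" for c
  define s where "s = (\<Sum>c<n. (cmod (a c))\<^sup>2)"
  define w where "w = (\<Sum>c<n. a c *\<^sub>C basis_vec c)"
  have s0: "s \<ge> 0" by (simp add: s_def sum_nonneg)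
  have "cinner v (blinfun_apply x w) = (\<Sum>c<n. cnj (a c) * a c)"
    by (simp add: w_def clinear_op_sum[OF x] cinner_sum_right cinner_scaleC_right a_def)
  also have "\<dots> = of_real s"
    by (simp add: s_def complex_norm_square[symmetric] mult.commute[of "cnj _"] del: of_real_power)
  finally have "s = cmod (cinner v (blinfun_apply x w))" using s0 by simp
  also have "\<dots> \<le> norm v * (norm x * norm w)"
    by (rule order_trans[OF cmod_cinner_le]) (intro mult_left_mono norm_blinfun norm_ge_zero)
  also have "norm w = sqrt s"
    using norm_sum_basis[of a n] by (simp add: w_def s_def real_sqrt_unique)
  finally have le: "sqrt s * sqrt s \<le> (norm v * norm x) * sqrt s" using s0 by (simp add: mult.assoc)
  have "sqrt s \<le> norm v * norm x"
  proof (cases "s = 0")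
    case False
    then have "sqrt s > 0" using s0 by simp
    with le show ?thesis by (rule mult_right_le_imp_le)
  qed simp
  then have "(sqrt s)\<^sup>2 \<le> (norm v * norm x)\<^sup>2" by (intro power_mono) (simp_all add: s0)
  then show ?thesis using s0 by (simp add: s_def a_def)
qed

text \<open>Needed because \<open>adj_op\<close> is a definite description. The adjoint is given by
  its coordinates; its identity holds for \<open>head n u\<close> and passes to the limit.\<close>

lemma adjoint_exists:
  assumes x: "clinear_op x"
  shows "\<exists>y. clinear_op y \<and> (\<forall>u v. cinner (blinfun_apply x u) v = cinner u (blinfun_apply y v))"
proof -
  define a where "a v c = cinner v (blinfun_apply x (basis_vec c))" for v c
  have summ: "summable (\<lambda>c. (cmod (a v c))\<^sup>2)" for v
    unfolding a_def by (rule bounded_imp_summable[of _ "(norm v * norm x)\<^sup>2"])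
      (use adjoint_coords_bound[OF x, of v "Suc _"] in \<open>simp_all add: lessThan_Suc_atMost\<close>)
  define f where "f v = Abs_ell2 (a v)" for v
  have coord_f: "coord (f v) = a v" for v
    by (simp add: f_def Abs_ell2_inverse summ)
  have fC: "f (z *\<^sub>C v) = z *\<^sub>C f v" for z v
    by (rule ell2_eqI) (simp add: coord_f coord_simps a_def cinner_scaleC_left)
  have bl: "bounded_linear f"
  proof (rule bounded_linear_intro)
    fix v w :: ell2 and r :: real
    show "f (v + w) = f v + f w"
      by (rule ell2_eqI) (simp add: coord_f coord_simps a_def cinner_add_left)
    show "f (r *\<^sub>R v) = r *\<^sub>R f v"
      by (simp add: scaleR_scaleC fC)
    have "(norm (f v))\<^sup>2 \<le> (norm v * norm x)\<^sup>2"
      unfolding norm_ell2_power2 coord_f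
      by (rule suminf_le_const[OF summ]) (simp add: a_def adjoint_coords_bound[OF x])
    then show "norm (f v) \<le> norm v * norm x"
      by (rule power2_le_imp_le) simp
  qed
  define y where "y = Blinfun f"
  have y: "blinfun_apply y = f" by (simp add: y_def bounded_linear_Blinfun_apply[OF bl])
  have head: "cinner (blinfun_apply x (head n u)) v = cinner (head n u) (f v)" for n u v
  proof -
    have "cinner (blinfun_apply x (head n u)) v = cnj (cinner v (blinfun_apply x (head n u)))"
      by (rule cinner_commute)
    also have "\<dots> = (\<Sum>c<n. coord u c * cnj (a v c))"
      by (simp add: head_eq_sum clinear_op_sum[OF x] cinner_sum_right cinner_scaleC_right a_def)
    also have "\<dots> = (\<Sum>c<n. cnj (cnj (coord u c) * coord (f v) c))"
      by (simp add: coord_f)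
    also have "\<dots> = cnj (cinner (f v) (head n u))"
      by (simp add: head_eq_sum cinner_sum_right cinner_scaleC_right cinner_basis_right)
    also have "\<dots> = cinner (head n u) (f v)"
      by (rule cinner_commute[symmetric])
    finally show ?thesis .
  qed
  have cont: "(\<lambda>n. cinner (g n) w) \<longlonglongrightarrow> cinner l w" if "g \<longlonglongrightarrow> l" for g l w
  proof -
    have "(\<lambda>n. cinner (g n - l) w) \<longlonglongrightarrow> 0"
    proof (rule Lim_null_comparison)
      show "\<forall>\<^sub>F n in sequentially. norm (cinner (g n - l) w) \<le> norm (g n - l) * norm w"
        by (simp add: cmod_cinner_le)
      show "(\<lambda>n. norm (g n - l) * norm w) \<longlonglongrightarrow> 0"
        using that by (intro tendsto_mult_left_zero) (simp add: LIM_zero tendsto_norm_zero)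
    qed
    then show ?thesis by (simp add: cinner_diff_left LIM_zero_cancel)
  qed
  have "cinner (blinfun_apply x u) v = cinner u (f v)" for u v
  proof (rule LIMSEQ_unique)
    show "(\<lambda>n. cinner (blinfun_apply x (head n u)) v) \<longlonglongrightarrow> cinner (blinfun_apply x u) v"
      by (intro cont tendsto_intros head_tendsto)
    show "(\<lambda>n. cinner (blinfun_apply x (head n u)) v) \<longlonglongrightarrow> cinner u (f v)"
      unfolding head by (intro cont head_tendsto)
  qed
  then show ?thesis by (intro exI[of _ y]) (simp add: y clinear_op_def fC)
qed

lemma adj_op:
  assumes x: "clinear_op x"
  shows clinear_adj_op: "clinear_op (adj_op x)"
    and cinner_adj_op: "cinner (blinfun_apply x u) v = cinner u (blinfun_apply (adj_op x) v)"
proof -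
  obtain y where y: "clinear_op y" "\<And>u v. cinner (blinfun_apply x u) v = cinner u (blinfun_apply y v)"
    using adjoint_exists[OF x] by blast
  have "adj_op x = y"
    unfolding adj_op_def
  proof (rule the_equality)
    fix y' assume y': "\<forall>u v. cinner (blinfun_apply x u) v = cinner u (blinfun_apply y' v)"
    show "y' = y"
    proof (intro blinfun_eqI ell2_eqI)
      fix v i
      have "cinner (basis_vec i) (blinfun_apply y' v) = cinner (basis_vec i) (blinfun_apply y v)"
        using y(2) y' by metis
      then have "cnj (cinner (basis_vec i) (blinfun_apply y' v)) = cnj (cinner (basis_vec i) (blinfun_apply y v))"
        by simp
      then show "coord (blinfun_apply y' v) i = coord (blinfun_apply y v) i"
        by (simp only: cinner_commute[symmetric] cinner_basis_right)
    qed
  qed (use y in blast)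
  then show "clinear_op (adj_op x)" "cinner (blinfun_apply x u) v = cinner u (blinfun_apply (adj_op x) v)"
    using y by auto
qed

lemma matrix_coeff_adj_op:
  assumes "clinear_op x" shows "matrix_coeff (adj_op x) c r = cnj (matrix_coeff x r c)"
proof -
  have "coord (blinfun_apply (adj_op x) (basis_vec r)) c
      = cnj (cinner (basis_vec c) (blinfun_apply (adj_op x) (basis_vec r)))"
    by (simp only: cinner_commute[of "basis_vec c"] cinner_basis_right complex_cnj_cnj)
  also have "\<dots> = cnj (cinner (blinfun_apply x (basis_vec c)) (basis_vec r))"
    by (simp only: cinner_adj_op[OF assms])
  finally show ?thesis by (simp add: matrix_coeff_def cinner_basis_right)
qed

section \<open>The Schatten trace as a limit over finite corners\<close>

definition compressed :: "(ell2 \<Rightarrow>\<^sub>L ell2) \<Rightarrow> nat \<Rightarrow> ell2 \<Rightarrow> ell2"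
  where "compressed x M v =
    head M (blinfun_apply (adj_op x) (head M (head M (blinfun_apply x (head M v)))))"

abbreviation gram :: "nat \<Rightarrow> (ell2 \<Rightarrow>\<^sub>L ell2) \<Rightarrow> rcm"
  where "gram M x \<equiv> star (cut M (matrix_coeff x)) * cut M (matrix_coeff x)"

text \<open>The doubled \<open>head M\<close> in \<open>compressed\<close> reads it as the product
  of the compressions of the adjoint and of \<open>x\<close>, so its matrix is
  \<open>gram M x\<close>. This ties operator powers to powers of finite matrices.\<close>

lemma coord_compressed:
  assumes x: "clinear_op x"
  shows "coord (compressed x M v) d
    = (\<Sum>j<M. ent (gram M x) d j * coord v j)"
proof -
  let ?C = "cut M (matrix_coeff x)"
  have e: "ent (star ?C * ?C) d j = (\<Sum>r<M. ent (star ?C) d r * ent ?C r j)" for j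
    by (rule ent_mult_less) (simp add: cut.rep_eq)
  have "coord (compressed x M v) d
    = (if d < M then \<Sum>r<M. cnj (matrix_coeff x r d) * (\<Sum>c<M. matrix_coeff x r c * coord v c) else 0)"
    by (simp add: compressed_def head.rep_eq[of M "blinfun_apply (adj_op x) _"] coord_apply_head[OF clinear_adj_op[OF x]]
        matrix_coeff_adj_op[OF x])
      (simp add: head.rep_eq coord_apply_head[OF x])
  also have "\<dots> = (\<Sum>r<M. ent (star ?C) d r * (\<Sum>c<M. ent ?C r c * coord v c))"
    by (simp add: star.rep_eq cut.rep_eq)
  also have "\<dots> = (\<Sum>c<M. ent (star ?C * ?C) d c * coord v c)"
    unfolding e sum_distrib_left sum_distrib_right mult.assoc by (rule sum.swap)
  finally show ?thesis .
qed

lemma coord_compressed_power: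
  assumes x: "clinear_op x" and "c < M"
  shows "coord ((compressed x M ^^ k) (basis_vec c)) d
    = ent (gram M x ^ k) d c"
proof (induction k arbitrary: d)
  case 0 then show ?case by (simp add: coord_simps one_rcm.rep_eq)
next
  case (Suc k)
  let ?B = "gram M x"
  have "ent (?B * ?B ^ k) d c = (\<Sum>j<M. ent ?B d j * ent (?B ^ k) j c)"
    by (rule ent_mult_less) (simp add: cornerD[OF corner_mult[OF corner_star[OF corner_cut] corner_cut]])
  then show ?case by (simp add: coord_compressed[OF x] Suc)
qed

lemma compressed_tendsto:
  assumes "f \<longlonglongrightarrow> v"
  shows "(\<lambda>M. compressed x M (f M)) \<longlonglongrightarrow> blinfun_apply (adj_op x o\<^sub>L x) v"
  unfolding compressed_def blinfun_apply_blinfun_compose o_def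
  by (intro head_tendsto2 tendsto_intros assms)

text \<open>As \<open>compressed_tendsto\<close> allows the argument to vary with \<open>M\<close>,
  strong convergence survives every fixed power.\<close>

lemma compressed_power_tendsto:
  "(\<lambda>M. (compressed x M ^^ k) v) \<longlonglongrightarrow> (blinfun_apply (adj_op x o\<^sub>L x) ^^ k) v"
proof (induction k)
  case (Suc k)
  then show ?case using compressed_tendsto[OF Suc] by simp
qed simp

definition diag_entry :: "nat \<Rightarrow> (ell2 \<Rightarrow>\<^sub>L ell2) \<Rightarrow> nat \<Rightarrow> real"
  where "diag_entry m x c = Re (coord ((blinfun_apply (adj_op x o\<^sub>L x) ^^ m) (basis_vec c)) c)"

context
  fixes m :: nat
  assumes m: "m \<ge> 1"
begin

lemma diag_entry_limit:
  assumes x: "clinear_op x"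
  shows "(\<lambda>M. Re (ent (gram M x ^ m) c c)) \<longlonglongrightarrow> diag_entry m x c"
proof (rule Lim_transform_eventually)
  show "(\<lambda>M. Re (coord ((compressed x M ^^ m) (basis_vec c)) c)) \<longlonglongrightarrow> diag_entry m x c"
    unfolding diag_entry_def
    by (intro tendsto_Re bounded_linear.tendsto[OF bounded_linear_coord] compressed_power_tendsto)
  show "\<forall>\<^sub>F M in sequentially. Re (coord ((compressed x M ^^ m) (basis_vec c)) c)
      = Re (ent (gram M x ^ m) c c)"
    using eventually_gt_at_top[of c] by eventually_elim (simp add: coord_compressed_power[OF x])
qed

text \<open>Pinching to the single index \<open>c\<close>.\<close>

lemma gram_diag_nonneg: "c < M \<Longrightarrow> 0 \<le> Re (ent (gram M x ^ m) c c)"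
  using gtrace_nonneg[OF corner_mult_proj[OF corner_cut] m, of M "matrix_coeff x" "{c}"]
    trace_pinching[OF corner_cut, of "{c}" M m "matrix_coeff x"] m by simp

lemma diag_entry_nonneg:
  assumes x: "clinear_op x" shows "0 \<le> diag_entry m x c"
  by (rule LIMSEQ_le_const[OF diag_entry_limit[OF x]]) (use gram_diag_nonneg Suc_le_eq in blast)

text \<open>Pinching in a larger corner \<open>M\<close> bounds the truncated norm by the first
  \<open>n\<close> diagonal entries, and \<open>M\<close> tends to infinity with \<open>n\<close>
  fixed. With \<open>sum_diag_le_mnorm\<close> the trace of the operator power becomes the
  \<open>2 m\<close>-th power of \<open>mnorm\<close>.\<close>

lemma tnorm_le_sum_diag:
  assumes x: "clinear_op x"
  shows "tnorm m n (matrix_coeff x) ^ (2 * m) \<le> (\<Sum>c<n. diag_entry m x c)"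
proof (rule LIMSEQ_le_const)
  show "(\<lambda>M. \<Sum>c<n. Re (ent (gram M x ^ m) c c))
      \<longlonglongrightarrow> (\<Sum>c<n. diag_entry m x c)"
    by (intro tendsto_sum diag_entry_limit x)
  have "tnorm m n (matrix_coeff x) ^ (2 * m)
      \<le> (\<Sum>c<n. Re (ent (gram M x ^ m) c c))" if "M \<ge> n" for M
  proof -
    let ?A = "matrix_coeff x"
    have "tnorm m n ?A = tnorm m n (row_restr {..<n} (col_restr {..<n} ?A))"
      unfolding tnorm_def by (subst cut_cong[of n ?A "row_restr {..<n} (col_restr {..<n} ?A)"])
        (auto simp: row_restr_def col_restr_def)
    also have "\<dots> \<le> tnorm m M (row_restr {..<n} (col_restr {..<n} ?A))"
      by (rule tnorm_mono[OF m that])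
    also have "\<dots> \<le> tnorm m M (col_restr {..<n} ?A)"
      by (rule tnorm_row_restr_le[OF m])
    finally have "tnorm m n ?A ^ (2 * m) \<le> tnorm m M (col_restr {..<n} ?A) ^ (2 * m)"
      by (intro power_mono tnorm_nonneg[OF m])
    also have "\<dots> = gtrace m M (cut M ?A * proj {..<n})"
      by (simp add: tnorm_power[OF m] cut_col_restr)
    also have "\<dots> \<le> (\<Sum>c<n. Re (ent ((star (cut M ?A) * cut M ?A) ^ m) c c))"
      using that by (intro trace_pinching corner_cut m) auto
    finally show ?thesis .
  qed
  then show "\<exists>N. \<forall>M\<ge>N. tnorm m n (matrix_coeff x) ^ (2 * m)
      \<le> (\<Sum>c<n. Re (ent (gram M x ^ m) c c))"
    by blast
qed

lemma sum_diag_le_mnorm: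
  assumes x: "clinear_op x" and A: "matrix_coeff x \<in> sp_mats m"
  shows "(\<Sum>c<n. diag_entry m x c) \<le> mnorm m (matrix_coeff x) ^ (2 * m)"
proof (rule LIMSEQ_le_const2)
  show "(\<lambda>M. \<Sum>c<n. Re (ent (gram M x ^ m) c c))
      \<longlonglongrightarrow> (\<Sum>c<n. diag_entry m x c)"
    by (intro tendsto_sum diag_entry_limit x)
  have "(\<Sum>c<n. Re (ent (gram M x ^ m) c c))
      \<le> mnorm m (matrix_coeff x) ^ (2 * m)" if "M \<ge> n" for M
  proof -
    let ?f = "\<lambda>c. Re (ent (gram M x ^ m) c c)"
    have "(\<Sum>c<n. ?f c) \<le> (\<Sum>c<M. ?f c)"
      using that by (intro sum_mono2 gram_diag_nonneg) auto
    also have "\<dots> = tnorm m M (matrix_coeff x) ^ (2 * m)"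
      by (simp add: tnorm_power[OF m] gtrace_def trn_def)
    also have "\<dots> \<le> mnorm m (matrix_coeff x) ^ (2 * m)"
      by (intro power_mono tnorm_le_mnorm[OF m] A tnorm_nonneg[OF m])
    finally show ?thesis .
  qed
  then show "\<exists>N. \<forall>M\<ge>N. (\<Sum>c<n. Re (ent (gram M x ^ m) c c))
      \<le> mnorm m (matrix_coeff x) ^ (2 * m)"
    by blast
qed

lemma schatten_trace_eq:
  assumes "clinear_op x"
  shows "schatten_trace (2 * m) x = (\<Sum>c. ennreal (diag_entry m x c))"
  by (simp add: schatten_trace_def pos_trace_def diag_entry_def cinner_basis_right)

lemma schatten_trace_finite_iff:
  assumes x: "clinear_op x"
  shows "schatten_trace (2 * m) x < \<infinity> \<longleftrightarrow> matrix_coeff x \<in> sp_mats m"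
proof
  assume fin: "schatten_trace (2 * m) x < \<infinity>"
  define K where "K = enn2real (schatten_trace (2 * m) x)"
  have K: "schatten_trace (2 * m) x = ennreal K" using fin by (simp add: K_def)
  have "tnorm m n (matrix_coeff x) \<le> root (2 * m) K" for n
  proof -
    have "ennreal (\<Sum>c<n. diag_entry m x c) = (\<Sum>c<n. ennreal (diag_entry m x c))"
      by (simp add: sum_ennreal diag_entry_nonneg[OF x])
    also have "\<dots> \<le> schatten_trace (2 * m) x"
      unfolding schatten_trace_eq[OF x] by (rule sum_le_suminf) auto
    finally have "(\<Sum>c<n. diag_entry m x c) \<le> K"
      unfolding K by (simp add: K_def)
    then have "tnorm m n (matrix_coeff x) ^ (2 * m) \<le> K"
      using tnorm_le_sum_diag[OF x, of n] by linarith
    then have "root (2 * m) (tnorm m n (matrix_coeff x) ^ (2 * m)) \<le> root (2 * m) K"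
      using m by simp
    then show ?thesis using m tnorm_nonneg[OF m] by (simp add: real_root_power_cancel)
  qed
  then show "matrix_coeff x \<in> sp_mats m" by (rule sp_mats_I[OF m])
next
  assume A: "matrix_coeff x \<in> sp_mats m"
  have "schatten_trace (2 * m) x \<le> ennreal (mnorm m (matrix_coeff x) ^ (2 * m))"
    unfolding schatten_trace_eq[OF x] suminf_eq_SUP
    by (rule SUP_least) (simp add: sum_ennreal diag_entry_nonneg[OF x] ennreal_leI sum_diag_le_mnorm[OF x A])
  then show "schatten_trace (2 * m) x < \<infinity>"
    using ennreal_less_top order_le_less_trans by (metis infinity_ennreal_def)
qed

lemma schatten_norm_eq:
  assumes x: "clinear_op x" and A: "matrix_coeff x \<in> sp_mats m"
  shows "schatten_norm (2 * m) x = mnorm m (matrix_coeff x)"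
proof -
  let ?s = "mnorm m (matrix_coeff x)"
  have s0: "?s \<ge> 0" by (rule mnorm_nonneg[OF m A])
  have summ: "summable (diag_entry m x)"
  proof (rule bounded_imp_summable)
    show "sum (diag_entry m x) {..n} \<le> ?s ^ (2 * m)" for n
      using sum_diag_le_mnorm[OF x A, of "Suc n"] by (simp add: lessThan_Suc_atMost)
  qed (rule diag_entry_nonneg[OF x])
  have "schatten_trace (2 * m) x = ennreal (suminf (diag_entry m x))"
    unfolding schatten_trace_eq[OF x]
    by (rule suminf_ennreal2[OF diag_entry_nonneg[OF x] summ])
  then have "enn2real (schatten_trace (2 * m) x) = suminf (diag_entry m x)"
    by (simp add: suminf_nonneg[OF summ] diag_entry_nonneg[OF x])
  also have "\<dots> = ?s ^ (2 * m)"
  proof (rule antisym)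
    show "suminf (diag_entry m x) \<le> ?s ^ (2 * m)"
      by (rule suminf_le_const[OF summ sum_diag_le_mnorm[OF x A]])
    show "?s ^ (2 * m) \<le> suminf (diag_entry m x)"
    proof (rule LIMSEQ_le[OF tendsto_power[OF tnorm_tendsto_mnorm[OF m A]] summable_LIMSEQ[OF summ]])
      show "\<exists>N. \<forall>n\<ge>N. tnorm m n (matrix_coeff x) ^ (2 * m) \<le> sum (diag_entry m x) {..<n}"
        using tnorm_le_sum_diag[OF x] by blast
    qed
  qed
  finally show ?thesis
    using m s0 by (cases "?s = 0") (simp_all add: schatten_norm_def powr_powr flip: powr_realpow)
qed

end

section \<open>Finite matrices as operators\<close>

definition fin_op :: "nat \<Rightarrow> (nat \<Rightarrow> nat \<Rightarrow> complex) \<Rightarrow> ell2 \<Rightarrow>\<^sub>L ell2"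
  where "fin_op n A = Blinfun (\<lambda>v. \<Sum>r<n. (\<Sum>c<n. A r c * coord v c) *\<^sub>C basis_vec r)"

lemma fin_op_apply: "blinfun_apply (fin_op n A) v = (\<Sum>r<n. (\<Sum>c<n. A r c * coord v c) *\<^sub>C basis_vec r)"
proof -
  have "bounded_linear (\<lambda>v. \<Sum>r<n. (\<Sum>c<n. A r c * coord v c) *\<^sub>C basis_vec r)"
  proof (intro bounded_linear_sum)
    fix r
    show "bounded_linear (\<lambda>v. (\<Sum>c<n. A r c * coord v c) *\<^sub>C basis_vec r)"
    proof (rule bounded_linear_compose[where f = "\<lambda>z. z *\<^sub>C basis_vec r"])
      show "bounded_linear (\<lambda>z. z *\<^sub>C basis_vec r)"
        by (rule bounded_linear_intro[of _ 1])
          (simp_all add: scaleC_add_left scaleR_scaleC scaleC_scaleC norm_scaleC scaleR_conv_of_real)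
      show "bounded_linear (\<lambda>v. \<Sum>c<n. A r c * coord v c)"
        by (intro bounded_linear_sum bounded_linear_const_mult bounded_linear_coord)
    qed
  qed
  then show ?thesis by (simp add: fin_op_def bounded_linear_Blinfun_apply)
qed

lemma coord_fin_op: "coord (blinfun_apply (fin_op n A) v) r = (if r < n then \<Sum>c<n. A r c * coord v c else 0)"
  by (simp add: fin_op_apply coord_sum coord_simps if_distrib[of "(*) _"] sum.delta' cong: if_cong)

lemma clinear_fin_op: "clinear_op (fin_op n A)"
  unfolding clinear_op_def
  by (auto intro!: ell2_eqI simp: coord_fin_op coord_simps sum_distrib_left mult_ac)

lemma matrix_coeff_fin_op: "matrix_coeff (fin_op n A) = trunc n A"
  by (intro ext) (simp add: matrix_coeff_def coord_fin_op coord_simps trunc_def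
      if_distrib[of "(*) _"] sum.delta' cong: if_cong)

text \<open>The image of the unit ball lies in a finite sum of discs along basis vectors, which is
  compact by induction on their number.\<close>

lemma compact_fin_op: "compact_op (fin_op n A)"
proof -
  define K where "K = (\<Sum>r<n. \<Sum>c<n. cmod (A r c))"
  define S where "S k = {v. \<exists>a. (\<forall>r<k. cmod (a r) \<le> K) \<and> v = (\<Sum>r<k. a r *\<^sub>C basis_vec r)}" for k
  have cont: "continuous_on (cball 0 K) (\<lambda>z. z *\<^sub>C basis_vec r)" for r
    by (intro linear_continuous_on bounded_linear_intro[of _ 1])
      (simp_all add: scaleC_add_left scaleR_scaleC scaleC_scaleC norm_scaleC scaleR_conv_of_real)
  have "compact (S k)" for k
  proof (induction k)
    case 0 then show ?case by (simp add: S_def)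
  next
    case (Suc k)
    have "S (Suc k) = {x + y | x y. x \<in> S k \<and> y \<in> (\<lambda>z. z *\<^sub>C basis_vec k) ` cball 0 K}" (is "_ = ?R")
    proof
      show "S (Suc k) \<subseteq> ?R"
        unfolding S_def by (force simp: less_Suc_eq)
      show "?R \<subseteq> S (Suc k)"
      proof
        fix v assume "v \<in> ?R"
        then obtain a z where a: "\<forall>r<k. cmod (a r) \<le> K" "cmod z \<le> K"
          "v = (\<Sum>r<k. a r *\<^sub>C basis_vec r) + z *\<^sub>C basis_vec k"
          by (auto simp: S_def)
        have "(\<Sum>r<k. a r *\<^sub>C basis_vec r) = (\<Sum>r<k. (a(k := z)) r *\<^sub>C basis_vec r)"
          by (intro sum.cong) auto
        then show "v \<in> S (Suc k)"
          unfolding S_def using a by (intro CollectI exI[of _ "a(k := z)"]) (auto simp: less_Suc_eq)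
      qed
    qed
    then show ?case
      by (simp only: compact_sums[OF Suc compact_continuous_image[OF cont compact_cball]])
  qed
  moreover have "blinfun_apply (fin_op n A) ` cball 0 1 \<subseteq> S n"
  proof (clarsimp simp: S_def fin_op_apply)
    fix v :: ell2 assume v: "norm v \<le> 1"
    show "\<exists>a. (\<forall>r<n. cmod (a r) \<le> K) \<and>
        (\<Sum>r<n. (\<Sum>c<n. A r c * coord v c) *\<^sub>C basis_vec r) = (\<Sum>r<n. a r *\<^sub>C basis_vec r)"
    proof (intro exI[of _ "\<lambda>r. \<Sum>c<n. A r c * coord v c"] conjI allI impI refl)
      fix r assume r: "r < n"
      have "cmod (\<Sum>c<n. A r c * coord v c) \<le> (\<Sum>c<n. cmod (A r c))"
      proof (rule sum_norm_le)
        fix c show "norm (A r c * coord v c) \<le> cmod (A r c)"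
          using cmod_coord_le[of v c] v by (simp add: norm_mult mult_left_le)
      qed
      also have "\<dots> \<le> K"
        unfolding K_def using r by (intro member_le_sum) (auto simp: sum_nonneg)
      finally show "cmod (\<Sum>c<n. A r c * coord v c) \<le> K" .
    qed
  qed
  ultimately have "closure (blinfun_apply (fin_op n A) ` cball 0 1) \<subseteq> S n"
    by (intro closure_minimal compact_imp_closed)
  then show ?thesis
    unfolding compact_op_def using \<open>compact (S n)\<close>
    by (metis closed_closure closed_Int_compact inf.absorb_iff1 inf_commute compact_Int_closed)
qed


section \<open>Schur multipliers and the complex approximation property\<close>

lemma matrix_coeff_add: "matrix_coeff (x + y) r c = matrix_coeff x r c + matrix_coeff y r c"
  by (simp add: matrix_coeff_def blinfun.add_left coord_simps)

lemma matrix_coeff_diff: "matrix_coeff (x - y) r c = matrix_coeff x r c - matrix_coeff y r c"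
  by (simp add: matrix_coeff_def blinfun.diff_left coord_simps)

lemma matrix_coeff_scaleC: "matrix_coeff (z *\<^sub>C x) r c = z * matrix_coeff x r c"
  by (simp add: matrix_coeff_def scaleC_blinfun.rep_eq coord_simps)

lemma matrix_coeff_zero: "matrix_coeff 0 r c = 0"
  by (simp add: matrix_coeff_def coord_simps)

lemma matrix_coeff_sum: "matrix_coeff (\<Sum>i\<in>S. f i) r c = (\<Sum>i\<in>S. matrix_coeff (f i) r c)"
  by (induction S rule: infinite_finite_induct) (simp_all add: matrix_coeff_add matrix_coeff_zero)

lemma clinear_op_add: "clinear_op x \<Longrightarrow> clinear_op y \<Longrightarrow> clinear_op (x + y)"
  by (simp add: clinear_op_def blinfun.add_left scaleC_add_right)

lemma clinear_op_diff: "clinear_op x \<Longrightarrow> clinear_op y \<Longrightarrow> clinear_op (x - y)"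
  by (simp add: clinear_op_def blinfun.diff_left complex_vector.scale_right_diff_distrib)

lemma clinear_op_scaleC: "clinear_op x \<Longrightarrow> clinear_op (z *\<^sub>C x)"
  by (simp add: clinear_op_def scaleC_blinfun.rep_eq scaleC_scaleC mult.commute)

lemma clinear_op_zero: "clinear_op 0"
  by (simp add: clinear_op_def)

lemma clinear_op_sums: "(\<And>i. i \<in> S \<Longrightarrow> clinear_op (f i)) \<Longrightarrow> clinear_op (\<Sum>i\<in>S. f i)"
  by (induction S rule: infinite_finite_induct) (simp_all add: clinear_op_add clinear_op_zero)

definition unit_mat :: "nat \<Rightarrow> nat \<Rightarrow> nat \<Rightarrow> nat \<Rightarrow> complex"
  where "unit_mat r c = (\<lambda>r' c'. if r' = r \<and> c' = c then 1 else 0)"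

definition unit_op :: "nat \<Rightarrow> nat \<Rightarrow> ell2 \<Rightarrow>\<^sub>L ell2"
  where "unit_op r c = fin_op (Suc (max r c)) (unit_mat r c)"

lemma clinear_unit_op: "clinear_op (unit_op r c)"
  by (simp add: unit_op_def clinear_fin_op)

lemma matrix_coeff_unit_op: "matrix_coeff (unit_op r c) = unit_mat r c"
  by (auto simp: unit_op_def matrix_coeff_fin_op trunc_def unit_mat_def fun_eq_iff)

lemma fin_op_eq_sum: "fin_op n A = (\<Sum>r<n. \<Sum>c<n. A r c *\<^sub>C unit_op r c)"
proof (rule clinear_op_eqI)
  fix r c
  have "(\<Sum>c'<n. A i c' * (if r = i \<and> c = c' then 1 else 0)) = (if r = i \<and> c < n then A r c else 0)" for i
    by (cases "r = i") (simp_all add: if_distrib[of "(*) _"] cong: if_cong)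
  then show "matrix_coeff (fin_op n A) r c = matrix_coeff (\<Sum>r<n. \<Sum>c<n. A r c *\<^sub>C unit_op r c) r c"
    by (cases "c < n") (simp_all add: matrix_coeff_fin_op trunc_def matrix_coeff_sum matrix_coeff_scaleC
        matrix_coeff_unit_op unit_mat_def)
qed (auto intro!: clinear_fin_op clinear_op_sums clinear_op_scaleC clinear_unit_op)

definition supported :: "(nat \<times> nat) set \<Rightarrow> (nat \<Rightarrow> nat \<Rightarrow> complex) \<Rightarrow> bool"
  where "supported I A \<longleftrightarrow> (\<forall>r c. (r, c) \<notin> I \<longrightarrow> A r c = 0)"

context
  fixes m :: nat
  assumes m: "m \<ge> 1"
begin

lemma schatten_subspaceD:
  assumes "x \<in> schatten_subspace (2 * m) I"
  shows "clinear_op x" "matrix_coeff x \<in> sp_mats m" "supported I (matrix_coeff x)"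
  using assms schatten_trace_finite_iff[OF m, of x]
  by (auto simp: schatten_subspace_def schatten_class_def supported_def)

lemma fin_op_mem:
  assumes "supported I (trunc n A)" shows "fin_op n A \<in> schatten_subspace (2 * m) I"
  using assms schatten_trace_finite_iff[OF m clinear_fin_op, of n A]
  by (simp add: schatten_subspace_def schatten_class_def supported_def clinear_fin_op compact_fin_op
      matrix_coeff_fin_op sp_mats_trunc[OF m])

lemma unit_op_mem: "(r, c) \<in> I \<Longrightarrow> unit_op r c \<in> schatten_subspace (2 * m) I"
  unfolding unit_op_def by (rule fin_op_mem) (auto simp: supported_def trunc_def unit_mat_def)

lemma sp_mats_zero: "(\<lambda>r c. 0) \<in> sp_mats m" and mnorm_zero: "mnorm m (\<lambda>r c. 0) = 0"
proof -
  show sp_mats: "(\<lambda>r c. 0) \<in> sp_mats m" using sp_mats_trunc[OF m, of 0 "\<lambda>r c. 0"] by (simp add: trunc_def)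
  show "mnorm m (\<lambda>r c. 0) = 0" using mnorm_scale[OF m sp_mats, of 0] by simp
qed

lemma sp_mats_sum: "finite S \<Longrightarrow> (\<And>i. i \<in> S \<Longrightarrow> B i \<in> sp_mats m) \<Longrightarrow>
    (\<lambda>r c. \<Sum>i\<in>S. B i r c) \<in> sp_mats m \<and> mnorm m (\<lambda>r c. \<Sum>i\<in>S. B i r c) \<le> (\<Sum>i\<in>S. mnorm m (B i))"
proof (induction S rule: finite_induct)
  case empty
  then show ?case by (simp add: sp_mats_zero mnorm_zero)
next
  case (insert i S)
  then have IH: "(\<lambda>r c. \<Sum>i\<in>S. B i r c) \<in> sp_mats m"
    "mnorm m (\<lambda>r c. \<Sum>i\<in>S. B i r c) \<le> (\<Sum>i\<in>S. mnorm m (B i))" and Bi: "B i \<in> sp_mats m" by auto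
  show ?case
    using sp_mats_add[OF m Bi IH(1)] mnorm_add[OF m Bi IH(1)] IH(2) insert.hyps by simp
qed

section \<open>Averages of nested squares\<close>

definition schur_bound :: "(nat \<times> nat) set \<Rightarrow> (nat \<Rightarrow> nat \<Rightarrow> complex) \<Rightarrow> real \<Rightarrow> bool"
  where "schur_bound I s K \<longleftrightarrow> (\<forall>A. A \<in> sp_mats m \<and> supported I A \<longrightarrow>
    (\<lambda>r c. s r c * A r c) \<in> sp_mats m \<and> mnorm m (\<lambda>r c. s r c * A r c) \<le> K * mnorm m A)"

lemma schur_boundD:
  assumes "schur_bound I s K" "A \<in> sp_mats m" "supported I A"
  shows "(\<lambda>r c. s r c * A r c) \<in> sp_mats m" "mnorm m (\<lambda>r c. s r c * A r c) \<le> K * mnorm m A"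
  using assms by (simp_all add: schur_bound_def)

lemma schur_bound_mult:
  assumes "schur_bound I s K" "schur_bound I t L" "0 \<le> K"
  shows "schur_bound I (\<lambda>r c. s r c * t r c) (K * L)"
  unfolding schur_bound_def
proof (intro allI impI)
  fix A assume A: "A \<in> sp_mats m \<and> supported I A"
  let ?B = "\<lambda>r c. t r c * A r c"
  have B: "?B \<in> sp_mats m" "mnorm m ?B \<le> L * mnorm m A" "supported I ?B"
    using A assms(2) by (auto simp: schur_bound_def supported_def)
  then have "(\<lambda>r c. s r c * ?B r c) \<in> sp_mats m" "mnorm m (\<lambda>r c. s r c * ?B r c) \<le> K * mnorm m ?B"
    using assms(1) by (auto simp: schur_bound_def)
  moreover have "K * mnorm m ?B \<le> K * (L * mnorm m A)"
    by (rule mult_left_mono[OF B(2) assms(3)])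
  ultimately show "(\<lambda>r c. s r c * t r c * A r c) \<in> sp_mats m \<and>
      mnorm m (\<lambda>r c. s r c * t r c * A r c) \<le> K * L * mnorm m A"
    by (simp add: mult.assoc)
qed

lemma schur_bound_const: "schur_bound I (\<lambda>r c. z) (cmod z)"
  by (simp add: schur_bound_def sp_mats_scale[OF m] mnorm_scale[OF m])

definition square :: "nat \<Rightarrow> nat \<Rightarrow> nat \<Rightarrow> complex"
  where "square n r c = (if r < n \<and> c < n then 1 else 0)"

lemma square_mult: "square n r c * A r c = trunc n A r c"
  by (simp add: square_def trunc_def)

lemma schur_bound_square: "schur_bound I (square n) 1"
  by (simp add: schur_bound_def square_mult sp_mats_trunc[OF m] mnorm_trunc[OF m] tnorm_le_mnorm[OF m])

text \<open>The annulus is cut into a block of rows and a block of columns, because superadditivity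
  is available for rows and for columns separately.\<close>

lemma square_diff_bound:
  assumes A: "A \<in> sp_mats m" and "k \<le> n"
  shows "(\<lambda>r c. (square n r c - square k r c) * A r c) \<in> sp_mats m"
    and "mnorm m (\<lambda>r c. (square n r c - square k r c) * A r c)
      \<le> mnorm m (row_restr {k..<n} A) + mnorm m (col_restr {k..<n} A)"
proof -
  let ?U = "row_restr {k..<n} (col_restr {..<n} A)" and ?V = "col_restr {k..<n} (row_restr {..<k} A)"
  have U: "?U \<in> sp_mats m" and V: "?V \<in> sp_mats m"
    by (simp_all add: sp_mats_row_restr[OF m] sp_mats_col_restr[OF m] A)
  have eq: "(\<lambda>r c. (square n r c - square k r c) * A r c) = (\<lambda>r c. ?U r c + ?V r c)"
    using \<open>k \<le> n\<close> by (auto simp: fun_eq_iff square_def row_restr_def col_restr_def)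
  show "(\<lambda>r c. (square n r c - square k r c) * A r c) \<in> sp_mats m"
    unfolding eq by (rule sp_mats_add[OF m U V])
  have "?U = col_restr {..<n} (row_restr {k..<n} A)" "?V = row_restr {..<k} (col_restr {k..<n} A)"
    by (auto simp: fun_eq_iff row_restr_def col_restr_def)
  then have "mnorm m ?U \<le> mnorm m (row_restr {k..<n} A)" "mnorm m ?V \<le> mnorm m (col_restr {k..<n} A)"
    by (simp_all add: mnorm_col_restr_le[OF m sp_mats_row_restr[OF m A]] mnorm_row_restr_le[OF m sp_mats_col_restr[OF m A]])
  then show "mnorm m (\<lambda>r c. (square n r c - square k r c) * A r c)
      \<le> mnorm m (row_restr {k..<n} A) + mnorm m (col_restr {k..<n} A)"
    unfolding eq using mnorm_add[OF m U V] by linarith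
qed

lemma sum_row_blocks:
  assumes A: "A \<in> sp_mats m" and \<nu>: "\<And>i. \<nu> i \<le> \<nu> (Suc i)"
  shows "(\<Sum>i<L. mnorm m (row_restr {\<nu> i..<\<nu> (Suc i)} A) ^ (2 * m)) \<le> mnorm m A ^ (2 * m)"
proof -
  have "(\<Sum>i<L. mnorm m (row_restr {\<nu> i..<\<nu> (Suc i)} A) ^ (2 * m)) \<le> mnorm m (row_restr {..<\<nu> L} A) ^ (2 * m)"
  proof (induction L)
    case 0 then show ?case by (simp add: mnorm_nonneg[OF m] sp_mats_row_restr[OF m A])
  next
    case (Suc L)
    let ?B = "row_restr {..<\<nu> (Suc L)} A"
    have "row_restr {..<\<nu> L} ?B = row_restr {..<\<nu> L} A" "row_restr (- {..<\<nu> L}) ?B = row_restr {\<nu> L..<\<nu> (Suc L)} A"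
      using \<nu>[of L] by (auto simp: row_restr_def fun_eq_iff)
    then show ?case
      using Suc mnorm_row_restr[OF m sp_mats_row_restr[OF m A, of "{..<\<nu> (Suc L)}"], of "{..<\<nu> L}"] by simp
  qed
  also have "\<dots> \<le> mnorm m A ^ (2 * m)"
    by (intro power_mono mnorm_row_restr_le[OF m A] mnorm_nonneg[OF m] sp_mats_row_restr[OF m A])
  finally show ?thesis .
qed

lemma sum_col_blocks:
  assumes A: "A \<in> sp_mats m" and \<nu>: "\<And>i. \<nu> i \<le> \<nu> (Suc i)"
  shows "(\<Sum>i<L. mnorm m (col_restr {\<nu> i..<\<nu> (Suc i)} A) ^ (2 * m)) \<le> mnorm m A ^ (2 * m)"
  using sum_row_blocks[of "conj_transpose A" \<nu> L] assms
  by (simp add: col_restr_eq sp_mats_conj_transpose[OF m] mnorm_conj_transpose[OF m])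

text \<open>Summands at most \<open>\<eta> a\<close> are bounded trivially, the others by \<open>t \<le> t\<^bsup>k+1\<^esup> / (\<eta> a)\<^sup>k\<close>.\<close>

lemma average_le:
  fixes t :: "nat \<Rightarrow> real"
  assumes "\<And>i. 0 \<le> t i" "(\<Sum>i<L. t i ^ Suc k) \<le> a ^ Suc k" "0 \<le> a" "0 < \<eta>"
  shows "(\<Sum>i<L. t i) \<le> (real L * \<eta> + 1 / \<eta> ^ k) * a"
proof (cases "a = 0")
  case True
  then have "(\<Sum>i<L. t i ^ Suc k) \<le> 0" using assms(2) by simp
  then have "\<forall>i<L. t i ^ Suc k = 0"
    using assms(1) sum_nonneg_eq_0_iff[of "{..<L}" "\<lambda>i. t i ^ Suc k"] sum_nonneg[of "{..<L}" "\<lambda>i. t i ^ Suc k"]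
    by (auto simp: zero_le_mult_iff)
  then have "\<forall>i<L. t i = 0" by auto
  then show ?thesis using True by simp
next
  case False
  define b where "b = \<eta> * a"
  have b: "b > 0" using False assms by (simp add: b_def)
  have "t i \<le> b + t i ^ Suc k / b ^ k" for i
  proof (cases "t i \<le> b")
    case True
    have "0 \<le> t i ^ Suc k / b ^ k" using assms(1)[of i] b by simp
    then show ?thesis using True by linarith
  next
    case False
    have "b ^ k \<le> t i ^ k" using False b by (intro power_mono) auto
    then have "t i * b ^ k \<le> t i * t i ^ k" using assms(1) by (intro mult_left_mono)
    then have "t i \<le> t i ^ Suc k / b ^ k" using b by (simp add: pos_le_divide_eq)
    then show ?thesis using b by linarith
  qed
  then have "(\<Sum>i<L. t i) \<le> (\<Sum>i<L. b + t i ^ Suc k / b ^ k)" by (intro sum_mono)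
  also have "\<dots> = real L * b + (\<Sum>i<L. t i ^ Suc k) / b ^ k"
    by (simp add: sum.distrib sum_divide_distrib)
  also have "\<dots> \<le> real L * b + a ^ Suc k / b ^ k"
    using assms(2) b by (intro add_left_mono divide_right_mono) auto
  also have "\<dots> = (real L * \<eta> + 1 / \<eta> ^ k) * a"
    using False by (simp add: b_def power_mult_distrib field_simps)
  finally show ?thesis .
qed

text \<open>Without the annulus, \<open>A\<close> satisfies the hypothesis of
  \<open>gtrace_near_far\<close>, so \<open>\<mu>\<close> changes none of the truncated norms.
  Deleting the annulus costs its norm once.\<close>

lemma near_far_norm:
  assumes far: "separated m I n n'"
    and "n \<le> n'" and A: "A \<in> sp_mats m" "supported I A" and \<mu>: "cmod \<mu> = 1"
  shows "(\<lambda>r c. (square n r c + \<mu> * (1 - square n' r c)) * A r c) \<in> sp_mats m"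
    and "mnorm m (\<lambda>r c. (square n r c + \<mu> * (1 - square n' r c)) * A r c)
      \<le> mnorm m A + mnorm m (\<lambda>r c. (square n' r c - square n r c) * A r c)"
proof -
  let ?D = "\<lambda>r c. (square n' r c - square n r c) * A r c"
  let ?B = "\<lambda>r c. A r c + (-1) * ?D r c"
  let ?M = "\<lambda>r c. (square n r c + \<mu> * (1 - square n' r c)) * A r c"
  have D: "?D \<in> sp_mats m" by (rule square_diff_bound(1)[OF A(1) \<open>n \<le> n'\<close>])
  have B: "?B \<in> sp_mats m" by (rule sp_mats_add[OF m A(1) sp_mats_scale[OF m D]])
  have M: "?M = (\<lambda>r c. (if r < n \<and> c < n then 1 else \<mu>) * ?B r c)"
    using \<open>n \<le> n'\<close> by (auto simp: fun_eq_iff square_def)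
  have tnorm: "tnorm m N ?M = tnorm m N ?B" for N
    unfolding tnorm_def M
  proof (subst gtrace_near_far[OF m far _ \<mu>])
    fix r c assume nz: "?B r c \<noteq> 0"
    then have "A r c \<noteq> 0" by auto
    then show "(r, c) \<in> I \<and> (r < n \<and> c < n \<or> \<not> (r < n' \<and> c < n'))"
      using A(2) nz by (auto simp: supported_def square_def split: if_splits)
  qed simp
  show M_sp_mats: "?M \<in> sp_mats m"
    by (rule sp_mats_I[OF m, of _ "mnorm m ?B"]) (simp only: tnorm tnorm_le_mnorm[OF m B])
  have "mnorm m ?M \<le> mnorm m ?B"
    by (rule mnorm_leI[OF m]) (simp only: tnorm tnorm_le_mnorm[OF m B])
  also have "\<dots> \<le> mnorm m A + mnorm m (\<lambda>r c. (-1) * ?D r c)"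
    by (rule mnorm_add[OF m A(1) sp_mats_scale[OF m D]])
  also have "mnorm m (\<lambda>r c. (-1) * ?D r c) = mnorm m ?D"
    using mnorm_scale[OF m D, of "-1"] by simp
  finally show "mnorm m ?M \<le> mnorm m A + mnorm m ?D" .
qed

text \<open>The mean of the indicators of \<open>L\<close> nested squares, consecutive ones
  separated. Each summand of \<open>\<alpha> + \<mu> (1 - \<alpha>)\<close> differs from a
  multiplier as in \<open>near_far_norm\<close> on one annulus only, and the annulus norms are small
  on average.\<close>

lemma approx_multiplier:
  assumes G: "graph_condition (2 * m) I" and \<eta>: "\<eta> > 0"
  shows "\<exists>\<alpha> n'. n < n' \<and> (\<forall>r c. r < n \<and> c < n \<longrightarrow> \<alpha> r c = 1) \<and>
    (\<forall>r c. \<not> (r < n' \<and> c < n') \<longrightarrow> \<alpha> r c = 0) \<and> schur_bound I \<alpha> 1 \<and>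
    (\<forall>\<mu>. cmod \<mu> = 1 \<longrightarrow> schur_bound I (\<lambda>r c. \<alpha> r c + \<mu> * (1 - \<alpha> r c)) (1 + \<eta>))"
proof -
  obtain nxt where nxt: "\<And>k. k < nxt k" "\<And>k. separated m I k (nxt k)"
    using separated_exists[OF G] by metis
  define \<nu> where "\<nu> i = (nxt ^^ i) n" for i
  have \<nu>_Suc: "\<nu> i < \<nu> (Suc i)" "separated m I (\<nu> i) (\<nu> (Suc i))" for i using nxt by (simp_all add: \<nu>_def)
  have \<nu>_mono: "i \<le> j \<Longrightarrow> \<nu> i \<le> \<nu> j" for i j
    by (rule lift_Suc_mono_le[of \<nu>]) (auto simp: less_imp_le \<nu>_Suc)
  have \<nu>_0: "\<nu> 0 = n" by (simp add: \<nu>_def)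
  \<comment> \<open>Each of the two block sums will be at most \<open>2 * L * e\<close> times the
    norm, and both enter with a factor 2, so the total error is
    \<open>8 * L * e = L * \<eta>\<close>.\<close>
  define e where "e = \<eta> / 8"
  have e: "e > 0" using \<eta> by (simp add: e_def)
  \<comment> \<open>\<open>L\<close> is so large that the term \<open>1 / e ^ (2 * m - 1)\<close> of
    \<open>average_le\<close> does not exceed the term \<open>L * e\<close>.\<close>
  obtain L0 :: nat where L0: "1 / (e * e ^ (2 * m - 1)) < real L0" using reals_Archimedean2 by blast
  define L where "L = Suc L0"
  have L: "L > 0" "1 / e ^ (2 * m - 1) \<le> real L * e"
  proof -
    have "1 / e ^ (2 * m - 1) = 1 / (e * e ^ (2 * m - 1)) * e" using e by simp
    also have "\<dots> \<le> real L * e" using L0 e by (intro mult_right_mono) (auto simp: L_def)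
    finally show "1 / e ^ (2 * m - 1) \<le> real L * e" .
  qed (simp add: L_def)
  define \<alpha> where "\<alpha> r c = (\<Sum>i<L. of_real (1 / real L) * square (\<nu> (Suc i)) r c)" for r c
  have L1: "(\<Sum>i<L. of_real (1 / real L) :: complex) = 1" using L by simp
  have ones: "\<alpha> r c = 1" if "r < n" "c < n" for r c
  proof -
    have "square (\<nu> (Suc i)) r c = 1" for i
      using that \<nu>_mono[of 0 "Suc i"] by (simp add: square_def \<nu>_0)
    then show ?thesis using L1 by (simp add: \<alpha>_def)
  qed
  have zeros: "\<alpha> r c = 0" if "\<not> (r < \<nu> L \<and> c < \<nu> L)" for r c
  proof -
    have "square (\<nu> (Suc i)) r c = 0" if "i < L" for i
      using \<open>\<not> (r < \<nu> L \<and> c < \<nu> L)\<close> \<nu>_mono[of "Suc i" L] that by (auto simp: square_def)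
    then show ?thesis by (simp add: \<alpha>_def)
  qed
  have avg: "schur_bound I (\<lambda>r c. \<Sum>i<L. of_real (1 / real L) * s i r c) K"
    if bound: "\<And>A. A \<in> sp_mats m \<Longrightarrow> supported I A \<Longrightarrow> (\<forall>i<L. (\<lambda>r c. s i r c * A r c) \<in> sp_mats m) \<and>
      (\<Sum>i<L. mnorm m (\<lambda>r c. s i r c * A r c)) \<le> real L * (K * mnorm m A)" for s K
    unfolding schur_bound_def
  proof (intro allI impI)
    fix A assume A: "A \<in> sp_mats m \<and> supported I A"
    let ?B = "\<lambda>i r c. of_real (1 / real L) * (s i r c * A r c)"
    have eq: "(\<lambda>r c. (\<Sum>i<L. of_real (1 / real L) * s i r c) * A r c) = (\<lambda>r c. \<Sum>i<L. ?B i r c)"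
      by (simp add: sum_distrib_right mult.assoc)
    have sB: "(\<lambda>r c. s i r c * A r c) \<in> sp_mats m" if "i < L" for i using bound[of A] A that by simp
    have "(\<lambda>r c. \<Sum>i<L. ?B i r c) \<in> sp_mats m \<and> mnorm m (\<lambda>r c. \<Sum>i<L. ?B i r c) \<le> (\<Sum>i<L. mnorm m (?B i))"
      by (intro sp_mats_sum sp_mats_scale[OF m] sB) auto
    moreover have "(\<Sum>i<L. mnorm m (?B i)) = (\<Sum>i<L. mnorm m (\<lambda>r c. s i r c * A r c)) / real L"
      unfolding sum_divide_distrib by (intro sum.cong refl) (subst mnorm_scale[OF m sB], simp_all add: norm_divide)
    moreover have "\<dots> \<le> K * mnorm m A"
      using bound[of A] A L(1) by (simp add: pos_divide_le_eq mult.commute)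
    ultimately show "(\<lambda>r c. (\<Sum>i<L. of_real (1 / real L) * s i r c) * A r c) \<in> sp_mats m \<and>
        mnorm m (\<lambda>r c. (\<Sum>i<L. of_real (1 / real L) * s i r c) * A r c) \<le> K * mnorm m A"
      unfolding eq by linarith
  qed
  have "schur_bound I \<alpha> 1"
    unfolding \<alpha>_def
  proof (rule avg)
    fix A assume A: "A \<in> sp_mats m" "supported I A"
    have "(\<Sum>i<L. mnorm m (\<lambda>r c. square (\<nu> (Suc i)) r c * A r c)) \<le> (\<Sum>i<L. mnorm m A)"
      using schur_bound_square[of I] A by (intro sum_mono) (simp add: schur_bound_def)
    then show "(\<forall>i<L. (\<lambda>r c. square (\<nu> (Suc i)) r c * A r c) \<in> sp_mats m) \<and>
        (\<Sum>i<L. mnorm m (\<lambda>r c. square (\<nu> (Suc i)) r c * A r c)) \<le> real L * (1 * mnorm m A)"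
      using schur_bound_square[of I] A by (simp add: schur_bound_def)
  qed
  moreover have "schur_bound I (\<lambda>r c. \<alpha> r c + \<mu> * (1 - \<alpha> r c)) (1 + \<eta>)" if \<mu>: "cmod \<mu> = 1" for \<mu>
  proof -
    let ?s = "\<lambda>i r c. square (\<nu> (Suc i)) r c + \<mu> * (1 - square (\<nu> (Suc i)) r c)"
    have eq: "(\<lambda>r c. \<alpha> r c + \<mu> * (1 - \<alpha> r c)) = (\<lambda>r c. \<Sum>i<L. of_real (1 / real L) * ?s i r c)"
    proof (intro ext)
      fix r c
      have "(\<Sum>i<L. of_real (1 / real L) * ?s i r c)
          = \<alpha> r c + \<mu> * ((\<Sum>i<L. of_real (1 / real L)) - \<alpha> r c)"
        unfolding \<alpha>_def sum_distrib_left sum_subtractf[symmetric] sum.distrib[symmetric]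
        by (intro sum.cong refl) (simp add: algebra_simps)
      then show "\<alpha> r c + \<mu> * (1 - \<alpha> r c) = (\<Sum>i<L. of_real (1 / real L) * ?s i r c)"
        by (simp only: L1)
    qed
    show ?thesis
      unfolding eq
    proof (rule avg)
      fix A assume A: "A \<in> sp_mats m" "supported I A"
      let ?D = "\<lambda>i r c. (square (\<nu> (Suc i)) r c - square (\<nu> i) r c) * A r c"
      let ?U = "\<lambda>i r c. (square (\<nu> i) r c + \<mu> * (1 - square (\<nu> (Suc i)) r c)) * A r c"
      let ?R = "\<lambda>i. mnorm m (row_restr {\<nu> i..<\<nu> (Suc i)} A)" and ?C = "\<lambda>i. mnorm m (col_restr {\<nu> i..<\<nu> (Suc i)} A)"
      have le: "\<nu> i \<le> \<nu> (Suc i)" for i using \<nu>_Suc(1)[of i] by simp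
      have D: "?D i \<in> sp_mats m" "mnorm m (?D i) \<le> ?R i + ?C i" for i
        by (rule square_diff_bound[OF A(1) le])+
      have U: "?U i \<in> sp_mats m" "mnorm m (?U i) \<le> mnorm m A + mnorm m (?D i)" for i
        using near_far_norm[OF \<nu>_Suc(2) le A \<mu>] by blast+
      have sA: "(\<lambda>r c. ?s i r c * A r c) = (\<lambda>r c. ?U i r c + ?D i r c)" for i
        by (simp add: fun_eq_iff algebra_simps)
      have SPs: "(\<lambda>r c. ?s i r c * A r c) \<in> sp_mats m" for i
        unfolding sA by (rule sp_mats_add[OF m U(1) D(1)])
      have s_le: "mnorm m (\<lambda>r c. ?s i r c * A r c) \<le> mnorm m A + 2 * (?R i + ?C i)" for i
      proof -
        have "mnorm m (\<lambda>r c. ?s i r c * A r c) \<le> mnorm m (?U i) + mnorm m (?D i)"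
          unfolding sA by (rule mnorm_add[OF m U(1) D(1)])
        moreover have "a \<le> d + 2 * f" if "a \<le> b + c" "b \<le> d + c" "c \<le> f" for a b c d f :: real
          using that by linarith
        ultimately show ?thesis using U(2)[of i] D(2)[of i] by blast
      qed
      obtain k where k: "2 * m = Suc k" "k = 2 * m - 1" using m by (cases "2 * m") auto
      have R: "(\<Sum>i<L. ?R i) \<le> (real L * e + 1 / e ^ k) * mnorm m A"
        by (rule average_le) (use sum_row_blocks[where \<nu> = \<nu>, OF A(1) le] e k(1) in
          \<open>auto simp: mnorm_nonneg[OF m] sp_mats_row_restr[OF m] A simp del: power_Suc\<close>)
      have C: "(\<Sum>i<L. ?C i) \<le> (real L * e + 1 / e ^ k) * mnorm m A"
        by (rule average_le) (use sum_col_blocks[where \<nu> = \<nu>, OF A(1) le] e k(1) in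
          \<open>auto simp: mnorm_nonneg[OF m] sp_mats_col_restr[OF m] A simp del: power_Suc\<close>)
      have b: "(real L * e + 1 / e ^ k) * mnorm m A \<le> 2 * ((real L * e) * mnorm m A)"
      proof -
        have "real L * e + 1 / e ^ k \<le> 2 * (real L * e)" using L(2) unfolding k(2) by linarith
        then show ?thesis
          using mult_right_mono[OF _ mnorm_nonneg[OF m A(1)]] by (metis mult.assoc)
      qed
      have "(\<Sum>i<L. mnorm m (\<lambda>r c. ?s i r c * A r c)) \<le> (\<Sum>i<L. mnorm m A + 2 * (?R i + ?C i))"
        by (intro sum_mono s_le)
      also have "\<dots> = real L * mnorm m A + 2 * ((\<Sum>i<L. ?R i) + (\<Sum>i<L. ?C i))"
        by (simp add: sum.distrib sum_distrib_left)
      also have "\<dots> \<le> real L * mnorm m A + 8 * ((real L * e) * mnorm m A)"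
      proof -
        have "x + 2 * (u + v) \<le> x + 8 * z" if "u \<le> q" "v \<le> q" "q \<le> 2 * z" for x u v q z :: real
          using that by argo
        from this[OF R C b] show ?thesis .
      qed
      also have "\<dots> = real L * ((1 + \<eta>) * mnorm m A)"
        by (simp add: e_def algebra_simps)
      finally show "(\<forall>i<L. (\<lambda>r c. ?s i r c * A r c) \<in> sp_mats m) \<and>
          (\<Sum>i<L. mnorm m (\<lambda>r c. ?s i r c * A r c)) \<le> real L * ((1 + \<eta>) * mnorm m A)"
        using SPs by simp
    qed
  qed
  ultimately show ?thesis
    using ones zeros \<nu>_mono[of 1 L] \<nu>_Suc(1)[of 0] L(1) by (intro exI[of _ \<alpha>] exI[of _ "\<nu> L"]) (auto simp: \<nu>_0)
qed

lemma graph_condition_imp_complex_muap: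
  assumes G: "graph_condition (2 * m) I"
  shows "complex_muap (schatten_subspace (2 * m) I) (schatten_norm (2 * m))"
  unfolding complex_muap_def muap_def
proof (intro allI impI)
  fix \<delta> :: real assume \<delta>: "\<delta> > 0"
  \<comment> \<open>With \<open>\<eta> k = d / 2 ^ k\<close> the product of the bounds
    \<open>1 + \<eta> k\<close> is at most \<open>exp d = 1 + \<delta>\<close>.\<close>
  define d where "d = ln (1 + \<delta>)"
  define \<eta> where "\<eta> k = d / 2 ^ k" for k :: nat
  have d: "d > 0" using \<delta> by (simp add: d_def)
  then have \<eta>: "\<eta> k > 0" for k by (simp add: \<eta>_def)
  have prod_le: "(\<Prod>k=1..n. 1 + \<eta> k) \<le> 1 + \<delta>" for n
  proof -
    have "(\<Prod>k=1..n. 1 + \<eta> k) \<le> exp (\<Sum>k=1..n. \<eta> k)"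
      unfolding exp_sum[OF finite_atLeastAtMost]
      by (intro prod_mono) (auto simp: \<eta> less_imp_le exp_ge_add_one_self intro: add_nonneg_nonneg)
    also have "(\<Sum>k=1..n. \<eta> k) = d * (1 - 1 / 2 ^ n)"
      by (induction n) (simp_all add: \<eta>_def algebra_simps)
    also have "exp \<dots> \<le> exp d" using d by (simp add: mult_left_le)
    finally show ?thesis using \<delta> by (simp add: d_def)
  qed
  \<comment> \<open>A state is a multiplier with the size of a square containing its support. State
    0 is the zero multiplier, so that \<open>op_diff T 1 = T 1\<close> also has the form of a
    difference. \<open>Q\<close> makes each multiplier equal to 1 on the square of its
    predecessor.\<close>
  define P where "P k s \<longleftrightarrow> (k = 0 \<longrightarrow> s = (\<lambda>_ _. 0, 0)) \<and>
    (\<forall>r c. \<not> (r < snd s \<and> c < snd s) \<longrightarrow> fst s r c = 0) \<and> schur_bound I (fst s) 1 \<and>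
    (k > 0 \<longrightarrow> (\<forall>\<mu>. cmod \<mu> = 1 \<longrightarrow> schur_bound I (\<lambda>r c. fst s r c + \<mu> * (1 - fst s r c)) (1 + \<eta> k)))"
    for k :: nat and s :: "(nat \<Rightarrow> nat \<Rightarrow> complex) \<times> nat"
  define Q where "Q s s' \<longleftrightarrow> snd s < snd s' \<and> (\<forall>r c. r < snd s \<and> c < snd s \<longrightarrow> fst s' r c = 1)"
    for s s' :: "(nat \<Rightarrow> nat \<Rightarrow> complex) \<times> nat"
  have "\<exists>F. \<forall>k. P k (F k) \<and> Q (F k) (F (Suc k))"
  proof (rule dependent_nat_choice)
    show "\<exists>s. P 0 s"
      by (intro exI[of _ "(\<lambda>_ _. 0, 0)"])
        (simp add: P_def schur_bound_def sp_mats_zero mnorm_zero mnorm_nonneg[OF m])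
    fix s k assume "P k s"
    obtain \<alpha> n' where "snd s < n'" "\<forall>r c. r < snd s \<and> c < snd s \<longrightarrow> \<alpha> r c = 1"
      "\<forall>r c. \<not> (r < n' \<and> c < n') \<longrightarrow> \<alpha> r c = 0" "schur_bound I \<alpha> 1"
      "\<forall>\<mu>. cmod \<mu> = 1 \<longrightarrow> schur_bound I (\<lambda>r c. \<alpha> r c + \<mu> * (1 - \<alpha> r c)) (1 + \<eta> (Suc k))"
      using approx_multiplier[OF G \<eta>[of "Suc k"], of "snd s"] by blast
    then show "\<exists>s'. P (Suc k) s' \<and> Q s s'"
      by (intro exI[of _ "(\<alpha>, n')"]) (simp add: P_def Q_def)
  qed
  then obtain F where F: "\<And>k. P k (F k)" "\<And>k. Q (F k) (F (Suc k))" by blast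
  define \<alpha> where "\<alpha> k = fst (F k)" for k
  define n where "n k = snd (F k)" for k
  have \<alpha>0: "\<alpha> 0 r c = 0" for r c using F(1)[of 0] by (simp add: P_def \<alpha>_def)
  have zeros: "\<alpha> k r c = 0" if "\<not> (r < n k \<and> c < n k)" for k r c
    using F(1)[of k] that unfolding P_def \<alpha>_def n_def by blast
  have ones: "\<alpha> (Suc k) r c = 1" if "r < n k" "c < n k" for k r c
    using F(2)[of k] that unfolding Q_def \<alpha>_def n_def by blast
  have sb: "schur_bound I (\<alpha> k) 1" for k using F(1)[of k] unfolding P_def \<alpha>_def by blast
  have sbV: "schur_bound I (\<lambda>r c. \<alpha> k r c + \<mu> * (1 - \<alpha> k r c)) (1 + \<eta> k)" if "k > 0" "cmod \<mu> = 1" for k \<mu>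
    using F(1)[of k] that unfolding P_def \<alpha>_def by blast
  have n_Suc: "n k < n (Suc k)" for k using F(2)[of k] by (simp add: Q_def n_def)
  have mono: "strict_mono n" by (rule strict_monoI_Suc) (rule n_Suc)
  \<comment> \<open>At every entry either the new multiplier is already 1 or all earlier ones are
    still 0. All product formulas below follow from this dichotomy.\<close>
  have sep: "\<alpha> (Suc k) r c = 1 \<or> (\<forall>j\<le>k. \<alpha> j r c = 0)" for k r c
  proof (cases "r < n k \<and> c < n k")
    case False
    have "\<alpha> j r c = 0" if "j \<le> k" for j
      by (rule zeros) (use False strict_mono_less_eq[OF mono, of j k] that in auto)
    then show ?thesis by blast
  qed (use ones in blast)
  let ?X = "schatten_subspace (2 * m) I" and ?N = "schatten_norm (2 * m)"
  define T where "T k x = fin_op (n k) (\<lambda>r c. \<alpha> k r c * matrix_coeff x r c)" for k x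
  have mT: "matrix_coeff (T k x) = (\<lambda>r c. \<alpha> k r c * matrix_coeff x r c)" for k x
    unfolding T_def matrix_coeff_fin_op using zeros by (auto simp: trunc_def fun_eq_iff)
  have cT: "clinear_op (T k x)" for k x by (simp add: T_def clinear_fin_op)
  have TX: "T k x \<in> ?X" if "x \<in> ?X" for k x
    unfolding T_def
    by (rule fin_op_mem) (use schatten_subspaceD(3)[OF that] in \<open>auto simp: supported_def trunc_def\<close>)
  have finite_rank: "finite_rank_operator ?X ?N (T k)" for k
    unfolding finite_rank_operator_def
  proof (intro conjI ballI allI)
    show "T k ` ?X \<subseteq> ?X" using TX by blast
    fix x y assume x: "x \<in> ?X" and y: "y \<in> ?X"
    show "T k (x + y) = T k x + T k y"
      by (rule clinear_op_eqI) (simp_all add: cT clinear_op_add mT matrix_coeff_add distrib_left)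
  next
    fix z x assume x: "x \<in> ?X"
    show "T k (z *\<^sub>C x) = z *\<^sub>C T k x"
      by (rule clinear_op_eqI) (simp_all add: cT clinear_op_scaleC mT matrix_coeff_scaleC)
  next
    show "\<exists>K. \<forall>x\<in>?X. ?N (T k x) \<le> K * ?N x"
    proof (intro exI[of _ 1] ballI)
      fix x assume x: "x \<in> ?X"
      note x' = schatten_subspaceD[OF x] and Tx = schatten_subspaceD[OF TX[OF x, of k]]
      show "?N (T k x) \<le> 1 * ?N x"
        unfolding schatten_norm_eq[OF m x'(1,2)] schatten_norm_eq[OF m Tx(1,2)] mT
        by (rule schur_boundD(2)[OF sb x'(2,3)])
    qed
    show "\<exists>B. finite B \<and> T k ` ?X \<subseteq> cspan B"
    proof (intro exI[of _ "(\<lambda>(r, c). unit_op r c) ` ({..<n k} \<times> {..<n k})"] conjI image_subsetI)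
      fix x
      show "T k x \<in> cspan ((\<lambda>(r, c). unit_op r c) ` ({..<n k} \<times> {..<n k}))"
        unfolding T_def fin_op_eq_sum
        by (intro complex_vector.span_sum complex_vector.span_scale complex_vector.span_base) auto
    qed simp
  qed
  have approx: "(\<lambda>k. ?N (T k x - x)) \<longlonglongrightarrow> 0" if x: "x \<in> ?X" for x
  proof -
    note x' = schatten_subspaceD[OF x]
    let ?A = "matrix_coeff x"
    let ?B = "\<lambda>j r c. trunc j ?A r c - ?A r c"
    have B: "?B j \<in> sp_mats m" for j by (rule sp_mats_diff[OF m sp_mats_trunc[OF m] x'(2)])
    have BI: "supported I (?B j)" for j using x'(3) by (auto simp: supported_def trunc_def)
    \<comment> \<open>As \<open>\<alpha> (Suc j)\<close> is 1 on the square of size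
      \<open>j\<close>, the error is \<open>B - \<alpha> B\<close> with the truncation error
      \<open>B\<close>, and neither term exceeds the norm of \<open>B\<close>.\<close>
    have "?N (T (Suc j) x - x) \<le> 2 * mnorm m (?B j)" for j
    proof -
      have aB: "(\<lambda>r c. \<alpha> (Suc j) r c * ?B j r c) \<in> sp_mats m"
        "mnorm m (\<lambda>r c. \<alpha> (Suc j) r c * ?B j r c) \<le> 1 * mnorm m (?B j)"
        by (rule schur_boundD[OF sb B BI])+
      have eq: "matrix_coeff (T (Suc j) x - x) = (\<lambda>r c. ?B j r c + (-1) * (\<alpha> (Suc j) r c * ?B j r c))"
      proof (intro ext)
        fix r c
        show "matrix_coeff (T (Suc j) x - x) r c = ?B j r c + (-1) * (\<alpha> (Suc j) r c * ?B j r c)"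
        proof (cases "r < j \<and> c < j")
          case True
          have "j \<le> n j" by (rule strict_mono_imp_increasing[OF mono])
          then have "\<alpha> (Suc j) r c = 1" using True by (intro ones) simp_all
          then show ?thesis by (simp add: matrix_coeff_diff mT)
        next
          case False
          then have "trunc j ?A r c = 0" unfolding trunc_def by (rule if_not_P)
          then show ?thesis by (simp add: matrix_coeff_diff mT)
        qed
      qed
      have sp_mats: "matrix_coeff (T (Suc j) x - x) \<in> sp_mats m"
        unfolding eq by (rule sp_mats_add[OF m B sp_mats_scale[OF m aB(1)]])
      have "?N (T (Suc j) x - x) = mnorm m (\<lambda>r c. ?B j r c + (-1) * (\<alpha> (Suc j) r c * ?B j r c))"
        unfolding schatten_norm_eq[OF m clinear_op_diff[OF cT x'(1)] sp_mats] eq ..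
      also have "\<dots> \<le> mnorm m (?B j) + mnorm m (\<lambda>r c. (-1) * (\<alpha> (Suc j) r c * ?B j r c))"
        by (rule mnorm_add[OF m B sp_mats_scale[OF m aB(1)]])
      also have "mnorm m (\<lambda>r c. (-1) * (\<alpha> (Suc j) r c * ?B j r c)) = mnorm m (\<lambda>r c. \<alpha> (Suc j) r c * ?B j r c)"
        using mnorm_scale[OF m aB(1), of "-1"] by simp
      finally show ?thesis using aB(2) by linarith
    qed
    note upper = this
    have lim: "(\<lambda>j. 2 * mnorm m (?B j)) \<longlonglongrightarrow> 0"
      using tendsto_mult[OF tendsto_const mnorm_trunc_tendsto[OF m x'(2)], of 2] by simp
    have "(\<lambda>j. ?N (T (Suc j) x - x)) \<longlonglongrightarrow> 0"
    proof (rule tendsto_sandwich[OF _ _ tendsto_const lim])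
      show "\<forall>\<^sub>F j in sequentially. ?N (T (Suc j) x - x) \<le> 2 * mnorm m (?B j)"
        by (rule always_eventually) (intro allI upper)
      show "\<forall>\<^sub>F j in sequentially. 0 \<le> ?N (T (Suc j) x - x)"
        by (rule always_eventually) (simp add: schatten_norm_def)
    qed
    then show ?thesis by (rule LIMSEQ_imp_Suc)
  qed
  have uncond: "operator_norm ?X ?N (\<lambda>x. \<Sum>k=1..l. \<epsilon> k *\<^sub>C op_diff T k x) \<le> ereal (1 + \<delta>)"
    if \<epsilon>: "\<And>k. cmod (\<epsilon> k) = 1" for l \<epsilon>
  proof -
    define S where "S l r c = (\<Sum>k=1..l. \<epsilon> k * (\<alpha> k r c - \<alpha> (k - 1) r c))" for l r c
    \<comment> \<open>\<open>H l\<close> is a product of the multipliers \<open>\<alpha> k + \<mu>\<^sub>k (1 - \<alpha> k)\<close>, and \<open>S (Suc l) = H l * \<alpha> (Suc l)\<close>.\<close>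
    define H where "H l r c = S l r c + \<epsilon> (Suc l) * (1 - \<alpha> l r c)" for l r c
    have \<epsilon>0: "\<epsilon> k \<noteq> 0" for k using \<epsilon>[of k] by auto
    have S_zero: "S k r c = 0" if "\<forall>j\<le>k. \<alpha> j r c = 0" for k r c
      unfolding S_def by (intro sum.neutral ballI) (use that in auto)
    \<comment> \<open>Where \<open>\<alpha> (Suc k) = 1\<close>, the new factor is 1 and
      \<open>H\<close> does not change. Where the earlier multipliers vanish,
      \<open>H k = \<epsilon> (Suc k)\<close>, which the quotient of signs turns into
      \<open>\<epsilon> (Suc (Suc k))\<close>.\<close>
    have H_Suc: "H (Suc k) r c = H k r c * (\<alpha> (Suc k) r c + \<epsilon> (Suc (Suc k)) / \<epsilon> (Suc k) * (1 - \<alpha> (Suc k) r c))" for k r c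
      using sep[of k r c]
    proof
      assume "\<forall>j\<le>k. \<alpha> j r c = 0"
      then show ?thesis using S_zero[of k r c] \<epsilon>0[of "Suc k"] by (simp add: H_def S_def field_simps)
    qed (simp add: H_def S_def)
    have S_Suc: "S (Suc k) r c = H k r c * \<alpha> (Suc k) r c" for k r c
      using sep[of k r c]
    proof
      assume "\<forall>j\<le>k. \<alpha> j r c = 0"
      then show ?thesis using S_zero[of k r c] by (simp add: H_def S_def)
    qed (simp add: H_def S_def)
    have H_bound: "schur_bound I (H k) (\<Prod>i=1..k. 1 + \<eta> i)" for k
    proof (induction k)
      case 0
      have "H 0 = (\<lambda>r c. \<epsilon> 1)" by (simp add: H_def S_def \<alpha>0 fun_eq_iff)
      then show ?case using schur_bound_const[of I "\<epsilon> 1"] \<epsilon>[of 1] by simp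
    next
      case (Suc k)
      have "schur_bound I (\<lambda>r c. H k r c * (\<alpha> (Suc k) r c + \<epsilon> (Suc (Suc k)) / \<epsilon> (Suc k) * (1 - \<alpha> (Suc k) r c)))
          ((\<Prod>i=1..k. 1 + \<eta> i) * (1 + \<eta> (Suc k)))"
        by (intro schur_bound_mult Suc sbV prod_nonneg) (auto simp: norm_divide \<epsilon> \<eta> less_imp_le add_nonneg_nonneg)
      moreover have "H (Suc k) = (\<lambda>r c. H k r c * (\<alpha> (Suc k) r c + \<epsilon> (Suc (Suc k)) / \<epsilon> (Suc k) * (1 - \<alpha> (Suc k) r c)))"
        by (intro ext) (rule H_Suc)
      ultimately show ?case by simp
    qed
    have S_bound: "schur_bound I (S l) (1 + \<delta>)"
    proof (cases l)
      case 0
      then have "S l = (\<lambda>r c. 0)" by (simp add: S_def fun_eq_iff)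
      then show ?thesis using \<delta> by (simp add: schur_bound_def sp_mats_zero mnorm_zero mnorm_nonneg[OF m])
    next
      case (Suc k)
      have b: "schur_bound I (\<lambda>r c. H k r c * \<alpha> (Suc k) r c) ((\<Prod>i=1..k. 1 + \<eta> i) * 1)"
        by (intro schur_bound_mult H_bound sb prod_nonneg) (auto simp: \<eta> less_imp_le add_nonneg_nonneg)
      have Sl: "S l = (\<lambda>r c. H k r c * \<alpha> (Suc k) r c)"
        unfolding Suc by (intro ext) (rule S_Suc)
      show ?thesis
        unfolding schur_bound_def
      proof (intro allI impI)
        fix A assume A: "A \<in> sp_mats m \<and> supported I A"
        then have "(\<lambda>r c. S l r c * A r c) \<in> sp_mats m"
          "mnorm m (\<lambda>r c. S l r c * A r c) \<le> (\<Prod>i=1..k. 1 + \<eta> i) * mnorm m A"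
          using schur_boundD[OF b, of A] unfolding Sl by simp_all
        moreover have "(\<Prod>i=1..k. 1 + \<eta> i) * mnorm m A \<le> (1 + \<delta>) * mnorm m A"
          using A by (intro mult_right_mono prod_le mnorm_nonneg[OF m]) auto
        ultimately show "(\<lambda>r c. S l r c * A r c) \<in> sp_mats m \<and> mnorm m (\<lambda>r c. S l r c * A r c) \<le> (1 + \<delta>) * mnorm m A"
          by linarith
      qed
    qed
    show ?thesis
      unfolding operator_norm_def
    proof (rule SUP_least)
      fix x assume "x \<in> {x \<in> ?X. ?N x \<le> 1}"
      then have x: "x \<in> ?X" "?N x \<le> 1" by auto
      note x' = schatten_subspaceD[OF x(1)]
      let ?z = "\<Sum>k=1..l. \<epsilon> k *\<^sub>C op_diff T k x"
      have diff: "matrix_coeff (op_diff T k x) r c = (\<alpha> k r c - \<alpha> (k - 1) r c) * matrix_coeff x r c" if "k \<ge> 1" for k r c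
        using that by (auto simp: op_diff_def mT matrix_coeff_diff \<alpha>0 algebra_simps)
      have cz: "clinear_op ?z"
        by (intro clinear_op_sums clinear_op_scaleC) (simp add: op_diff_def cT clinear_op_diff)
      have mz: "matrix_coeff ?z = (\<lambda>r c. S l r c * matrix_coeff x r c)"
        by (intro ext) (simp add: matrix_coeff_sum matrix_coeff_scaleC S_def sum_distrib_right diff mult.assoc)
      have SPz: "matrix_coeff ?z \<in> sp_mats m" and z_le: "mnorm m (matrix_coeff ?z) \<le> (1 + \<delta>) * mnorm m (matrix_coeff x)"
        unfolding mz by (rule schur_boundD[OF S_bound x'(2,3)])+
      have "?N ?z \<le> (1 + \<delta>) * ?N x"
        unfolding schatten_norm_eq[OF m cz SPz] schatten_norm_eq[OF m x'(1,2)] by (rule z_le)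
      also have "\<dots> \<le> 1 + \<delta>" using x(2) \<delta> by (simp add: mult_left_le)
      finally show "ereal (?N ?z) \<le> ereal (1 + \<delta>)" by simp
    qed
  qed
  show "\<exists>T. approximating_sequence ?X ?N T \<and> unconditional_constant {z. cmod z = 1} ?X ?N T \<le> ereal (1 + \<delta>)"
  proof (intro exI[of _ T] conjI)
    show "approximating_sequence ?X ?N T"
      using finite_rank approx by (simp add: approximating_sequence_def)
    show "unconditional_constant {z. cmod z = 1} ?X ?N T \<le> ereal (1 + \<delta>)"
      unfolding unconditional_constant_def by (rule Inf_lower) (use uncond in auto)
  qed
qed

end


section \<open>Consequences of the real approximation property\<close>

text \<open>Coordinates on a finite-dimensional space of operators can be chosen among the matrix
  coefficients, which are continuous.\<close>

lemma coordinate_expansion: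
  fixes V :: "(ell2 \<Rightarrow>\<^sub>L ell2) set"
  assumes "complex_vector.subspace V" "\<And>v. v \<in> V \<Longrightarrow> clinear_op v"
    and "\<And>S. S \<subseteq> V \<Longrightarrow> \<not> complex_vector.dependent S \<Longrightarrow> finite S \<and> card S \<le> d"
  shows "\<exists>n e u. (\<forall>i<n. u i \<in> V) \<and>
    (\<forall>v\<in>V. v = (\<Sum>i<(n::nat). matrix_coeff v (fst (e i)) (snd (e i)) *\<^sub>C u i))"
  using assms
proof (induction d arbitrary: V)
  case 0
  have "v = 0" if "v \<in> V" for v
  proof (rule ccontr)
    assume "v \<noteq> 0"
    then have "\<not> complex_vector.dependent {v}" by (simp add: complex_vector.dependent_single)
    then have "finite {v} \<and> card {v} \<le> 0" using that by (intro "0.prems"(3)) auto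
    then show False by simp
  qed
  then show ?case by (intro exI[of _ 0]) auto
next
  case (Suc d)
  show ?case
  proof (cases "\<forall>v\<in>V. v = 0")
    case True
    then show ?thesis by (intro exI[of _ 0]) auto
  next
    case False
    then obtain v where v: "v \<in> V" "v \<noteq> 0" by blast
    have "\<exists>r c. matrix_coeff v r c \<noteq> 0"
    proof (rule ccontr)
      assume "\<not> ?thesis"
      then have "v = 0"
        by (intro clinear_op_eqI Suc.prems(2) v clinear_op_zero) (simp add: matrix_coeff_zero)
      then show False using v by simp
    qed
    then obtain r c where rc: "matrix_coeff v r c \<noteq> 0" by blast
    define w where "w = (1 / matrix_coeff v r c) *\<^sub>C v"
    have w: "w \<in> V" "matrix_coeff w r c = 1"
      using v rc complex_vector.subspace_scale[OF Suc.prems(1)] by (auto simp: w_def matrix_coeff_scaleC)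
    \<comment> \<open>The hyperplane of \<open>V\<close> where the chosen coefficient vanishes. An
      independent subset of it stays independent with \<open>w\<close> adjoined, so the bound on its
      size drops to \<open>d\<close>.\<close>
    define V' where "V' = {v \<in> V. matrix_coeff v r c = 0}"
    have K: "complex_vector.subspace {v. matrix_coeff v r c = 0}"
      unfolding complex_vector.subspace_def by (simp add: matrix_coeff_zero matrix_coeff_add matrix_coeff_scaleC)
    have V': "complex_vector.subspace V'"
      using Suc.prems(1) unfolding V'_def complex_vector.subspace_def
      by (simp add: matrix_coeff_zero matrix_coeff_add matrix_coeff_scaleC)
    have "finite S \<and> card S \<le> d" if S: "S \<subseteq> V'" "\<not> complex_vector.dependent S" for S
    proof -
      have "cspan S \<subseteq> {v. matrix_coeff v r c = 0}"
        by (rule complex_vector.span_minimal[OF _ K]) (use S in \<open>auto simp: V'_def\<close>)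
      then have ns: "w \<notin> cspan S" using w by auto
      then have "\<not> complex_vector.dependent (insert w S)"
        using S(2) by (rule complex_vector.independent_insertI)
      then have fin: "finite (insert w S) \<and> card (insert w S) \<le> Suc d"
        using S(1) w by (intro Suc.prems(3)) (auto simp: V'_def)
      moreover have "w \<notin> S" using ns complex_vector.span_base by blast
      ultimately show ?thesis by (auto simp: card_insert_if)
    qed
    then obtain n e u where IH: "\<And>i. i < n \<Longrightarrow> u i \<in> V'"
      "\<And>v. v \<in> V' \<Longrightarrow> v = (\<Sum>i<(n::nat). matrix_coeff v (fst (e i)) (snd (e i)) *\<^sub>C u i)"
      using Suc.IH[OF V'] Suc.prems(2) unfolding V'_def by blast
    \<comment> \<open>The induction hypothesis expands \<open>v - a *\<^sub>C w\<close>. The new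
      vector absorbs the contribution of \<open>w\<close>, so that the coefficients of
      \<open>v\<close> itself appear.\<close>
    define u' where "u' = u(n := w - (\<Sum>i<n. matrix_coeff w (fst (e i)) (snd (e i)) *\<^sub>C u i))"
    define e' where "e' = e(n := (r, c))"
    have "u' i \<in> V" if "i < Suc n" for i
    proof (cases "i = n")
      case True
      have "(\<Sum>i<n. matrix_coeff w (fst (e i)) (snd (e i)) *\<^sub>C u i) \<in> V"
        using IH(1) by (intro complex_vector.subspace_sum complex_vector.subspace_scale Suc.prems(1))
          (auto simp: V'_def)
      then show ?thesis
        using True w complex_vector.subspace_diff[OF Suc.prems(1)] by (simp add: u'_def)
    next
      case False
      then show ?thesis using that IH(1)[of i] by (simp add: u'_def V'_def)
    qed
    moreover have "v = (\<Sum>i<Suc n. matrix_coeff v (fst (e' i)) (snd (e' i)) *\<^sub>C u' i)" if "v \<in> V" for v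
    proof -
      define a where "a = matrix_coeff v r c"
      have "v - a *\<^sub>C w \<in> V'"
        using that w complex_vector.subspace_diff[OF Suc.prems(1)] complex_vector.subspace_scale[OF Suc.prems(1)]
        by (simp add: V'_def matrix_coeff_diff matrix_coeff_scaleC a_def)
      from IH(2)[OF this]
      have "v - a *\<^sub>C w = (\<Sum>i<n. (matrix_coeff v (fst (e i)) (snd (e i)) - a * matrix_coeff w (fst (e i)) (snd (e i))) *\<^sub>C u i)"
        by (simp only: matrix_coeff_diff matrix_coeff_scaleC)
      also have "\<dots> = (\<Sum>i<n. matrix_coeff v (fst (e i)) (snd (e i)) *\<^sub>C u i)
          - a *\<^sub>C (\<Sum>i<n. matrix_coeff w (fst (e i)) (snd (e i)) *\<^sub>C u i)"
        by (simp add: complex_vector.scale_left_diff_distrib sum_subtractf complex_vector.scale_sum_right scaleC_scaleC)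
      finally have "v = (\<Sum>i<n. matrix_coeff v (fst (e i)) (snd (e i)) *\<^sub>C u i)
          + a *\<^sub>C (w - (\<Sum>i<n. matrix_coeff w (fst (e i)) (snd (e i)) *\<^sub>C u i))"
        by (simp add: complex_vector.scale_right_diff_distrib algebra_simps)
      then show ?thesis by (simp add: u'_def e'_def a_def)
    qed
    ultimately show ?thesis by (intro exI[of _ "Suc n"] exI[of _ e'] exI[of _ u']) blast
  qed
qed

section \<open>Finitely supported operators\<close>

definition set_mat :: "(nat \<times> nat) set \<Rightarrow> (nat \<times> nat \<Rightarrow> complex) \<Rightarrow> nat \<Rightarrow> nat \<Rightarrow> complex"
  where "set_mat F a = (\<lambda>r c. if (r, c) \<in> F then a (r, c) else 0)"

lemma finite_pairs_bounded:
  assumes "finite (F :: (nat \<times> nat) set)" shows "\<exists>N. F \<subseteq> {..<N} \<times> {..<N}"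
proof -
  obtain N where N: "fst ` F \<union> snd ` F \<subseteq> {..<N}"
    using assms finite_nat_set_iff_bounded[of "fst ` F \<union> snd ` F"] by (auto simp: subset_iff)
  have "F \<subseteq> {..<N} \<times> {..<N}"
  proof
    fix x assume "x \<in> F"
    then have "fst x \<in> {..<N}" "snd x \<in> {..<N}" using N by auto
    then show "x \<in> {..<N} \<times> {..<N}" by (simp add: mem_Times_iff)
  qed
  then show ?thesis ..
qed

text \<open>Written as a sum of unit operators so that a linear operator can be applied term by
  term.\<close>

definition set_op :: "(nat \<times> nat) set \<Rightarrow> (nat \<times> nat \<Rightarrow> complex) \<Rightarrow> ell2 \<Rightarrow>\<^sub>L ell2"
  where "set_op F a = (\<Sum>e\<in>F. a e *\<^sub>C unit_op (fst e) (snd e))"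

lemma clinear_set_op: "clinear_op (set_op F a)"
  unfolding set_op_def by (intro clinear_op_sums clinear_op_scaleC clinear_unit_op)

lemma matrix_coeff_set_op:
  assumes "finite F" shows "matrix_coeff (set_op F a) = set_mat F a"
proof (intro ext)
  fix r c
  have "matrix_coeff (set_op F a) r c = (\<Sum>e\<in>F. if e = (r, c) then a e else 0)"
    unfolding set_op_def matrix_coeff_sum
    by (intro sum.cong refl) (auto simp: matrix_coeff_scaleC matrix_coeff_unit_op unit_mat_def prod_eq_iff)
  then show "matrix_coeff (set_op F a) r c = set_mat F a r c"
    using assms by (simp add: set_mat_def)
qed

text \<open>Expand the alternating products of \<open>a + b\<close> and \<open>a - b\<close>, where
  \<open>a\<close> and \<open>b\<close> are the indicators of \<open>F1\<close> and
  \<open>F2\<close>, by the number of factors \<open>b\<close>. The even parts agree and the odd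
  part changes its sign; it has nonnegative entries, and the walk \<open>f\<close> contributes at
  least 1 to its trace.\<close>

lemma gtrace_gap:
  assumes f: "\<And>t. t < 2 * m \<Longrightarrow> walk_edge f t \<in> F1 \<union> F2" "f (2 * m) = f 0"
    and disj: "F1 \<inter> F2 = {}" and M: "F1 \<union> F2 \<subseteq> {..<M} \<times> {..<M}"
    and odd: "odd (card {t. t < 2 * m \<and> walk_edge f t \<in> F2})" and m: "m \<ge> 1"
  shows "gtrace m M (cut M (\<lambda>r c. set_mat F1 (\<lambda>_. 1) r c + - 1 * set_mat F2 (\<lambda>_. 1) r c)) + 2
    \<le> gtrace m M (cut M (\<lambda>r c. set_mat F1 (\<lambda>_. 1) r c + set_mat F2 (\<lambda>_. 1) r c))"
proof -
  define nonneg :: "rcm \<Rightarrow> bool" where "nonneg A \<longleftrightarrow> (\<forall>i j. \<exists>x\<ge>0. ent A i j = complex_of_real x)" for A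
  have nn_add: "nonneg (A + B)" if "nonneg A" "nonneg B" for A B
    unfolding nonneg_def
  proof (intro allI)
    fix i j
    obtain x y where "x \<ge> 0" "ent A i j = complex_of_real x" "y \<ge> 0" "ent B i j = complex_of_real y"
      using \<open>nonneg A\<close> \<open>nonneg B\<close> unfolding nonneg_def by metis
    then show "\<exists>x\<ge>0. ent (A + B) i j = complex_of_real x"
      by (intro exI[of _ "x + y"]) (simp add: plus_rcm.rep_eq)
  qed
  have nn_star: "nonneg (star A)" if "nonneg A" for A
    using that unfolding nonneg_def star.rep_eq by (metis complex_cnj_complex_of_real)
  \<comment> \<open>Keeping one intermediate index \<open>k\<close> gives the lower bound; this
    singles out one walk in a matrix product.\<close>
  have nn_mult: "nonneg (A * B) \<and> Re (ent A i k) * Re (ent B k j) \<le> Re (ent (A * B) i j)"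
    if AB: "nonneg A" "nonneg B" for A B i j k
  proof -
    obtain x where x: "\<And>i j. x i j \<ge> 0" "\<And>i j. ent A i j = complex_of_real (x i j)"
      using AB(1) unfolding nonneg_def by metis
    obtain y where y: "\<And>i j. y i j \<ge> 0" "\<And>i j. ent B i j = complex_of_real (y i j)"
      using AB(2) unfolding nonneg_def by metis
    define S where "S i = insert k {l. ent A i l \<noteq> 0}" for i
    have fS: "finite (S i)" for i by (simp add: S_def finite_row)
    have e: "ent (A * B) i j = complex_of_real (\<Sum>l\<in>S i. x i l * y l j)" for i j
      using fS by (subst ent_mult[of "S i"]) (auto simp: S_def x y)
    have "nonneg (A * B)"
      unfolding nonneg_def e
    proof (intro allI)
      fix i j
      show "\<exists>z\<ge>0. complex_of_real (\<Sum>l\<in>S i. x i l * y l j) = complex_of_real z"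
        by (rule exI[of _ "\<Sum>l\<in>S i. x i l * y l j"]) (rule conjI[OF sum_nonneg[OF mult_nonneg_nonneg[OF x(1) y(1)]] refl])
    qed
    moreover have "x i k * y k j \<le> (\<Sum>l\<in>S i. x i l * y l j)"
      by (rule member_le_sum[of k]) (use fS in \<open>auto simp: S_def x y\<close>)
    ultimately show ?thesis by (simp add: e x(2) y(2))
  qed
  define a where "a = cut M (set_mat F1 (\<lambda>_. 1))"
  define b where "b = cut M (set_mat F2 (\<lambda>_. 1))"
  have ab: "nonneg a" "nonneg b"
    unfolding a_def b_def nonneg_def cut.rep_eq set_mat_def
    by (auto intro: exI[of _ 1] exI[of _ 0])
  define st :: "nat \<Rightarrow> rcm \<Rightarrow> rcm" where "st k x = (if even k then x else star x)" for k x
  define EO where "EO = rec_nat (1 :: rcm, 0 :: rcm)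
    (\<lambda>k P. (st k a * fst P + st k b * snd P, st k a * snd P + st k b * fst P))"
  \<comment> \<open>The parts of the alternating product that contain \<open>b\<close> an even (\<open>E\<close>) or odd (\<open>U\<close>) number of times.\<close>
  define E where "E k = fst (EO k)" for k
  define U where "U k = snd (EO k)" for k
  have EU0: "E 0 = 1" "U 0 = 0" by (simp_all add: E_def U_def EO_def)
  have EUS: "E (Suc k) = st k a * E k + st k b * U k" "U (Suc k) = st k a * U k + st k b * E k" for k
    by (simp_all add: E_def U_def EO_def)
  have nn_st: "nonneg (st k a)" "nonneg (st k b)" for k by (simp_all add: st_def ab nn_star)
  have nn: "nonneg (E k) \<and> nonneg (U k)" for k
  proof (induction k)
    case 0
    have "nonneg 1" unfolding nonneg_def
      by (intro allI, rule_tac x = "if i = j then 1 else 0" in exI) (simp add: one_rcm.rep_eq)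
    moreover have "nonneg 0" unfolding nonneg_def
      by (intro allI exI[of _ 0]) (simp add: zero_rcm.rep_eq)
    ultimately show ?case by (simp add: EU0)
  next
    case (Suc k)
    have mult: "nonneg (A * B)" if "nonneg A" "nonneg B" for A B
      using nn_mult[OF that] by blast
    show ?case unfolding EUS
      using Suc by (intro conjI nn_add mult nn_st) simp_all
  qed
  have altprod_Suc: "altprod x (Suc k) = st k x * altprod x k" for x k
    by (auto simp: altprod_def st_def mult.assoc)
  have st_add: "st k (x + y) = st k x + st k y" for k x y by (simp add: st_def star_add)
  have st_diff: "st k (x - y) = st k x - st k y" for k x y
  proof -
    have "st k x = st k ((x - y) + y)" by simp
    then show ?thesis unfolding st_add by simp
  qed
  have W0: "altprod x 0 = 1" for x by (simp add: altprod_def)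
  have Wp: "altprod (a + b) k = E k + U k" for k
  proof (induction k)
    case (Suc k)
    show ?case unfolding altprod_Suc Suc.IH st_add EUS by (simp add: algebra_simps)
  qed (simp add: W0 EU0)
  have Wm: "altprod (a - b) k = E k - U k" for k
  proof (induction k)
    case (Suc k)
    show ?case unfolding altprod_Suc Suc.IH st_diff EUS by (simp add: algebra_simps)
  qed (simp add: W0 EU0)
  define q where "q k = card {t. t < k \<and> walk_edge f t \<in> F2}" for k
  have q_Suc: "q (Suc k) = (if walk_edge f k \<in> F2 then Suc (q k) else q k)" for k
  proof -
    have "{t. t < Suc k \<and> walk_edge f t \<in> F2}
        = (if walk_edge f k \<in> F2 then insert k {t. t < k \<and> walk_edge f t \<in> F2} else {t. t < k \<and> walk_edge f t \<in> F2})"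
      by (auto simp: less_Suc_eq)
    then show ?thesis by (simp add: q_def)
  qed
  have entry: "Re (ent (st k (cut M (set_mat F (\<lambda>_. 1)))) (f (Suc k)) (f k)) = 1"
    if "walk_edge f k \<in> F" "F \<subseteq> {..<M} \<times> {..<M}" for k F
  proof -
    have "walk_edge f k \<in> {..<M} \<times> {..<M}" using that by blast
    then show ?thesis
      using that walk_edge_bounded[of f k M]
      by (auto simp: st_def star.rep_eq cut.rep_eq set_mat_def walk_edge_def split: if_splits)
  qed
  \<comment> \<open>The first \<open>k\<close> edges of \<open>f\<close> contribute at least 1 to
    the entry \<open>(f k, f 0)\<close> of the part with the parity of the number of edges in
    \<open>F2\<close> among them.\<close>
  have walk: "1 \<le> Re (ent (if even (q k) then E k else U k) (f k) (f 0))" if "k \<le> 2 * m" for k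
    using that
  proof (induction k)
    case 0 then show ?case by (simp add: q_def EU0 one_rcm.rep_eq)
  next
    case (Suc k)
    let ?X = "if even (q k) then E k else U k" and ?Y = "if even (q k) then U k else E k"
    define F where "F = (if walk_edge f k \<in> F2 then F2 else F1)"
    define x where "x = cut M (set_mat F (\<lambda>_. 1))"
    define y where "y = (if walk_edge f k \<in> F2 then a else b)"
    have F: "walk_edge f k \<in> F" "F \<subseteq> {..<M} \<times> {..<M}"
      using f(1)[of k] Suc.prems M by (auto simp: F_def)
    have eq: "(if even (q (Suc k)) then E (Suc k) else U (Suc k)) = st k x * ?X + st k y * ?Y"
      using disj by (auto simp: q_Suc EUS x_def y_def F_def a_def b_def algebra_simps)
    have nnx: "nonneg (st k x)" "nonneg ?X" "nonneg (st k y)" "nonneg ?Y"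
      using nn nn_st[of k] by (auto simp: x_def y_def F_def a_def b_def)
    have "1 \<le> Re (ent (st k x) (f (Suc k)) (f k)) * Re (ent ?X (f k) (f 0))"
      using Suc entry[OF F] by (simp add: x_def)
    also have "\<dots> \<le> Re (ent (st k x * ?X) (f (Suc k)) (f 0))"
      using nn_mult[OF nnx(1,2)] by blast
    also have "\<dots> \<le> Re (ent (st k x * ?X + st k y * ?Y) (f (Suc k)) (f 0))"
    proof -
      have "nonneg (st k y * ?Y)" using nn_mult[OF nnx(3,4)] by blast
      then obtain z where "z \<ge> 0" "ent (st k y * ?Y) (f (Suc k)) (f 0) = complex_of_real z"
        unfolding nonneg_def by blast
      then show ?thesis by (simp only: plus_rcm.rep_eq plus_complex.sel Re_complex_of_real)
    qed
    finally show ?case unfolding eq .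
  qed
  have U1: "1 \<le> Re (ent (U (2 * m)) (f 0) (f 0))"
    using walk[of "2 * m"] odd f(2) by (simp add: q_def)
  have f0M: "f 0 < M"
  proof -
    have "walk_edge f 0 \<in> {..<M} \<times> {..<M}" using f(1)[of 0] M m by auto
    then show ?thesis by (rule walk_edge_bounded(1))
  qed
  have "Re (ent (U (2 * m)) (f 0) (f 0)) \<le> (\<Sum>i<M. Re (ent (U (2 * m)) i i))"
  proof (rule member_le_sum)
    fix i
    show "0 \<le> Re (ent (U (2 * m)) i i)"
    proof -
      obtain z where "z \<ge> 0" "ent (U (2 * m)) i i = complex_of_real z"
        using nn[of "2 * m"] unfolding nonneg_def by blast
      then show ?thesis by simp
    qed
  qed (use f0M in auto)
  then have trU: "1 \<le> Re (trn M (U (2 * m)))"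
    using U1 by (simp add: trn_def)
  have W2: "(star x * x) ^ m = altprod x (2 * m)" for x by (simp add: altprod_def)
  have minus: "cut M (\<lambda>r c. set_mat F1 (\<lambda>_. 1) r c + - 1 * set_mat F2 (\<lambda>_. 1) r c) = a - b"
    by (rule rcm_eqI) (simp add: a_def b_def ent_diff cut.rep_eq)
  have tr_diff: "trn M (x - y) = trn M x - trn M y" for x y
    by (simp add: trn_def ent_diff sum_subtractf)
  have p: "gtrace m M (cut M (\<lambda>r c. set_mat F1 (\<lambda>_. 1) r c + set_mat F2 (\<lambda>_. 1) r c))
      = Re (trn M (E (2 * m))) + Re (trn M (U (2 * m)))"
    unfolding cut_add a_def[symmetric] b_def[symmetric] gtrace_def W2 Wp trn_add by (rule plus_complex.sel)
  have q: "gtrace m M (cut M (\<lambda>r c. set_mat F1 (\<lambda>_. 1) r c + - 1 * set_mat F2 (\<lambda>_. 1) r c))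
      = Re (trn M (E (2 * m))) - Re (trn M (U (2 * m)))"
    unfolding minus gtrace_def W2 Wm tr_diff by (rule minus_complex.sel)
  show ?thesis unfolding p q using trU by argo
qed

lemma finite_rank_operatorD:
  assumes "finite_rank_operator X N T"
  shows "x \<in> X \<Longrightarrow> T x \<in> X" "x \<in> X \<Longrightarrow> y \<in> X \<Longrightarrow> T (x + y) = T x + T y"
    "x \<in> X \<Longrightarrow> T (z *\<^sub>C x) = z *\<^sub>C T x" "\<exists>K. \<forall>x\<in>X. N (T x) \<le> K * N x"
    "\<exists>B. finite B \<and> T ` X \<subseteq> cspan B"
  using assms by (auto simp: finite_rank_operator_def)

text \<open>Rows sit at even positions here, in contrast to closed walks, whose even terms are
  columns.\<close>

lemma path_from_row:
  assumes "graph_dist J (Inl r) (Inr c) = enat d"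
  shows "\<exists>k :: nat \<Rightarrow> nat. k 0 = r \<and> k d = c \<and>
    (\<forall>i<d. (if even i then (k i, k (Suc i)) else (k (Suc i), k i)) \<in> J)"
proof -
  obtain vs where vs: "is_path J (Inl r) (Inr c) vs" "length vs = Suc d"
    using graph_dist_attained[OF assms] .
  define k where "k i = case_sum id id (vs ! i)" for i
  have ends: "vs ! 0 = Inl r" "vs ! d = Inr c"
    using vs by (auto simp: is_path_def hd_conv_nth last_conv_nth)
  have adj: "adjacent J (vs ! i) (vs ! Suc i)" if "i < d" for i
    using vs that by (simp add: is_path_walk)
  have isl: "isl (vs ! i) \<longleftrightarrow> even i" if "i \<le> d" for i
    using walk_isl[of d J "(!) vs" i, OF adj] that ends by simp
  have "(if even i then (k i, k (Suc i)) else (k (Suc i), k i)) \<in> J" if i: "i < d" for i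
  proof (cases "even i")
    case True
    then have "vs ! i = Inl (k i)" "vs ! Suc i = Inr (k (Suc i))"
      using isl[of i] isl[of "Suc i"] i by (auto simp: k_def split: sum.splits)
    then show ?thesis using adj[OF i] True by (simp add: adjacent_Inl_Inr)
  next
    case False
    then have "vs ! i = Inr (k i)" "vs ! Suc i = Inl (k (Suc i))"
      using isl[of i] isl[of "Suc i"] i by (auto simp: k_def split: sum.splits)
    then show ?thesis using adj[OF i] False by (simp add: adjacent_commute[of J "Inr _"] adjacent_Inl_Inr)
  qed
  then show ?thesis using ends by (intro exI[of _ k]) (simp add: k_def)
qed

section \<open>From the real property to the graph condition\<close>

context
  fixes m :: nat
  assumes m: "m \<ge> 1"
begin

text \<open>Operators on which \<open>schatten_norm\<close> is the norm of the matrix and thus obeys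
  the triangle inequality. Closure under sums needs no argument about compactness.\<close>

definition good :: "(ell2 \<Rightarrow>\<^sub>L ell2) \<Rightarrow> bool"
  where "good x \<longleftrightarrow> clinear_op x \<and> matrix_coeff x \<in> sp_mats m"

lemma good_add: "good x \<Longrightarrow> good y \<Longrightarrow> good (x + y)"
  and norm_good_add: "good x \<Longrightarrow> good y \<Longrightarrow>
    schatten_norm (2 * m) (x + y) \<le> schatten_norm (2 * m) x + schatten_norm (2 * m) y"
proof -
  assume "good x" "good y"
  then have x: "clinear_op x" "matrix_coeff x \<in> sp_mats m" and y: "clinear_op y" "matrix_coeff y \<in> sp_mats m"
    by (auto simp: good_def)
  have eq: "matrix_coeff (x + y) = (\<lambda>r c. matrix_coeff x r c + matrix_coeff y r c)"
    by (intro ext) (rule matrix_coeff_add)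
  have sp_mats: "matrix_coeff (x + y) \<in> sp_mats m" unfolding eq by (rule sp_mats_add[OF m x(2) y(2)])
  have c: "clinear_op (x + y)" by (rule clinear_op_add[OF x(1) y(1)])
  show "good (x + y)" using sp_mats c by (simp add: good_def)
  show "schatten_norm (2 * m) (x + y) \<le> schatten_norm (2 * m) x + schatten_norm (2 * m) y"
    unfolding schatten_norm_eq[OF m c sp_mats] schatten_norm_eq[OF m x] schatten_norm_eq[OF m y] eq
    by (rule mnorm_add[OF m x(2) y(2)])
qed

lemma good_scaleC: "good x \<Longrightarrow> good (z *\<^sub>C x)"
  and norm_good_scaleC: "good x \<Longrightarrow> schatten_norm (2 * m) (z *\<^sub>C x) = cmod z * schatten_norm (2 * m) x"
proof -
  assume "good x"
  then have x: "clinear_op x" "matrix_coeff x \<in> sp_mats m" by (auto simp: good_def)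
  have eq: "matrix_coeff (z *\<^sub>C x) = (\<lambda>r c. z * matrix_coeff x r c)"
    by (intro ext) (rule matrix_coeff_scaleC)
  have sp_mats: "matrix_coeff (z *\<^sub>C x) \<in> sp_mats m" unfolding eq by (rule sp_mats_scale[OF m x(2)])
  have c: "clinear_op (z *\<^sub>C x)" by (rule clinear_op_scaleC[OF x(1)])
  show "good (z *\<^sub>C x)" using sp_mats c by (simp add: good_def)
  show "schatten_norm (2 * m) (z *\<^sub>C x) = cmod z * schatten_norm (2 * m) x"
    unfolding schatten_norm_eq[OF m c sp_mats] schatten_norm_eq[OF m x] eq by (rule mnorm_scale[OF m x(2)])
qed

lemma diff_eq_scaleC: "x - y = x + (-1) *\<^sub>C (y :: ell2 \<Rightarrow>\<^sub>L ell2)"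
  by (simp add: complex_vector.scale_minus_left scaleC_one)

lemma good_diff: "good x \<Longrightarrow> good y \<Longrightarrow> good (x - y)"
  and norm_good_diff: "good x \<Longrightarrow> good y \<Longrightarrow>
    schatten_norm (2 * m) (x - y) \<le> schatten_norm (2 * m) x + schatten_norm (2 * m) y"
  unfolding diff_eq_scaleC using good_add[of x "(-1) *\<^sub>C y"] norm_good_add[of x "(-1) *\<^sub>C y"]
    good_scaleC[of y "-1"] norm_good_scaleC[of y "-1"] by simp_all

lemma good_subspace: "x \<in> schatten_subspace (2 * m) I \<Longrightarrow> good x"
  using schatten_subspaceD[OF m] by (auto simp: good_def)

lemma norm_good_sum:
  assumes "finite S" "\<And>i. i \<in> S \<Longrightarrow> good (f i)"
  shows "good (\<Sum>i\<in>S. f i) \<and> schatten_norm (2 * m) (\<Sum>i\<in>S. f i) \<le> (\<Sum>i\<in>S. schatten_norm (2 * m) (f i))"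
  using assms
proof (induction S rule: finite_induct)
  case empty
  have "matrix_coeff 0 = (\<lambda>r c. 0)" by (intro ext) (rule matrix_coeff_zero)
  then have "good 0" by (simp add: good_def clinear_op_zero sp_mats_zero[OF m])
  then show ?case using norm_good_scaleC[of 0 0] by simp
next
  case (insert i S)
  then have IH: "good (\<Sum>i\<in>S. f i)" "schatten_norm (2 * m) (\<Sum>i\<in>S. f i) \<le> (\<Sum>i\<in>S. schatten_norm (2 * m) (f i))"
    and fi: "good (f i)" by auto
  show ?case using good_add[OF fi IH(1)] norm_good_add[OF fi IH(1)] IH(2) insert.hyps by simp
qed

lemma set_op_mem:
  assumes "finite F" "F \<subseteq> I" shows "set_op F a \<in> schatten_subspace (2 * m) I"
proof -
  obtain N where N: "F \<subseteq> {..<N} \<times> {..<N}" using finite_pairs_bounded[OF assms(1)] by blast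
  have tr: "trunc N (set_mat F a) = set_mat F a"
    using N by (auto simp: trunc_def set_mat_def fun_eq_iff)
  have "set_op F a = fin_op N (set_mat F a)"
    by (rule clinear_op_eqI[OF clinear_set_op clinear_fin_op])
      (simp add: matrix_coeff_set_op[OF assms(1)] matrix_coeff_fin_op tr)
  moreover have "supported I (set_mat F a)" using assms(2) by (auto simp: supported_def set_mat_def)
  ultimately show ?thesis using fin_op_mem[OF m, of I N "set_mat F a"] by (simp add: tr)
qed

lemma norm_set_op_le:
  assumes "finite F"
  shows "schatten_norm (2 * m) (set_op F a) \<le> sqrt (\<Sum>e\<in>F. (cmod (a e))\<^sup>2)"
proof -
  have "set_op F a \<in> schatten_subspace (2 * m) F" by (rule set_op_mem[OF assms]) simp
  note mem = schatten_subspaceD[OF m this]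
  have "tnorm m N (set_mat F a) \<le> sqrt (\<Sum>e\<in>F. (cmod (a e))\<^sup>2)" for N
  proof -
    have "(\<Sum>r<N. \<Sum>c<N. (cmod (set_mat F a r c))\<^sup>2) = (\<Sum>e\<in>{..<N} \<times> {..<N}. if e \<in> F then (cmod (a e))\<^sup>2 else 0)"
      unfolding sum.cartesian_product by (intro sum.cong) (auto simp: set_mat_def)
    also have "\<dots> = (\<Sum>e\<in>({..<N} \<times> {..<N}) \<inter> F. (cmod (a e))\<^sup>2)"
      by (rule sum.inter_restrict[symmetric]) simp
    also have "\<dots> \<le> (\<Sum>e\<in>F. (cmod (a e))\<^sup>2)" using assms by (intro sum_mono2) auto
    finally show ?thesis using tnorm_hsn[OF m, of N "set_mat F a"] real_sqrt_le_mono order_trans by blast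
  qed
  then show ?thesis
    unfolding schatten_norm_eq[OF m mem(1,2)] matrix_coeff_set_op[OF assms] by (rule mnorm_leI[OF m])
qed

lemma set_op_insert: "finite F \<Longrightarrow> e \<notin> F \<Longrightarrow> set_op (insert e F) a = a e *\<^sub>C unit_op (fst e) (snd e) + set_op F a"
  by (simp add: set_op_def)

lemma operator_set_op:
  assumes T: "finite_rank_operator (schatten_subspace (2 * m) I) N T" and F: "finite F" "F \<subseteq> I"
  shows "T (set_op F a) = (\<Sum>e\<in>F. a e *\<^sub>C T (unit_op (fst e) (snd e)))"
  using F
proof (induction F rule: finite_induct)
  case empty
  have "0 = set_op {} a" by (simp add: set_op_def)
  also have "\<dots> \<in> schatten_subspace (2 * m) I" by (rule set_op_mem) auto
  finally have "T (0 *\<^sub>C 0) = 0 *\<^sub>C T 0" by (rule finite_rank_operatorD(3)[OF T])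
  then show ?case by (simp add: set_op_def)
next
  case (insert e F)
  let ?X = "schatten_subspace (2 * m) I"
  have u: "unit_op (fst e) (snd e) \<in> ?X" using insert.prems by (intro unit_op_mem[OF m]) auto
  have eF: "set_op F a \<in> ?X" using insert by (intro set_op_mem) auto
  have au: "a e *\<^sub>C unit_op (fst e) (snd e) \<in> ?X"
    using set_op_mem[of "{e}" I a] insert.prems by (simp add: set_op_def)
  have "T (a e *\<^sub>C unit_op (fst e) (snd e) + set_op F a) = T (a e *\<^sub>C unit_op (fst e) (snd e)) + T (set_op F a)"
    by (rule finite_rank_operatorD(2)[OF T au eF])
  moreover have "T (a e *\<^sub>C unit_op (fst e) (snd e)) = a e *\<^sub>C T (unit_op (fst e) (snd e))"
    by (rule finite_rank_operatorD(3)[OF T u])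
  ultimately show ?case using insert by (simp add: set_op_insert)
qed

text \<open>At a fixed position the coefficients \<open>g e\<close> of the images of unit matrices
  are square-summable: the combination with coefficients \<open>cnj (g e)\<close> gives
  \<open>s \<le> K' * sqrt s\<close>, as its norm is at most its Hilbert-Schmidt norm
  \<open>sqrt s\<close>.\<close>

lemma coefficient_decay:
  assumes T: "finite_rank_operator (schatten_subspace (2 * m) I) (schatten_norm (2 * m)) T" and \<eta>: "\<eta> > 0"
  shows "finite {e \<in> I. \<eta> \<le> cmod (matrix_coeff (T (unit_op (fst e) (snd e))) r c)}"
proof (rule ccontr)
  let ?X = "schatten_subspace (2 * m) I" and ?N = "schatten_norm (2 * m)"
  let ?S = "{e \<in> I. \<eta> \<le> cmod (matrix_coeff (T (unit_op (fst e) (snd e))) r c)}"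
  assume inf: "infinite ?S"
  obtain K where K: "\<And>x. x \<in> ?X \<Longrightarrow> ?N (T x) \<le> K * ?N x"
    using finite_rank_operatorD(4)[OF T] by blast
  define K' where "K' = max K 0"
  \<comment> \<open>With this many coefficients of modulus at least \<open>\<eta>\<close>, the sum
    of squares would exceed the square of \<open>K'\<close>.\<close>
  obtain k :: nat where k: "K'\<^sup>2 / \<eta>\<^sup>2 < real k" using reals_Archimedean2 by blast
  obtain F where F: "finite F" "card F = k" "F \<subseteq> ?S" using infinite_arbitrarily_large[OF inf] by blast
  define g where "g e = matrix_coeff (T (unit_op (fst e) (snd e))) r c" for e
  define s where "s = (\<Sum>e\<in>F. (cmod (g e))\<^sup>2)"
  have FI: "F \<subseteq> I" using F by auto
  let ?z = "set_op F (\<lambda>e. cnj (g e))"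
  have z: "?z \<in> ?X" by (rule set_op_mem[OF F(1) FI])
  have Tz: "T ?z \<in> ?X" by (rule finite_rank_operatorD(1)[OF T z])
  have s0: "0 \<le> s" by (simp add: s_def sum_nonneg)
  have "matrix_coeff (T ?z) r c = (\<Sum>e\<in>F. cnj (g e) * g e)"
    by (simp add: operator_set_op[OF T F(1) FI] matrix_coeff_sum matrix_coeff_scaleC g_def)
  also have "\<dots> = of_real s"
    by (simp add: s_def complex_norm_square[symmetric] mult.commute[of "cnj _"] del: of_real_power)
  finally have "s = cmod (matrix_coeff (T ?z) r c)" using s0 by simp
  also have "\<dots> \<le> ?N (T ?z)"
    using schatten_subspaceD[OF m Tz] by (simp add: schatten_norm_eq[OF m] cmod_le_mnorm[OF m])
  also have "\<dots> \<le> K * ?N ?z" by (rule K[OF z])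
  also have "\<dots> \<le> K' * ?N ?z" by (intro mult_right_mono) (auto simp: K'_def schatten_norm_def)
  also have "\<dots> \<le> K' * sqrt s"
    using norm_set_op_le[OF F(1), of "\<lambda>e. cnj (g e)"]
    by (intro mult_left_mono) (auto simp: K'_def s_def)
  finally have le: "sqrt s * sqrt s \<le> K' * sqrt s" using s0 by simp
  have "sqrt s \<le> K'"
  proof (cases "s = 0")
    case False
    then have "sqrt s > 0" using s0 by simp
    with le show ?thesis by (rule mult_right_le_imp_le)
  qed (simp add: K'_def)
  then have "(sqrt s)\<^sup>2 \<le> K'\<^sup>2" by (intro power_mono) (auto simp: s0)
  then have "s \<le> K'\<^sup>2" using s0 by simp
  moreover have "real k * \<eta>\<^sup>2 \<le> s"
  proof -
    have "(\<Sum>e\<in>F. \<eta>\<^sup>2) \<le> s"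
      unfolding s_def using F(3) \<eta> by (intro sum_mono power_mono) (auto simp: g_def)
    then show ?thesis by (simp add: F(2))
  qed
  moreover have "K'\<^sup>2 < real k * \<eta>\<^sup>2" using k \<eta> by (simp add: pos_divide_less_eq)
  ultimately show False by linarith
qed

text \<open>On a finite-dimensional range finitely many matrix coefficients control the norm, and
  each of them tends to zero along the unit matrices.\<close>

lemma unit_decay:
  assumes T: "finite_rank_operator (schatten_subspace (2 * m) I) (schatten_norm (2 * m)) T" and \<eta>: "\<eta> > 0"
  shows "\<exists>N. \<forall>e\<in>I - {..<N} \<times> {..<N}. schatten_norm (2 * m) (T (unit_op (fst e) (snd e))) < \<eta>"
proof -
  let ?X = "schatten_subspace (2 * m) I" and ?N = "schatten_norm (2 * m)"
  \<comment> \<open>Only images of finitely supported matrices are collected; for these the subspace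
    properties are immediate.\<close>
  define V where "V = {T (set_op F a) | F a. finite F \<and> F \<subseteq> I}"
  have VI: "T (set_op F a) \<in> V" if "finite F" "F \<subseteq> I" for F a
    unfolding V_def using that by blast
  have VX: "v \<in> ?X" if "v \<in> V" for v
    using that finite_rank_operatorD(1)[OF T set_op_mem] unfolding V_def by blast
  obtain B where B: "finite B" "T ` ?X \<subseteq> cspan B" using finite_rank_operatorD(5)[OF T] by blast
  have Vspan: "V \<subseteq> cspan B" using B(2) set_op_mem unfolding V_def by blast
  have sub: "complex_vector.subspace V"
  proof (rule complex_vector.subspaceI)
    have "T (set_op {} (\<lambda>_. 0)) = 0" using operator_set_op[OF T, of "{}"] by simp
    then show "0 \<in> V" unfolding V_def by force
  next
    fix x y assume "x \<in> V" "y \<in> V"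
    then obtain F a F' a' where F: "finite F" "F \<subseteq> I" "x = T (set_op F a)" and F': "finite F'" "F' \<subseteq> I" "y = T (set_op F' a')"
      unfolding V_def by blast
    define b where "b e = (if e \<in> F then a e else 0) + (if e \<in> F' then a' e else 0)" for e
    have "set_op F a + set_op F' a' = set_op (F \<union> F') b"
      by (rule clinear_op_eqI)
        (use F F' in \<open>auto simp: clinear_op_add clinear_set_op matrix_coeff_add matrix_coeff_set_op set_mat_def b_def\<close>)
    moreover have "T (set_op F a + set_op F' a') = x + y"
      unfolding F(3) F'(3) by (rule finite_rank_operatorD(2)[OF T set_op_mem[OF F(1,2)] set_op_mem[OF F'(1,2)]])
    ultimately show "x + y \<in> V" using VI[of "F \<union> F'" b] F F' by simp
  next
    fix z x assume "x \<in> V"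
    then obtain F a where F: "finite F" "F \<subseteq> I" "x = T (set_op F a)" unfolding V_def by blast
    have "z *\<^sub>C set_op F a = set_op F (\<lambda>e. z * a e)"
      by (simp add: set_op_def complex_vector.scale_sum_right scaleC_scaleC)
    moreover have "T (z *\<^sub>C set_op F a) = z *\<^sub>C x"
      unfolding F(3) by (rule finite_rank_operatorD(3)[OF T set_op_mem[OF F(1,2)]])
    ultimately show "z *\<^sub>C x \<in> V" using VI[OF F(1,2), of "\<lambda>e. z * a e"] by simp
  qed
  have "\<exists>n e u. (\<forall>i<n. u i \<in> V) \<and>
    (\<forall>v\<in>V. v = (\<Sum>i<(n::nat). matrix_coeff v (fst (e i)) (snd (e i)) *\<^sub>C u i))"
  proof (rule coordinate_expansion[OF sub, of "card B"])
    show "clinear_op v" if "v \<in> V" for v using schatten_subspaceD(1)[OF m VX[OF that]] .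
    show "finite S \<and> card S \<le> card B" if "S \<subseteq> V" "\<not> complex_vector.dependent S" for S
      using complex_vector.independent_span_bound[OF B(1) that(2)] that(1) Vspan by blast
  qed
  then obtain n e u where u: "\<And>i. i < n \<Longrightarrow> u i \<in> V"
    and ex: "\<And>v. v \<in> V \<Longrightarrow> v = (\<Sum>i<(n::nat). matrix_coeff v (fst (e i)) (snd (e i)) *\<^sub>C u i)"
    by blast
  define S where "S = (\<Sum>i<n. ?N (u i))"
  have N0: "0 \<le> ?N x" for x by (simp add: schatten_norm_def)
  have S0: "0 \<le> S" by (simp add: S_def sum_nonneg N0)
  \<comment> \<open>The norms in question are at most \<open>\<eta>' * S\<close>; the 1 in the
    denominator makes this strictly less than \<open>\<eta>\<close> and covers
    \<open>S = 0\<close>.\<close>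
  define \<eta>' where "\<eta>' = \<eta> / (1 + S)"
  have \<eta>': "\<eta>' > 0" using \<eta> S0 by (simp add: \<eta>'_def)
  let ?bad = "\<lambda>i. {f \<in> I. \<eta>' \<le> cmod (matrix_coeff (T (unit_op (fst f) (snd f))) (fst (e i)) (snd (e i)))}"
  have "finite (\<Union>i<n. ?bad i)" using coefficient_decay[OF T \<eta>'] by blast
  then obtain N where N: "(\<Union>i<n. ?bad i) \<subseteq> {..<N} \<times> {..<N}" using finite_pairs_bounded by blast
  show ?thesis
  proof (intro exI[of _ N] ballI)
    fix f assume f: "f \<in> I - {..<N} \<times> {..<N}"
    let ?v = "T (unit_op (fst f) (snd f))"
    have "unit_op (fst f) (snd f) = set_op {f} (\<lambda>_. 1)" by (simp add: set_op_def scaleC_one)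
    then have v: "?v \<in> V" unfolding V_def using f by (intro CollectI exI[of _ "{f}"] exI[of _ "\<lambda>_. 1"]) auto
    have small: "cmod (matrix_coeff ?v (fst (e i)) (snd (e i))) \<le> \<eta>'" if "i < n" for i
    proof (rule ccontr)
      assume "\<not> ?thesis"
      then have "f \<in> (\<Union>i<n. ?bad i)" using f that by (intro UN_I[of i]) auto
      then show False using N f by blast
    qed
    have gu: "good (u i)" if "i < n" for i using good_subspace VX u that by blast
    have "?N ?v = ?N (\<Sum>i<n. matrix_coeff ?v (fst (e i)) (snd (e i)) *\<^sub>C u i)"
      by (rule arg_cong[OF ex[OF v]])
    also have "\<dots> \<le> (\<Sum>i<n. ?N (matrix_coeff ?v (fst (e i)) (snd (e i)) *\<^sub>C u i))"
      using norm_good_sum[of "{..<n}" "\<lambda>i. matrix_coeff ?v (fst (e i)) (snd (e i)) *\<^sub>C u i"] gu good_scaleC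
      by simp
    also have "\<dots> = (\<Sum>i<n. cmod (matrix_coeff ?v (fst (e i)) (snd (e i))) * ?N (u i))"
      using gu by (intro sum.cong refl norm_good_scaleC) simp
    also have "\<dots> \<le> (\<Sum>i<n. \<eta>' * ?N (u i))"
      using small by (intro sum_mono mult_right_mono N0) simp
    also have "\<dots> = \<eta>' * S" by (simp add: S_def sum_distrib_left)
    also have "\<dots> < \<eta>" using \<eta> S0 by (simp add: \<eta>'_def pos_divide_less_eq)
    finally show "?N ?v < \<eta>" .
  qed
qed

text \<open>Signs 1 up to \<open>k\<close> and -1 afterwards sum to
  \<open>2 T k - T (k + i)\<close>, and \<open>T (k + i) z\<close> tends to
  \<open>z\<close>.\<close>

lemma muap_norm_bound:
  assumes T: "approximating_sequence (schatten_subspace (2 * m) I) (schatten_norm (2 * m)) T"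
    and U: "unconditional_constant {-1, 1} (schatten_subspace (2 * m) I) (schatten_norm (2 * m)) T \<le> ereal (1 + \<delta>)"
    and k: "k \<ge> 1" and z: "z \<in> schatten_subspace (2 * m) I" "schatten_norm (2 * m) z \<le> 1"
  shows "schatten_norm (2 * m) (2 *\<^sub>C T k z - z) \<le> 1 + \<delta>"
proof -
  let ?X = "schatten_subspace (2 * m) I" and ?N = "schatten_norm (2 * m)"
  have TX: "T l z \<in> ?X" if "l \<ge> 1" for l
    using T that unfolding approximating_sequence_def by (intro finite_rank_operatorD(1)[OF _ z(1)]) blast
  have gz: "good z" and gT: "good (T l z)" if "l \<ge> 1" for l
    using good_subspace z(1) TX that by blast+
  define \<epsilon> :: "nat \<Rightarrow> complex" where "\<epsilon> l = (if l \<le> k then 1 else - 1)" for l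
  have sum1: "(\<Sum>l=1..n. \<epsilon> l *\<^sub>C op_diff T l z) = T n z" if "1 \<le> n" "n \<le> k" for n
    using that
  proof (induction n)
    case (Suc n)
    then show ?case by (cases "n = 0") (auto simp: \<epsilon>_def op_diff_def scaleC_one)
  qed simp
  have sum2: "(\<Sum>l=1..k + i. \<epsilon> l *\<^sub>C op_diff T l z) = 2 *\<^sub>C T k z - T (k + i) z" for i
  proof (induction i)
    case 0
    have "2 *\<^sub>C T k z = T k z + T k z" using scaleC_add_left[of 1 1 "T k z"] by (simp add: scaleC_one)
    then show ?case using sum1[of k] k by simp
  next
    case (Suc i)
    have "\<epsilon> (Suc (k + i)) *\<^sub>C op_diff T (Suc (k + i)) z = - (T (Suc (k + i)) z - T (k + i) z)"
      using k by (simp add: \<epsilon>_def op_diff_def complex_vector.scale_minus_left scaleC_one)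
    then show ?case using Suc by simp
  qed
  have le: "?N (2 *\<^sub>C T k z - T (k + i) z) \<le> 1 + \<delta>" for i
  proof -
    have "operator_norm ?X ?N (\<lambda>x. \<Sum>l=1..k + i. \<epsilon> l *\<^sub>C op_diff T l x) \<le> unconditional_constant {-1, 1} ?X ?N T"
      unfolding unconditional_constant_def
    proof (rule Inf_greatest)
      fix D assume "D \<in> {D. \<forall>n \<epsilon>. (\<forall>k. \<epsilon> k \<in> {-1, 1}) \<longrightarrow>
        operator_norm ?X ?N (\<lambda>x. \<Sum>k=1..n. \<epsilon> k *\<^sub>C op_diff T k x) \<le> D}"
      then show "operator_norm ?X ?N (\<lambda>x. \<Sum>l=1..k + i. \<epsilon> l *\<^sub>C op_diff T l x) \<le> D"
        by (simp add: \<epsilon>_def)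
    qed
    then have "operator_norm ?X ?N (\<lambda>x. \<Sum>l=1..k + i. \<epsilon> l *\<^sub>C op_diff T l x) \<le> ereal (1 + \<delta>)"
      using U by (rule order_trans)
    moreover have "ereal (?N (\<Sum>l=1..k + i. \<epsilon> l *\<^sub>C op_diff T l z))
        \<le> operator_norm ?X ?N (\<lambda>x. \<Sum>l=1..k + i. \<epsilon> l *\<^sub>C op_diff T l x)"
      unfolding operator_norm_def using z by (intro SUP_upper) simp
    ultimately have "ereal (?N (\<Sum>l=1..k + i. \<epsilon> l *\<^sub>C op_diff T l z)) \<le> ereal (1 + \<delta>)"
      using order_trans by blast
    then show ?thesis unfolding sum2 by simp
  qed
  have lim: "(\<lambda>i. (1 + \<delta>) + ?N (T (k + i) z - z)) \<longlonglongrightarrow> (1 + \<delta>) + 0"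
  proof (intro tendsto_intros)
    have "(\<lambda>i. ?N (T i z - z)) \<longlonglongrightarrow> 0" using T z(1) by (simp add: approximating_sequence_def)
    then show "(\<lambda>i. ?N (T (k + i) z - z)) \<longlonglongrightarrow> 0"
      using LIMSEQ_ignore_initial_segment[of "\<lambda>i. ?N (T i z - z)" 0 k] by (simp add: add.commute)
  qed
  have "?N (2 *\<^sub>C T k z - z) \<le> (1 + \<delta>) + ?N (T (k + i) z - z)" for i
  proof -
    have g: "good (2 *\<^sub>C T k z - T (k + i) z)" "good (T (k + i) z - z)"
      using k gz gT by (auto intro!: good_diff good_scaleC)
    have "2 *\<^sub>C T k z - z = (2 *\<^sub>C T k z - T (k + i) z) + (T (k + i) z - z)" by simp
    then have "?N (2 *\<^sub>C T k z - z) \<le> ?N (2 *\<^sub>C T k z - T (k + i) z) + ?N (T (k + i) z - z)"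
      using norm_good_add[OF g] by simp
    then show ?thesis using le[of i] by linarith
  qed
  then show ?thesis using LIMSEQ_le_const[OF lim] by simp
qed

text \<open>The order of the quantifiers matters: the near edges and their square are fixed first,
  while the far set \<open>J\<close> is chosen only after an operator of the approximating
  sequence.\<close>

lemma near_far_walk:
  assumes near: "graph_dist I (Inl r) (Inr c) = enat (2 * j + 1)"
  shows "\<exists>n f1. \<forall>J h. graph_dist J (Inl r) (Inr c) = enat h \<and> 2 * j + 1 + h \<le> 2 * m \<and> J \<subseteq> I - {..<n} \<times> {..<n} \<longrightarrow>
    (\<exists>f. f (2 * m) = f 0 \<and>
      (\<forall>t<2 * m. walk_edge f t \<in> (if 2 * j + 1 \<le> t \<and> t < 2 * j + 1 + h then J else walk_edge f1 ` {..2 * j})) \<and>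
      walk_edge f1 ` {..2 * j} \<subseteq> I \<inter> {..<n} \<times> {..<n})"
proof -
  define d where "d = 2 * j + 1"
  obtain k1 where k1: "k1 0 = r" "k1 d = c"
    "\<And>i. i < d \<Longrightarrow> (if even i then (k1 i, k1 (Suc i)) else (k1 (Suc i), k1 i)) \<in> I"
    using path_from_row[OF near] unfolding d_def by blast
  \<comment> \<open>Reversed because closed walks start at a column: \<open>f1\<close> runs from
    \<open>c\<close> to \<open>r\<close>.\<close>
  define f1 where "f1 t = k1 (d - t)" for t
  have f1I: "walk_edge f1 ` {..2 * j} \<subseteq> I"
  proof (rule image_subsetI)
    fix t assume "t \<in> {..2 * j}"
    then have t: "t < d" by (simp add: d_def)
    define i where "i = d - Suc t"
    have i: "i < d" "d - t = Suc i" "d - Suc t = i" using t by (auto simp: i_def)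
    have "d = Suc (t + i)" using t by (simp add: i_def)
    then have par: "even i \<longleftrightarrow> even t" unfolding d_def by presburger
    have e: "f1 t = k1 (Suc i)" "f1 (Suc t) = k1 i" by (simp_all only: f1_def i(2,3))
    show "walk_edge f1 t \<in> I"
      using k1(3)[OF i(1)] unfolding walk_edge_def e par by (cases "even t") (simp_all only: if_True if_False)
  qed
  obtain n where n: "walk_edge f1 ` {..2 * j} \<subseteq> {..<n} \<times> {..<n}"
    using finite_pairs_bounded[of "walk_edge f1 ` {..2 * j}"] by blast
  have "\<exists>f. f (2 * m) = f 0 \<and>
      (\<forall>t<2 * m. walk_edge f t \<in> (if d \<le> t \<and> t < d + h then J else walk_edge f1 ` {..2 * j}))"
    if J: "graph_dist J (Inl r) (Inr c) = enat h" "d + h \<le> 2 * m" for J h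
  proof -
    obtain k2 where k2: "k2 0 = r" "k2 h = c"
      "\<And>i. i < h \<Longrightarrow> (if even i then (k2 i, k2 (Suc i)) else (k2 (Suc i), k2 i)) \<in> J"
      using path_from_row[OF J(1)] by blast
    have oh: "odd h" by (rule graph_dist_odd[OF J(1)])
    have od: "odd d" by (simp add: d_def)
    \<comment> \<open>The near path from \<open>c\<close> to \<open>r\<close>, the far path back to
      \<open>c\<close>, then to and fro along the first near edge up to length \<open>2 m\<close>.
      Since \<open>d\<close> and \<open>h\<close> are odd, the padding starts at an even
      position.\<close>
    define f where "f t = (if t \<le> d then f1 t else if t \<le> d + h then k2 (t - d) else if even t then f1 0 else f1 1)" for t
    have f10: "f1 0 = c" "f1 d = r" using k1 by (simp_all add: f1_def)
    have fL: "f t = (if even t then f1 0 else f1 1)" if "d + h \<le> t" for t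
    proof (cases "t = d + h")
      case True
      then have "f t = k2 h" using oh by (auto simp: f_def elim: oddE)
      then show ?thesis using True oh od by (simp add: k2(2) f10(1))
    qed (use that in \<open>simp add: f_def\<close>)
    have "walk_edge f t \<in> (if d \<le> t \<and> t < d + h then J else walk_edge f1 ` {..2 * j})" for t
    proof -
      consider "t < d" | "d \<le> t" "t < d + h" | "d + h \<le> t" by linarith
      then show ?thesis
      proof cases
        case 1
        then have "walk_edge f t = walk_edge f1 t" by (simp add: walk_edge_def f_def)
        then show ?thesis using 1 by (simp add: d_def)
      next
        case 2
        define i where "i = t - d"
        have i: "t = d + i" "i < h" using 2 by (auto simp: i_def)
        have "f t = k2 i" using i(2) by (cases "i = 0") (simp_all add: f_def i(1) f10(2) k2(1))
        moreover have "f (Suc t) = k2 (Suc i)" using i(2) by (simp add: f_def i(1))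
        moreover have "even t \<longleftrightarrow> odd i" using od by (simp add: i(1))
        ultimately have "walk_edge f t = (if even i then (k2 i, k2 (Suc i)) else (k2 (Suc i), k2 i))"
          by (simp add: walk_edge_def)
        then show ?thesis using k2(3)[OF i(2)] 2 by (simp only: simp_thms if_True)
      next
        case 3
        have "walk_edge f t = walk_edge f1 0"
          using fL[of t] fL[of "Suc t"] 3 by (cases "even t") (simp_all add: walk_edge_def)
        then show ?thesis using 3 by simp
      qed
    qed
    moreover have "f (2 * m) = f 0" using fL[OF J(2)] by (simp add: f_def)
    ultimately show ?thesis by blast
  qed
  note ex = this
  show ?thesis
  proof (rule exI[of _ n], rule exI[of _ f1], intro allI impI)
    fix J h
    assume J: "graph_dist J (Inl r) (Inr c) = enat h \<and> 2 * j + 1 + h \<le> 2 * m \<and> J \<subseteq> I - {..<n} \<times> {..<n}"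
    obtain f where "f (2 * m) = f 0"
      "\<forall>t<2 * m. walk_edge f t \<in> (if d \<le> t \<and> t < d + h then J else walk_edge f1 ` {..2 * j})"
    proof -
      have "graph_dist J (Inl r) (Inr c) = enat h" "d + h \<le> 2 * m" using J by (simp_all add: d_def)
      from ex[OF this] show ?thesis using that by (elim exE conjE)
    qed
    then show "\<exists>f. f (2 * m) = f 0 \<and>
      (\<forall>t<2 * m. walk_edge f t \<in> (if 2 * j + 1 \<le> t \<and> t < 2 * j + 1 + h then J else walk_edge f1 ` {..2 * j})) \<and>
      walk_edge f1 ` {..2 * j} \<subseteq> I \<inter> {..<n} \<times> {..<n}"
      unfolding d_def using n f1I by (intro exI[of _ f] conjI) simp_all
  qed
qed

text \<open>A mean value estimate: nearly equal norms have nearly equal powers.\<close>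

lemma power_diff_le:
  fixes a b K :: real
  assumes "0 \<le> b" "b \<le> a" "a \<le> K"
  shows "a ^ Suc k - b ^ Suc k \<le> real (Suc k) * K ^ k * (a - b)"
proof (induction k)
  case (Suc k)
  have "a ^ Suc (Suc k) - b ^ Suc (Suc k) = a * (a ^ Suc k - b ^ Suc k) + b ^ Suc k * (a - b)"
    by (simp add: algebra_simps)
  also have "\<dots> \<le> K * (real (Suc k) * K ^ k * (a - b)) + K ^ Suc k * (a - b)"
  proof (intro add_mono mult_mono)
    show "a ^ Suc k - b ^ Suc k \<le> real (Suc k) * K ^ k * (a - b)" by (rule Suc)
    show "0 \<le> a ^ Suc k - b ^ Suc k" using assms power_mono[of b a "Suc k"] by simp
    show "b ^ Suc k \<le> K ^ Suc k" using assms by (intro power_mono) auto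
  qed (use assms in auto)
  also have "\<dots> = real (Suc (Suc k)) * K ^ Suc k * (a - b)"
    by (simp add: algebra_simps)
  finally show ?case .
qed simp

lemma real_muap_imp_graph_condition:
  assumes muap: "real_muap (schatten_subspace (2 * m) I) (schatten_norm (2 * m))"
  shows "graph_condition (2 * m) I"
proof (rule ccontr)
  let ?X = "schatten_subspace (2 * m) I" and ?N = "schatten_norm (2 * m)"
  assume "\<not> graph_condition (2 * m) I"
  then obtain r c j where near: "graph_dist I (Inl r) (Inr c) = enat (2 * j + 1)" and j: "2 * j + 1 \<le> m"
    and asym: "\<not> enat (2 * m - 2 * j + 1) \<le> asymptotic_dist I r c"
    by (auto simp: graph_condition_def)
  \<comment> \<open>An odd \<open>h\<close> below \<open>2 m - 2 j + 1\<close> is at most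
    \<open>2 m - 2 j - 1\<close>, which leaves room for the near path.\<close>
  have far: "\<exists>h. graph_dist (I - {..<N} \<times> {..<N}) (Inl r) (Inr c) = enat h \<and> odd h \<and> 2 * j + 1 + h \<le> 2 * m" for N
  proof -
    have "graph_dist (I - {..<N} \<times> {..<N}) (Inl r) (Inr c) \<le> asymptotic_dist I r c"
      unfolding asymptotic_dist_def by (rule SUP_upper2[of "({..<N}, {..<N})"]) auto
    then have lt: "graph_dist (I - {..<N} \<times> {..<N}) (Inl r) (Inr c) < enat (2 * m - 2 * j + 1)"
      using asym by (meson le_less_trans not_le)
    then obtain h where h: "graph_dist (I - {..<N} \<times> {..<N}) (Inl r) (Inr c) = enat h"
      by (cases "graph_dist (I - {..<N} \<times> {..<N}) (Inl r) (Inr c)") auto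
    have "odd h" by (rule graph_dist_odd[OF h])
    moreover have "h < 2 * m - 2 * j + 1" using lt h by simp
    ultimately have "2 * j + 1 + h \<le> 2 * m" using j by presburger
    then show ?thesis using h \<open>odd h\<close> by blast
  qed
  obtain n f1 where walk: "\<forall>J h. graph_dist J (Inl r) (Inr c) = enat h \<and> 2 * j + 1 + h \<le> 2 * m \<and> J \<subseteq> I - {..<n} \<times> {..<n} \<longrightarrow>
    (\<exists>f. f (2 * m) = f 0 \<and>
      (\<forall>t<2 * m. walk_edge f t \<in> (if 2 * j + 1 \<le> t \<and> t < 2 * j + 1 + h then J else walk_edge f1 ` {..2 * j})) \<and>
      walk_edge f1 ` {..2 * j} \<subseteq> I \<inter> {..<n} \<times> {..<n})"
    using near_far_walk[OF near] by (elim exE)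
  note walk = walk[THEN spec, THEN spec, THEN mp, OF conjI[OF _ conjI]]
  define F1 where "F1 = walk_edge f1 ` {..2 * j}"
  have finF1: "finite F1" by (simp add: F1_def)
  have F1: "F1 \<subseteq> I \<inter> {..<n} \<times> {..<n}"
  proof -
    obtain h where h: "graph_dist (I - {..<n} \<times> {..<n}) (Inl r) (Inr c) = enat h" "2 * j + 1 + h \<le> 2 * m"
      using far by blast
    show ?thesis using walk[OF h order_refl] unfolding F1_def by (elim exE conjE)
  qed
  have cF1: "card F1 \<le> 2 * j + 1" using card_image_le[of "{..2 * j}" "walk_edge f1"] by (simp add: F1_def)
  \<comment> \<open>Bounds the norms of both \<open>X + Y\<close> and \<open>X - Y\<close>: each of
    \<open>X\<close> and \<open>Y\<close> has at most \<open>2 m\<close> unit entries and therefore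
    norm at most \<open>2 m\<close>.\<close>
  define K where "K = 4 * real m"
  have K: "K \<ge> 1" using m by (simp add: K_def)
  \<comment> \<open>Chosen so that \<open>a - b \<le> \<delta> * (K + 1)\<close> forces the
    \<open>2 m\<close>-th powers to differ by at most 1, against a gap of 2.\<close>
  define \<delta> where "\<delta> = 1 / (real (2 * m) * K ^ (2 * m - 1) * (K + 1))"
  have \<delta>: "\<delta> > 0" using K m by (simp add: \<delta>_def)
  obtain T where T: "approximating_sequence ?X ?N T" "unconditional_constant {-1, 1} ?X ?N T \<le> ereal (1 + \<delta>)"
    using muap \<delta> unfolding real_muap_def muap_def by blast
  have frT: "finite_rank_operator ?X ?N (T k)" if "k \<ge> 1" for k
    using T(1) that by (simp add: approximating_sequence_def)
  define X where "X = set_op F1 (\<lambda>_. 1)"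
  have X: "X \<in> ?X" unfolding X_def using finF1 F1 by (intro set_op_mem) auto
  have N0: "0 \<le> ?N x" for x by (simp add: schatten_norm_def)
  obtain k where k: "k \<ge> 1" "?N (T k X - X) < \<delta> / 4"
  proof -
    have lim: "(\<lambda>k. ?N (T k X - X)) \<longlonglongrightarrow> 0"
      using T(1) X unfolding approximating_sequence_def by (elim conjE) (rule bspec)
    have "\<forall>\<^sub>F k in sequentially. ?N (T k X - X) < \<delta> / 4"
      by (rule order_tendstoD(2)[OF lim]) (use \<delta> in simp)
    then have "\<forall>\<^sub>F k in sequentially. k \<ge> 1 \<and> ?N (T k X - X) < \<delta> / 4"
      by (rule eventually_conj[OF eventually_ge_at_top])
    from eventually_happens'[OF sequentially_bot this] show ?thesis using that by (elim exE conjE)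
  qed
  \<comment> \<open>\<open>Y\<close> has at most \<open>2 m\<close> entries, so the norm of
    \<open>T k Y\<close> is at most \<open>2 * m * \<eta> = \<delta> / 4\<close>.\<close>
  define \<eta> where "\<eta> = \<delta> / (8 * real m)"
  have \<eta>: "\<eta> > 0" using \<delta> m by (simp add: \<eta>_def)
  obtain N where "\<forall>e\<in>I - {..<N} \<times> {..<N}. ?N (T k (unit_op (fst e) (snd e))) < \<eta>"
    using unit_decay[OF frT[OF k(1)] \<eta>] by (elim exE)
  note N = bspec[OF this]
  define n' where "n' = max n N"
  let ?J = "I - {..<n'} \<times> {..<n'}"
  obtain h where h: "graph_dist ?J (Inl r) (Inr c) = enat h" "odd h" "2 * j + 1 + h \<le> 2 * m"
    using far by blast
  have Jn: "?J \<subseteq> I - {..<n} \<times> {..<n}" and JN: "?J \<subseteq> I - {..<N} \<times> {..<N}"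
    by (auto simp: n'_def)
  obtain f where f: "f (2 * m) = f 0"
    "\<forall>t<2 * m. walk_edge f t \<in> (if 2 * j + 1 \<le> t \<and> t < 2 * j + 1 + h then ?J else F1)"
    using walk[OF h(1,3) Jn] unfolding F1_def by (elim exE conjE)
  note f = f(1) f(2)[rule_format]
  define F2 where "F2 = walk_edge f ` {2 * j + 1..<2 * j + 1 + h}"
  have finF2: "finite F2" by (simp add: F2_def)
  have F2: "F2 \<subseteq> ?J"
  proof
    fix e assume "e \<in> F2"
    then obtain t where t: "2 * j + 1 \<le> t" "t < 2 * j + 1 + h" "e = walk_edge f t" by (auto simp: F2_def)
    have "t < 2 * m" using t(2) h(3) by linarith
    from f(2)[OF this] show "e \<in> ?J" using t by simp
  qed
  have cF2: "card F2 \<le> h" using card_image_le[of "{2 * j + 1..<2 * j + 1 + h}" "walk_edge f"] by (simp add: F2_def)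
  have disj: "F1 \<inter> F2 = {}" using F1 F2 Jn by blast
  define Y where "Y = set_op F2 (\<lambda>_. 1)"
  have Y: "Y \<in> ?X" unfolding Y_def using finF2 F2 by (intro set_op_mem) auto
  define A where "A = X + Y"
  define B where "B = X - Y"
  define a where "a = ?N A"
  define b where "b = ?N B"
  have gX: "good X" and gY: "good Y" using good_subspace X Y by blast+
  have gA: "good A" and gB: "good B" unfolding A_def B_def using gX gY good_add good_diff by blast+
  have NX: "?N X \<le> 2 * real m" and NY: "?N Y \<le> 2 * real m"
  proof -
    have le: "?N (set_op F (\<lambda>_. 1)) \<le> 2 * real m" if "finite F" "card F \<le> 2 * m" for F
    proof -
      have "?N (set_op F (\<lambda>_. 1)) \<le> sqrt (real (card F))"
        using norm_set_op_le[OF that(1), of "\<lambda>_. 1"] by simp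
      also have "\<dots> \<le> sqrt ((2 * real m)\<^sup>2)"
      proof (intro real_sqrt_le_mono)
        have "real (card F) \<le> 2 * real m" using that(2) by linarith
        also have "\<dots> \<le> (2 * real m)\<^sup>2" using m by (simp add: power2_eq_square)
        finally show "real (card F) \<le> (2 * real m)\<^sup>2" .
      qed
      also have "sqrt ((2 * real m)\<^sup>2) = 2 * real m" by (rule real_sqrt_unique[OF refl]) simp
      finally show ?thesis .
    qed
    show "?N X \<le> 2 * real m" unfolding X_def using cF1 h(3) by (intro le finF1) linarith
    show "?N Y \<le> 2 * real m" unfolding Y_def using cF2 h(3) by (intro le finF2) linarith
  qed
  have aK: "a \<le> K" and bK: "b \<le> K"
    using norm_good_add[OF gX gY] norm_good_diff[OF gX gY] NX NY
    by (simp_all add: a_def b_def A_def B_def K_def)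
  obtain M where M: "F1 \<union> F2 \<subseteq> {..<M} \<times> {..<M}"
    using finite_pairs_bounded[of "F1 \<union> F2"] finF1 finF2 by blast
  have gap: "b ^ (2 * m) + 2 \<le> a ^ (2 * m)"
  proof -
    let ?SA = "\<lambda>r c. set_mat F1 (\<lambda>_. 1) r c + set_mat F2 (\<lambda>_. 1) r c"
    let ?SB = "\<lambda>r c. set_mat F1 (\<lambda>_. 1) r c + - 1 * set_mat F2 (\<lambda>_. 1) r c"
    have mA: "matrix_coeff A = ?SA"
      by (intro ext) (simp add: A_def X_def Y_def matrix_coeff_add matrix_coeff_set_op finF1 finF2)
    have mB: "matrix_coeff B = ?SB"
      by (intro ext) (simp add: B_def X_def Y_def matrix_coeff_diff matrix_coeff_set_op finF1 finF2)
    have supp: "r < M \<and> c < M" if "(r, c) \<in> F1 \<or> (r, c) \<in> F2" for r c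
      using M that by auto
    have "a = mnorm m ?SA"
      unfolding a_def using gA schatten_norm_eq[OF m, of A] unfolding good_def mA by blast
    also have "\<dots> = tnorm m M ?SA"
      by (rule sp_mats_corner(2)[OF m]) (rule supp, auto simp: set_mat_def split: if_splits)
    finally have "a = tnorm m M ?SA" .
    moreover have "b = tnorm m M ?SB"
    proof -
      have "b = mnorm m ?SB"
        unfolding b_def using gB schatten_norm_eq[OF m, of B] unfolding good_def mB by blast
      also have "\<dots> = tnorm m M ?SB"
        by (rule sp_mats_corner(2)[OF m]) (rule supp, auto simp: set_mat_def split: if_splits)
      finally show ?thesis .
    qed
    moreover have "gtrace m M (cut M ?SB) + 2 \<le> gtrace m M (cut M ?SA)"
    proof (rule gtrace_gap[OF _ f(1) disj M _ m])
      show "walk_edge f t \<in> F1 \<union> F2" if "t < 2 * m" for t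
        using f(2)[OF that] by (auto simp: F2_def split: if_splits)
      have "{t. t < 2 * m \<and> walk_edge f t \<in> F2} = {2 * j + 1..<2 * j + 1 + h}"
      proof (intro set_eqI iffI)
        fix t assume "t \<in> {t. t < 2 * m \<and> walk_edge f t \<in> F2}"
        then have "t < 2 * m" "walk_edge f t \<notin> F1" using disj by auto
        then show "t \<in> {2 * j + 1..<2 * j + 1 + h}" using f(2)[of t] by (auto split: if_splits)
      next
        fix t assume "t \<in> {2 * j + 1..<2 * j + 1 + h}"
        then show "t \<in> {t. t < 2 * m \<and> walk_edge f t \<in> F2}" using h(3) by (auto simp: F2_def)
      qed
      then show "odd (card {t. t < 2 * m \<and> walk_edge f t \<in> F2})" using h(2) by simp
    qed
    ultimately show ?thesis by (simp only: tnorm_power[OF m])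
  qed
  have a0: "0 \<le> a" and b0: "0 \<le> b" by (simp_all add: a_def b_def N0)
  have ab: "b < a"
  proof (rule ccontr)
    assume "\<not> b < a"
    then have "a ^ (2 * m) \<le> b ^ (2 * m)" using a0 by (intro power_mono) auto
    then show False using gap by linarith
  qed
  \<comment> \<open>The operator \<open>2 T k - 1\<close> has norm at most
    \<open>1 + \<delta>\<close>, nearly fixes \<open>X\<close> and nearly negates \<open>Y\<close>,
    so it sends \<open>B = X - Y\<close> almost to \<open>A = X + Y\<close>.\<close>
  have a_le: "a \<le> (1 + \<delta>) * b + \<delta>"
  proof -
    have TXm: "T k x \<in> ?X" if "x \<in> ?X" for x using finite_rank_operatorD(1)[OF frT[OF k(1)] that] .
    have gT: "good (T k x)" if "x \<in> ?X" for x using good_subspace TXm that by blast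
    have Bset: "B = set_op (F1 \<union> F2) (\<lambda>e. if e \<in> F1 then 1 else -1)"
      by (rule clinear_op_eqI) (use gB disj finF1 finF2 in \<open>auto simp: good_def clinear_set_op B_def X_def Y_def
        matrix_coeff_diff matrix_coeff_set_op set_mat_def\<close>)
    have FI: "finite (F1 \<union> F2)" "F1 \<union> F2 \<subseteq> I" using finF1 finF2 F1 F2 by auto
    have BX: "B \<in> ?X" unfolding Bset by (rule set_op_mem[OF FI])
    have TB: "T k B = T k X - T k Y"
    proof -
      have "X = B + Y" by (simp add: B_def)
      then have "T k X = T k B + T k Y" using finite_rank_operatorD(2)[OF frT[OF k(1)] BX Y] by simp
      then show ?thesis by simp
    qed
    \<comment> \<open>\<open>B\<close> has the entry 1 at a near edge; hence \<open>b\<close> is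
      positive and \<open>B\<close> can be normalized.\<close>
    have b1: "1 \<le> b"
    proof -
      have e: "walk_edge f1 0 \<in> F1" by (simp add: F1_def)
      then have "matrix_coeff B (fst (walk_edge f1 0)) (snd (walk_edge f1 0)) = 1"
        unfolding Bset by (simp add: matrix_coeff_set_op[OF FI(1)] set_mat_def)
      then have "cmod 1 \<le> mnorm m (matrix_coeff B)"
        using cmod_le_mnorm[OF m, of "matrix_coeff B" "fst (walk_edge f1 0)" "snd (walk_edge f1 0)"] gB
        by (simp add: good_def)
      then show ?thesis using gB by (simp add: b_def good_def schatten_norm_eq[OF m])
    qed
    have main: "?N (2 *\<^sub>C T k B - B) \<le> (1 + \<delta>) * b"
    proof -
      define s where "s = complex_of_real (1 / b)"
      have cs: "cmod s = 1 / b" using b1 by (simp add: s_def norm_divide)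
      define z where "z = s *\<^sub>C B"
      have "z = set_op (F1 \<union> F2) (\<lambda>e. s * (if e \<in> F1 then 1 else -1))"
        unfolding z_def Bset by (simp add: set_op_def complex_vector.scale_sum_right scaleC_scaleC)
      then have zX: "z \<in> ?X" using set_op_mem[OF FI] by simp
      have "?N z \<le> 1" unfolding z_def norm_good_scaleC[OF gB] cs b_def[symmetric] using b1 by simp
      then have "?N (2 *\<^sub>C T k z - z) \<le> 1 + \<delta>"
        by (rule muap_norm_bound[OF T k(1) zX])
      moreover have "2 *\<^sub>C T k z - z = s *\<^sub>C (2 *\<^sub>C T k B - B)"
        unfolding z_def finite_rank_operatorD(3)[OF frT[OF k(1)] BX]
        by (simp add: complex_vector.scale_right_diff_distrib scaleC_scaleC mult.commute)
      moreover have "good (2 *\<^sub>C T k B - B)"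
        by (intro good_diff good_scaleC gT BX gB)
      ultimately have "?N (2 *\<^sub>C T k B - B) / b \<le> 1 + \<delta>"
        by (simp add: norm_good_scaleC cs)
      then show ?thesis using b1 by (simp add: pos_divide_le_eq)
    qed
    have TY: "?N (T k Y) \<le> \<delta> / 4"
    proof -
      have e: "T k Y = (\<Sum>e\<in>F2. T k (unit_op (fst e) (snd e)))"
        unfolding Y_def using operator_set_op[OF frT[OF k(1)] finF2, of "\<lambda>_. 1"] F2 by (simp add: scaleC_one subset_iff)
      have "?N (T k Y) \<le> (\<Sum>e\<in>F2. ?N (T k (unit_op (fst e) (snd e))))"
        unfolding e
      proof (rule conjunct2[OF norm_good_sum[OF finF2]])
        fix e assume "e \<in> F2"
        then have "(fst e, snd e) \<in> I" using F2 by auto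
        then show "good (T k (unit_op (fst e) (snd e)))" by (intro gT unit_op_mem[OF m])
      qed
      also have "\<dots> \<le> (\<Sum>e\<in>F2. \<eta>)"
      proof (rule sum_mono)
        fix e assume "e \<in> F2"
        then have "e \<in> I - {..<N} \<times> {..<N}" using F2 JN by blast
        then show "?N (T k (unit_op (fst e) (snd e))) \<le> \<eta>" using N[of e] by simp
      qed
      also have "\<dots> = real (card F2) * \<eta>" by simp
      also have "\<dots> \<le> (2 * real m) * \<eta>"
      proof (rule mult_right_mono)
        have "card F2 \<le> 2 * m" using cF2 h(3) by linarith
        then show "real (card F2) \<le> 2 * real m" by linarith
      qed (use \<eta> in simp)
      also have "\<dots> = \<delta> / 4" using m by (simp add: \<eta>_def)
      finally show ?thesis .
    qed
    define P where "P = (-2) *\<^sub>C (T k X - X)"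
    define Q where "Q = 2 *\<^sub>C T k Y"
    have gP: "good P" and gQ: "good Q" and gM: "good (2 *\<^sub>C T k B - B)"
      unfolding P_def Q_def by (intro good_scaleC good_diff gT X Y BX gX gB)+
    have nP: "?N P \<le> \<delta> / 2"
      unfolding P_def norm_good_scaleC[OF good_diff[OF gT[OF X] gX]] using k(2) by simp
    have nQ: "?N Q \<le> \<delta> / 2"
      unfolding Q_def norm_good_scaleC[OF gT[OF Y]] using TY by simp
    have "A = (2 *\<^sub>C T k B - B) + (P + Q)"
    proof (rule clinear_op_eqI)
      show "clinear_op A" "clinear_op ((2 *\<^sub>C T k B - B) + (P + Q))"
        using gA good_add[OF gM good_add[OF gP gQ]] by (simp_all add: good_def)
    qed (simp add: A_def TB[unfolded B_def] B_def P_def Q_def matrix_coeff_add matrix_coeff_diff matrix_coeff_scaleC algebra_simps)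
    then have "a \<le> ?N (2 *\<^sub>C T k B - B) + ?N (P + Q)"
      unfolding a_def using norm_good_add[OF gM good_add[OF gP gQ]] by simp
    also have "\<dots> \<le> (1 + \<delta>) * b + (\<delta> / 2 + \<delta> / 2)"
      using norm_good_add[OF gP gQ] nP nQ by (intro add_mono main) linarith
    finally show ?thesis by simp
  qed
  have "a - b \<le> \<delta> * b + \<delta>" using a_le by (simp add: algebra_simps)
  also have "\<dots> \<le> \<delta> * K + \<delta>" using bK \<delta> by simp
  also have "\<dots> = \<delta> * (K + 1)" by (simp add: algebra_simps)
  finally have diff: "a - b \<le> \<delta> * (K + 1)" .
  obtain l where l: "2 * m = Suc l" "l = 2 * m - 1" using m by (cases "2 * m") auto
  have "a ^ (2 * m) - b ^ (2 * m) \<le> real (2 * m) * K ^ l * (a - b)"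
    unfolding l(1) using ab by (intro power_diff_le b0 aK) simp
  also have "\<dots> \<le> real (2 * m) * K ^ l * (\<delta> * (K + 1))"
    using K diff by (intro mult_left_mono) auto
  also have "\<dots> = 1"
    using K m by (simp add: \<delta>_def l(2))
  finally show False using gap by linarith
qed

end

text \<open>Fewer signs give a smaller constant, so the complex property implies the real one; the
  graph condition closes the cycle of implications.\<close>

lemma even_graph_condition:
  assumes "m \<ge> 1"
  shows "graph_condition (2 * m) I \<longleftrightarrow> complex_muap (schatten_subspace (2 * m) I) (schatten_norm (2 * m))"
    and "graph_condition (2 * m) I \<longleftrightarrow> real_muap (schatten_subspace (2 * m) I) (schatten_norm (2 * m))"
proof -
  let ?X = "schatten_subspace (2 * m) I" and ?N = "schatten_norm (2 * m)"
  have "real_muap ?X ?N" if c: "complex_muap ?X ?N"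
    unfolding real_muap_def muap_def
  proof (intro allI impI)
    fix \<delta> :: real assume "\<delta> > 0"
    then obtain T where T: "approximating_sequence ?X ?N T" "unconditional_constant {z. cmod z = 1} ?X ?N T \<le> ereal (1 + \<delta>)"
      using c unfolding complex_muap_def muap_def by blast
    have "unconditional_constant {-1, 1} ?X ?N T \<le> unconditional_constant {z. cmod z = 1} ?X ?N T"
      unfolding unconditional_constant_def
    proof (rule Inf_superset_mono, clarify)
      fix D n and \<epsilon> :: "nat \<Rightarrow> complex"
      assume D: "\<forall>n \<epsilon>. (\<forall>k. \<epsilon> k \<in> {z. cmod z = 1}) \<longrightarrow> operator_norm ?X ?N (\<lambda>x. \<Sum>k=1..n. \<epsilon> k *\<^sub>C op_diff T k x) \<le> D"
        and \<epsilon>: "\<forall>k. \<epsilon> k \<in> {-1, 1}"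
      have "\<epsilon> k \<in> {z. cmod z = 1}" for k using \<epsilon>[rule_format, of k] by auto
      then show "operator_norm ?X ?N (\<lambda>x. \<Sum>k=1..n. \<epsilon> k *\<^sub>C op_diff T k x) \<le> D" using D by blast
    qed
    then show "\<exists>T. approximating_sequence ?X ?N T \<and> unconditional_constant {-1, 1} ?X ?N T \<le> ereal (1 + \<delta>)"
      using T order_trans by blast
  qed
  then show "graph_condition (2 * m) I \<longleftrightarrow> complex_muap ?X ?N" "graph_condition (2 * m) I \<longleftrightarrow> real_muap ?X ?N"
    using graph_condition_imp_complex_muap[OF assms, of I] real_muap_imp_graph_condition[OF assms, of I] by blast+
qed

theorem theorem1p8:
  fixes I :: "(nat \<times> nat) set" and p :: nat
  assumes "even p" and "p \<ge> 2"
  shows "(complex_muap (schatten_subspace p I) (schatten_norm p)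
            \<longleftrightarrow> real_muap (schatten_subspace p I) (schatten_norm p))
       \<and> (real_muap (schatten_subspace p I) (schatten_norm p)
            \<longleftrightarrow> (\<forall>r c j. graph_dist I (Inl r) (Inr c) = enat (2 * j + 1) \<and> 2 * j + 1 \<le> p div 2
                   \<longrightarrow> asymptotic_dist I r c \<ge> enat (p - 2 * j + 1)))"
proof -
  obtain m where m: "p = 2 * m" "m \<ge> 1" using assms by (auto elim!: evenE)
  show ?thesis
    using even_graph_condition[OF m(2), of I] unfolding m(1) graph_condition_def by blast
qed

end
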